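(* Let $X$ be a sigma-finite measure space with measure denoted $dx$, let $t$ be a closed non-negative quadratic form in $L^2(X)$ with domain $\mathrm{dom}\,t$, and let $T$ be the corresponding self-adjoint operator. Let $2<q<\infty$ and $0<\theta<1$, and suppose that there is a constant $S>0$ such that for all $u\in\mathrm{dom}\,t$, $$ t[u]^\theta\,\|u\|^{2(1-\theta)}\geq S\left(\int_X|u|^q\,dx\right)^{2/q}. $$ Assume that $t$ satisfies the generalized Beurling--Deny conditions with parameter $q/(q-2)$. Define $0<\kappa<\infty$ and $0<\gamma<\infty$ by $$ \gamma=\frac{q(1-\theta)}{q-2},\qquad \kappa=\frac{q\theta}{q-2}. $$ Then for all $\tilde\gamma>\gamma$ and for all $0\leq V\in L^{\tilde\gamma+\kappa}(X)$ one has $$ \mathrm{Tr}\,(T-V)_-^{\tilde\gamma}\ \leq\ L_{\tilde\gamma}\int_X V^{\tilde\gamma+\kappa}\,dx $$ with a constant $L_{\tilde\gamma}$ satisfying $$ L_{\tilde\gamma}\ \leq\ \frac{\tilde\gamma^{\tilde\gamma+1}}{\gamma^\gamma(\tilde\gamma-\gamma)^{\tilde\gamma-\gamma}}\ \frac{\Gamma(\gamma+\kappa+1)\,\Gamma(\tilde\gamma-\gamma)}{\Gamma(\tilde\gamma+\kappa+1)}\ L, $$ where $L$ is the sharp (smallest possible) constant in the weak LT inequality $$ N(-\tau,T-W)\leq L\,\tau^{-\gamma}\int_X W^{\gamma+\kappa}\,dx\qquad\text{for all } 0\leq W\in L^{\gamma+\kappa}(X)\text{ and all }\tau>0. $$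
   Context: $L^2(X)$ is the complex Hilbert space of square-integrable functions with respect to $dx$, with norm $\|\cdot\|$; $L^p(X)$ is the usual $L^p$ space, and for a non-negative function $w$ on $X$, $L^p(X,w)$ is the $L^p$ space with respect to the measure $w(x)\,dx$. The form $t$ is densely defined (so that $T$ exists). $\Gamma(\cdot)$ is the Gamma function. Generalized Beurling--Deny conditions with parameter $p\in(1,\infty)$ (here used with $p=q/(q-2)=\gamma+\kappa$): (i) if $u,v\in\mathrm{dom}\,t$ are real-valued then $t[u+iv]=t[u]+t[v]$; (ii) if $u\in\mathrm{dom}\,t$ is real-valued then $|u|\in\mathrm{dom}\,t$ and $t[|u|]\leq t[u]$; (iii) there is a measurable, a.e. positive function $\omega$ on $X$ such that if $u\in\mathrm{dom}\,t$ is non-negative then $\min(u,\omega)\in\mathrm{dom}\,t$ and $t[\min(u,\omega)]\leq t[u]$; moreover, there is a form core $\mathcal Q$ of $t$ such that $\omega^{-1}\mathcal Q$ is dense in $L^2(X,\omega^{2p/(p-1)})$. For $\tau\geq0$, $N(-\tau,T-V)$ denotes the number of eigenvalues of the operator $T-V$ less than $-\tau$, counted with multiplicity. The operator $T-V$ is understood in the sense of quadratic forms, and by the variational principle $N(-\tau,T-V)$ is the supremum of $\dim M$ over subspaces $M\subset\mathrm{dom}\,t$ such that $t[u]+\tau\int_X|u|^2\,dx<\int_X V|u|^2\,dx$ for all $0\neq u\in M$. $(T-V)_-$ is the negative part of $T-V$, so $\mathrm{Tr}\,(T-V)_-^{\tilde\gamma}=\sum_j|\lambda_j|^{\tilde\gamma}$,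 where $\lambda_j$ are the negative eigenvalues of $T-V$ counted with multiplicity; equivalently it equals $\tilde\gamma\int_0^\infty N(-\tau,T-V)\,\tau^{\tilde\gamma-1}\,d\tau$.
   Formalization: Condition (i) is read as saying that t is a real form: it is additionally assumed that the real part of every u in dom t lies in dom t. Without this, dom t may contain no non-zero real-valued function, (i)–(iii) can hold vacuously, and the claim is false. *)

theory Defs
  imports "HOL-Analysis.Analysis"
begin

text \<open>
  Elements of the complex Hilbert space L2 are represented by functions, two functions being
  identified when they agree almost everywhere. The inner product is linear in the first argument.
\<close>

definition L2 :: "'a measure \<Rightarrow> ('a \<Rightarrow> complex) set" where
  "L2 M = {u \<in> borel_measurable M. integrable M (\<lambda>x. (cmod (u x))\<^sup>2)}"

definition L2_inner :: "'a measure \<Rightarrow> ('a \<Rightarrow> complex) \<Rightarrow> ('a \<Rightarrow> complex) \<Rightarrow> complex" where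
  "L2_inner M u v = (\<integral>x. u x * cnj (v x) \<partial>M)"

definition L2_norm :: "'a measure \<Rightarrow> ('a \<Rightarrow> complex) \<Rightarrow> real" where
  "L2_norm M u = sqrt (\<integral>x. (cmod (u x))\<^sup>2 \<partial>M)"

definition L2_dense :: "'a measure \<Rightarrow> ('a \<Rightarrow> complex) set \<Rightarrow> bool" where
  "L2_dense M A \<longleftrightarrow> A \<subseteq> L2 M \<and>
     (\<forall>f\<in>L2 M. \<forall>\<epsilon>>0. \<exists>g\<in>A. L2_norm M (\<lambda>x. f x - g x) < \<epsilon>)"

definition fun_subspace :: "('a \<Rightarrow> complex) set \<Rightarrow> bool" where
  "fun_subspace A \<longleftrightarrow> (\<lambda>x. 0) \<in> A \<and>
     (\<forall>u\<in>A. \<forall>v\<in>A. (\<lambda>x. u x + v x) \<in> A) \<and> (\<forall>c. \<forall>u\<in>A. (\<lambda>x. c * u x) \<in> A)"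

text \<open>The dimension is that of the image in L2: linear independence is understood modulo null sets.\<close>

definition L2_independent :: "'a measure \<Rightarrow> nat \<Rightarrow> (nat \<Rightarrow> 'a \<Rightarrow> complex) \<Rightarrow> bool" where
  "L2_independent M n w \<longleftrightarrow>
     (\<forall>c. (AE x in M. (\<Sum>i<n. c i * w i x) = 0) \<longrightarrow> (\<forall>i<n. c i = 0))"

definition L2_dim :: "'a measure \<Rightarrow> ('a \<Rightarrow> complex) set \<Rightarrow> enat" where
  "L2_dim M E = Sup {enat n | n. \<exists>w. (\<forall>i<n. w i \<in> E) \<and> L2_independent M n w}"

definition nonneg_Lp :: "'a measure \<Rightarrow> real \<Rightarrow> ('a \<Rightarrow> real) set" where
  "nonneg_Lp M p =
     {V \<in> borel_measurable M. (AE x in M. 0 \<le> V x) \<and> integrable M (\<lambda>x. V x powr p)}"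

text \<open>
  A quadratic form is given by its sesquilinear form \<open>t\<close> on the domain \<open>D\<close>; the value
  on the diagonal (real, by Hermitian symmetry) is \<open>qform t u\<close>.
\<close>

type_synonym 'a sform = "('a \<Rightarrow> complex) \<Rightarrow> ('a \<Rightarrow> complex) \<Rightarrow> complex"

definition qform :: "'a sform \<Rightarrow> ('a \<Rightarrow> complex) \<Rightarrow> real" where
  "qform t u = Re (t u u)"

definition nonneg_form :: "'a measure \<Rightarrow> ('a \<Rightarrow> complex) set \<Rightarrow> 'a sform \<Rightarrow> bool" where
  "nonneg_form M D t \<longleftrightarrow>
     D \<subseteq> L2 M \<and> fun_subspace D \<and>
     (\<forall>u\<in>D. \<forall>v\<in>borel_measurable M. (AE x in M. u x = v x) \<longrightarrow>
        v \<in> D \<and> (\<forall>w\<in>D. t u w = t v w)) \<and>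
     (\<forall>u\<in>D. \<forall>v\<in>D. \<forall>w\<in>D. t (\<lambda>x. u x + v x) w = t u w + t v w) \<and>
     (\<forall>c. \<forall>u\<in>D. \<forall>v\<in>D. t (\<lambda>x. c * u x) v = c * t u v) \<and>
     (\<forall>u\<in>D. \<forall>v\<in>D. t v u = cnj (t u v)) \<and>
     (\<forall>u\<in>D. 0 \<le> qform t u)"

definition closed_form :: "'a measure \<Rightarrow> ('a \<Rightarrow> complex) set \<Rightarrow> 'a sform \<Rightarrow> bool" where
  "closed_form M D t \<longleftrightarrow>
     (\<forall>U. \<forall>u\<in>L2 M. (\<forall>n::nat. U n \<in> D) \<longrightarrow>
        (\<lambda>n. L2_norm M (\<lambda>x. U n x - u x)) \<longlonglongrightarrow> 0 \<longrightarrow>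
        (\<forall>\<epsilon>>0. \<exists>n0. \<forall>m\<ge>n0. \<forall>n\<ge>n0. qform t (\<lambda>x. U m x - U n x) < \<epsilon>) \<longrightarrow>
        u \<in> D \<and> (\<lambda>n. qform t (\<lambda>x. U n x - u x)) \<longlonglongrightarrow> 0)"

definition form_core ::
  "'a measure \<Rightarrow> ('a \<Rightarrow> complex) set \<Rightarrow> 'a sform \<Rightarrow> ('a \<Rightarrow> complex) set \<Rightarrow> bool" where
  "form_core M D t Q \<longleftrightarrow> Q \<subseteq> D \<and> fun_subspace Q \<and>
     (\<forall>u\<in>D. \<forall>\<epsilon>>0. \<exists>v\<in>Q.
        qform t (\<lambda>x. u x - v x) + (L2_norm M (\<lambda>x. u x - v x))\<^sup>2 < \<epsilon>)"

text \<open>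
  The generalized Beurling--Deny conditions. The first clause is the part of reality of the form
  that concerns its domain: \<open>D\<close> is the complexification of its real-valued members
  (imaginary parts are covered, since \<open>D\<close> is a complex subspace). Without it \<open>D\<close>
  could contain no real-valued function but zero, and the remaining clauses would say nothing
  about \<open>t\<close>.
\<close>

definition beurling_deny ::
  "'a measure \<Rightarrow> ('a \<Rightarrow> complex) set \<Rightarrow> 'a sform \<Rightarrow> real \<Rightarrow> bool" where
  "beurling_deny M D t p \<longleftrightarrow>
     (\<forall>f\<in>D. (\<lambda>x. complex_of_real (Re (f x))) \<in> D) \<and>
     (\<forall>u v :: 'a \<Rightarrow> real.
        (\<lambda>x. complex_of_real (u x)) \<in> D \<longrightarrow> (\<lambda>x. complex_of_real (v x)) \<in> D \<longrightarrow>
        qform t (\<lambda>x. complex_of_real (u x) + \<i> * complex_of_real (v x)) =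
          qform t (\<lambda>x. complex_of_real (u x)) + qform t (\<lambda>x. complex_of_real (v x))) \<and>
     (\<forall>u :: 'a \<Rightarrow> real. (\<lambda>x. complex_of_real (u x)) \<in> D \<longrightarrow>
        (\<lambda>x. complex_of_real \<bar>u x\<bar>) \<in> D \<and>
        qform t (\<lambda>x. complex_of_real \<bar>u x\<bar>) \<le> qform t (\<lambda>x. complex_of_real (u x))) \<and>
     (\<exists>\<omega> \<in> borel_measurable M. (AE x in M. (0::real) < \<omega> x) \<and>
        (\<forall>u :: 'a \<Rightarrow> real. (\<lambda>x. complex_of_real (u x)) \<in> D \<longrightarrow> (AE x in M. 0 \<le> u x) \<longrightarrow>
           (\<lambda>x. complex_of_real (min (u x) (\<omega> x))) \<in> D \<and>
           qform t (\<lambda>x. complex_of_real (min (u x) (\<omega> x)))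
             \<le> qform t (\<lambda>x. complex_of_real (u x))) \<and>
        (\<exists>Q. form_core M D t Q \<and>
           L2_dense (density M (\<lambda>x. ennreal (\<omega> x powr (2 * p / (p - 1)))))
             ((\<lambda>u x. u x / complex_of_real (\<omega> x)) ` Q)))"

text \<open>
  The operator associated with a form by the first representation theorem, as a graph. In
  \<open>form_minus\<close> the potential term is meant for potentials for which it converges absolutely
  on \<open>D\<close>; under a Sobolev inequality this holds for all potentials in the relevant
  \<open>Lp\<close> spaces, by Hoelder's inequality.
\<close>

type_synonym 'a L2_op = "(('a \<Rightarrow> complex) \<times> ('a \<Rightarrow> complex)) set"

definition form_op :: "'a measure \<Rightarrow> ('a \<Rightarrow> complex) set \<Rightarrow> 'a sform \<Rightarrow> 'a L2_op" where
  "form_op M D s = {(u, f). u \<in> D \<and> f \<in> L2 M \<and> (\<forall>v\<in>D. s u v = L2_inner M f v)}"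

definition form_minus :: "'a measure \<Rightarrow> 'a sform \<Rightarrow> ('a \<Rightarrow> real) \<Rightarrow> 'a sform" where
  "form_minus M t V =
     (\<lambda>u v. t u v - (\<integral>x. complex_of_real (V x) * u x * cnj (v x) \<partial>M))"

definition schroedinger_op ::
  "'a measure \<Rightarrow> ('a \<Rightarrow> complex) set \<Rightarrow> 'a sform \<Rightarrow> ('a \<Rightarrow> real) \<Rightarrow> 'a L2_op" where
  "schroedinger_op M D t V = form_op M D (form_minus M t V)"

definition eigenspace :: "'a L2_op \<Rightarrow> real \<Rightarrow> ('a \<Rightarrow> complex) set" where
  "eigenspace A \<mu> = {u. (u, \<lambda>x. complex_of_real \<mu> * u x) \<in> A}"

definition eigenvalue :: "'a measure \<Rightarrow> 'a L2_op \<Rightarrow> real \<Rightarrow> bool" where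
  "eigenvalue M A \<mu> \<longleftrightarrow> (\<exists>u\<in>eigenspace A \<mu>. \<not> (AE x in M. u x = 0))"

definition multiplicity_of :: "'a measure \<Rightarrow> 'a L2_op \<Rightarrow> real \<Rightarrow> ennreal" where
  "multiplicity_of M A \<mu> = ennreal_of_enat (L2_dim M (eigenspace A \<mu>))"

text \<open>
  Both quantities below sum over eigenvalues, with multiplicities. They agree with the dimension of
  the spectral subspace and with the operator trace whenever the negative spectrum is discrete.
\<close>

definition num_eigenvalues_below :: "'a measure \<Rightarrow> real \<Rightarrow> 'a L2_op \<Rightarrow> ennreal" where
  "num_eigenvalues_below M r A = (\<Sum>\<^sub>\<infinity>\<mu>\<in>{\<mu>. eigenvalue M A \<mu> \<and> \<mu> < r}. multiplicity_of M A \<mu>)"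

definition trace_neg_part :: "'a measure \<Rightarrow> real \<Rightarrow> 'a L2_op \<Rightarrow> ennreal" where
  "trace_neg_part M g A =
     (\<Sum>\<^sub>\<infinity>\<mu>\<in>{\<mu>. eigenvalue M A \<mu> \<and> \<mu> < 0}. multiplicity_of M A \<mu> * ennreal (\<bar>\<mu>\<bar> powr g))"

definition weak_LT ::
  "'a measure \<Rightarrow> ('a \<Rightarrow> complex) set \<Rightarrow> 'a sform \<Rightarrow> real \<Rightarrow> real \<Rightarrow> real \<Rightarrow> bool" where
  "weak_LT M D t \<gamma> \<kappa> C \<longleftrightarrow>
     (\<forall>W\<in>nonneg_Lp M (\<gamma> + \<kappa>). \<forall>\<tau>>0.
        num_eigenvalues_below M (-\<tau>) (schroedinger_op M D t W)
          \<le> ennreal (C * \<tau> powr (-\<gamma>) * (\<integral>x. W x powr (\<gamma> + \<kappa>) \<partial>M)))"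

definition sharp_weak_LT ::
  "'a measure \<Rightarrow> ('a \<Rightarrow> complex) set \<Rightarrow> 'a sform \<Rightarrow> real \<Rightarrow> real \<Rightarrow> real \<Rightarrow> bool" where
  "sharp_weak_LT M D t \<gamma> \<kappa> L \<longleftrightarrow>
     0 \<le> L \<and> weak_LT M D t \<gamma> \<kappa> L \<and> (\<forall>C\<ge>0. weak_LT M D t \<gamma> \<kappa> C \<longrightarrow> L \<le> C)"

end

theory Submission imports Defs "HOL-Library.Function_Algebras"
begin

text \<open>
  The assertion has two parts: the weak inequality holds with some finite constant, so that a
  sharp constant \<open>L\<close> exists; and the weak inequality with constant \<open>L\<close> implies the trace bound.

  Throughout, eigenvalues below \<open>\<rho>\<close> are counted by subspaces on which the form of
  \<open>\<rho> - (T - V)\<close> is positive. Eigenvectors span such a subspace (\<open>eigenspaces_pos_family\<close>).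
  Conversely, if the dimensions of these subspaces are bounded, then a positive subspace of
  dimension \<open>n\<close> forces \<open>n\<close> orthonormal eigenvectors (\<open>eigenvectors_below\<close>). No spectral
  theorem is needed: \<open>T - V\<close> is minimised successively on orthogonal complements, and the
  minimising sequences converge because the form of \<open>\<rho> - (T - V)\<close> is dominated by finitely many
  rank one forms (\<open>finite_index_bound\<close>).

  The weak inequality with some constant follows from a bound of Cwikel--Lieb--Rozenblum type,
  \<open>CLR_bound\<close>. By Young's inequality the form \<open>a = t + \<tau>\<close> satisfies
  \<open>a[u] \<ge> S \<tau> powr (1 - \<theta>) \<parallel>u\<parallel>\<^sub>q\<^sup>2\<close>, so one has to bound by a constant times \<open>\<integral>W powr p\<close>,
  \<open>p = q / (q - 2)\<close>, the dimension of subspaces on which \<open>a[u] < \<integral>W \<bar>u\<bar>\<^sup>2\<close>. The method is that of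
  Li and Yau, with powers of a resolvent in place of the heat semigroup. Let \<open>A\<close> be the operator
  of \<open>a\<close> in \<open>L2(W dx)\<close> and \<open>P = \<lambda> (A + \<lambda>)\<^sup>-\<^sup>1\<close>. Since \<open>a[\<bar>Re u\<bar>] \<le> a[u]\<close>, the operator \<open>P\<close> preserves
  non-negativity. For a finite orthonormal family of non-negative \<open>e i\<close> put
  \<open>z k = \<Sum>i. \<parallel>P\<^sup>k (e i)\<parallel>\<^sup>2\<close>. Then \<open>\<Sum>i. a[P\<^sup>k (e i)]\<close> is at most \<open>\<lambda> / 2\<close> times the decrement
  \<open>z (k - 1) - z k\<close>, and the Sobolev and Hoelder inequalities turn this into a difference inequality
  for \<open>z\<close> (\<open>trace_decay\<close>). For \<open>\<lambda> = k\<close> large it bounds \<open>z k\<close> by a constant times \<open>\<integral>W powr p\<close>,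
  independently of \<open>z 0\<close>, that is, of the size of the family (\<open>discrete_decay\<close>). On the other
  hand \<open>P\<^sup>k\<close> is bounded below where \<open>A \<le> 1\<close>. The \<open>e i\<close> are the normalised indicators of a
  partition fine enough to approximate a basis of the given subspace, so that neither compactness
  of \<open>P\<close> nor the existence of an integral kernel is required.

  For the trace bound, part of the spectral shift is moved into the potential:
  \<open>N(-\<tau>, T - V) \<le> N(-(1 - \<sigma>) \<tau>, T - max 0 (V - \<sigma> \<tau>))\<close> for \<open>0 < \<sigma> < 1\<close>. Inserting the weak inequality
  and integrating against \<open>\<gamma>' \<tau> powr (\<gamma>' - 1)\<close> produces a Beta integral (\<open>trace_bound\<close>), and
  \<open>\<sigma> = (\<gamma>' - \<gamma>) / \<gamma>'\<close> gives the stated constant (\<open>optimal_split\<close>).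
\<close>

section \<open>Hermitian forms on complex vector spaces\<close>

text \<open>Homogeneous linear systems with more unknowns than equations.\<close>

lemma nontrivial_solution:
  fixes A :: "nat \<Rightarrow> 'i \<Rightarrow> complex"
  assumes "finite I" "k < card I"
  shows "\<exists>c. (\<exists>i\<in>I. c i \<noteq> 0) \<and> (\<forall>j<k. (\<Sum>i\<in>I. c i * A j i) = 0)"
  using assms
proof (induction k arbitrary: A I)
  case 0
  then obtain i where "i \<in> I" by (metis card.empty ex_in_conv less_irrefl)
  then show ?case by (intro exI[of _ "\<lambda>_. 1"]) auto
next
  case (Suc k)
  show ?case
  proof (cases "\<forall>i\<in>I. A k i = 0")
    case True
    obtain c where c: "\<exists>i\<in>I. c i \<noteq> 0" "\<And>j. j < k \<Longrightarrow> (\<Sum>i\<in>I. c i * A j i) = 0"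
      using Suc.IH[of I A] Suc.prems by auto
    have "(\<Sum>i\<in>I. c i * A k i) = 0" using True by simp
    then show ?thesis using c by (intro exI[of _ c]) (auto simp: less_Suc_eq)
  next
    case False
    then obtain p where p: "p \<in> I" "A k p \<noteq> 0" by blast
    define A' where "A' j i = A j i - A j p * A k i / A k p" for j i
    have "k < card (I - {p})" using Suc.prems p by simp
    then obtain c where c: "\<exists>i\<in>I - {p}. c i \<noteq> 0" "\<And>j. j < k \<Longrightarrow> (\<Sum>i\<in>I - {p}. c i * A' j i) = 0"
      using Suc.IH[of "I - {p}" A'] Suc.prems by auto
    define x where "x = - (\<Sum>i\<in>I - {p}. c i * A k i) / A k p"
    have split: "(\<Sum>i\<in>I. (c(p := x)) i * A j i) = x * A j p + (\<Sum>i\<in>I - {p}. c i * A j i)" for j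
      using Suc.prems p by (simp add: sum.remove[of I p])
    have "(\<Sum>i\<in>I. (c(p := x)) i * A j i) = 0" if "j < Suc k" for j
    proof (cases "j = k")
      case True
      then show ?thesis unfolding split by (simp add: x_def p)
    next
      case False
      then have "0 = (\<Sum>i\<in>I - {p}. c i * A' j i)" using c(2)[of j] that by simp
      also have "\<dots> = (\<Sum>i\<in>I - {p}. c i * A j i) - A j p / A k p * (\<Sum>i\<in>I - {p}. c i * A k i)"
        by (simp add: A'_def sum_subtractf sum_distrib_left algebra_simps)
      finally show ?thesis unfolding split by (simp add: x_def algebra_simps)
    qed
    then show ?thesis using c(1) p by (intro exI[of _ "c(p := x)"]) auto
  qed
qed

lemma bounded_tuple_convergent_subseq:
  fixes f :: "nat \<Rightarrow> nat \<Rightarrow> complex"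
  assumes "\<And>i. i < N \<Longrightarrow> bounded (range (f i))"
  shows "\<exists>r. strict_mono r \<and> (\<forall>i<N. convergent (f i \<circ> r))"
  using assms
proof (induction N)
  case 0
  show ?case by (intro exI[of _ id]) (simp add: strict_mono_def)
next
  case (Suc N)
  then have "\<exists>r. strict_mono r \<and> (\<forall>i<N. convergent (f i \<circ> r))" by (meson less_SucI)
  then obtain r where r: "strict_mono r" "\<And>i. i < N \<Longrightarrow> convergent (f i \<circ> r)" by blast
  have "bounded (range (f N \<circ> r))"
    using Suc.prems[of N] by (rule bounded_subset) auto
  then obtain l r' where r': "strict_mono r'" "((f N \<circ> r) \<circ> r') \<longlonglongrightarrow> l"
    using bounded_imp_convergent_subsequence by blast
  have "convergent (f i \<circ> (r \<circ> r'))" if "i < Suc N" for i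
  proof (cases "i = N")
    case True
    then show ?thesis using r'(2) by (auto simp: convergent_def comp_assoc)
  next
    case False
    then have "convergent (f i \<circ> r)" using r(2) that by simp
    then show ?thesis using convergent_subseq_convergent[OF _ r'(1)] by (metis comp_assoc)
  qed
  then show ?case using strict_mono_o[OF r(1) r'(1)] by blast
qed

text \<open>
  A sesquilinear form, linear in the first argument, with Hermitian symmetry. The vectors form a
  complex vector space with a scalar multiplication given explicitly, because functions will be
  used as vectors. The form is only specified on the subspace \<open>D\<close>, its domain.
\<close>

locale hermitian_form = vector_space scale
  for scale :: "complex \<Rightarrow> 'v::ab_group_add \<Rightarrow> 'v" (infixr \<open>*\<^sub>C\<close> 75) +
  fixes D :: "'v set" and h :: "'v \<Rightarrow> 'v \<Rightarrow> complex"
  assumes subspace: "subspace D"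
    and add_left: "\<And>u v w. u \<in> D \<Longrightarrow> v \<in> D \<Longrightarrow> w \<in> D \<Longrightarrow> h (u + v) w = h u w + h v w"
    and scale_left: "\<And>c u v. u \<in> D \<Longrightarrow> v \<in> D \<Longrightarrow> h (c *\<^sub>C u) v = c * h u v"
    and hermitian: "\<And>u v. u \<in> D \<Longrightarrow> v \<in> D \<Longrightarrow> h v u = cnj (h u v)"
begin

lemma D_zero [simp]: "0 \<in> D"
  and D_add [simp]: "u \<in> D \<Longrightarrow> v \<in> D \<Longrightarrow> u + v \<in> D"
  and D_scale [simp]: "u \<in> D \<Longrightarrow> c *\<^sub>C u \<in> D"
  and D_diff [simp]: "u \<in> D \<Longrightarrow> v \<in> D \<Longrightarrow> u - v \<in> D"
  and D_sum: "(\<And>i. i \<in> I \<Longrightarrow> f i \<in> D) \<Longrightarrow> sum f I \<in> D"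
  using subspace by (auto simp: subspace_0 subspace_add subspace_scale subspace_diff subspace_sum)

lemma add_right: "u \<in> D \<Longrightarrow> v \<in> D \<Longrightarrow> w \<in> D \<Longrightarrow> h w (u + v) = h w u + h w v"
  by (metis D_add add_left complex_cnj_add hermitian)

lemma scale_right: "u \<in> D \<Longrightarrow> v \<in> D \<Longrightarrow> h u (c *\<^sub>C v) = cnj c * h u v"
  by (metis D_scale scale_left complex_cnj_mult hermitian)

lemma diff_left: "u \<in> D \<Longrightarrow> v \<in> D \<Longrightarrow> w \<in> D \<Longrightarrow> h (u - v) w = h u w - h v w"
  by (metis D_diff add_left add_diff_cancel_right' diff_add_cancel)

lemma diff_right: "u \<in> D \<Longrightarrow> v \<in> D \<Longrightarrow> w \<in> D \<Longrightarrow> h w (u - v) = h w u - h w v"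
  by (metis D_diff add_right add_diff_cancel_right' diff_add_cancel)

lemma zero_left [simp]: "w \<in> D \<Longrightarrow> h 0 w = 0"
  using diff_left[of 0 0 w] by simp

lemma sum_left:
  assumes "\<And>i. i \<in> I \<Longrightarrow> f i \<in> D" "w \<in> D"
  shows "h (sum f I) w = (\<Sum>i\<in>I. h (f i) w)"
  using assms(1)
proof (induction I rule: infinite_finite_induct)
  case (insert i I)
  then show ?case using assms(2) by (simp add: add_left D_sum)
qed (use assms(2) in auto)

lemma sum_right:
  assumes "\<And>i. i \<in> I \<Longrightarrow> f i \<in> D" "w \<in> D"
  shows "h w (sum f I) = (\<Sum>i\<in>I. h w (f i))"
proof -
  have "h w (sum f I) = cnj (h (sum f I) w)"
    using assms by (intro hermitian D_sum)
  also have "\<dots> = (\<Sum>i\<in>I. cnj (h (f i) w))"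
    using assms by (simp add: sum_left)
  also have "\<dots> = (\<Sum>i\<in>I. h w (f i))"
    using assms by (intro sum.cong refl) (auto intro!: hermitian[symmetric])
  finally show ?thesis .
qed

abbreviation quad :: "'v \<Rightarrow> real" where "quad u \<equiv> Re (h u u)"

lemma Im_diag: "u \<in> D \<Longrightarrow> Im (h u u) = 0"
  using hermitian[of u u] by (simp add: complex_eq_iff)

lemma quad_add: "u \<in> D \<Longrightarrow> v \<in> D \<Longrightarrow> quad (u + v) = quad u + 2 * Re (h u v) + quad v"
  using hermitian[of u v] by (simp add: add_left add_right)

lemma quad_diff: "u \<in> D \<Longrightarrow> v \<in> D \<Longrightarrow> quad (u - v) = quad u - 2 * Re (h u v) + quad v"
  using hermitian[of u v] by (simp add: diff_left diff_right)

lemma quad_scale: "u \<in> D \<Longrightarrow> quad (c *\<^sub>C u) = (cmod c)\<^sup>2 * quad u"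
proof -
  assume u: "u \<in> D"
  have "h (c *\<^sub>C u) (c *\<^sub>C u) = (c * cnj c) * h u u"
    using u by (simp add: scale_left scale_right)
  then show ?thesis by (simp only: complex_norm_square[symmetric] scaleR_conv_of_real[symmetric] scaleR_complex.sel)
qed

lemma quad_commute: "u \<in> D \<Longrightarrow> v \<in> D \<Longrightarrow> quad (u - v) = quad (v - u)"
  using hermitian[of u v] by (simp add: quad_diff)

lemma parallelogram:
  "u \<in> D \<Longrightarrow> v \<in> D \<Longrightarrow> quad (u + v) + quad (u - v) = 2 * quad u + 2 * quad v"
  by (simp add: quad_add quad_diff)

text \<open>Families are indexed by natural numbers below a bound; values beyond it are irrelevant.\<close>

definition orthonormal :: "nat \<Rightarrow> (nat \<Rightarrow> 'v) \<Rightarrow> bool" where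
  "orthonormal n e \<longleftrightarrow> (\<forall>i<n. e i \<in> D) \<and> (\<forall>i<n. \<forall>j<n. h (e i) (e j) = (if i = j then 1 else 0))"

definition lincomb :: "nat \<Rightarrow> (nat \<Rightarrow> 'v) \<Rightarrow> (nat \<Rightarrow> complex) \<Rightarrow> 'v" where
  "lincomb n w c = (\<Sum>i<n. c i *\<^sub>C w i)"

text \<open>
  A family of \<open>n\<close> vectors on whose span the form is positive definite; in particular the
  family is linearly independent. The largest such \<open>n\<close> is the positive inertia index of
  the form.
\<close>

definition pos_family :: "nat \<Rightarrow> (nat \<Rightarrow> 'v) \<Rightarrow> bool" where
  "pos_family n w \<longleftrightarrow> (\<forall>i<n. w i \<in> D) \<and>
     (\<forall>c. (\<exists>i<n. c i \<noteq> 0) \<longrightarrow> 0 < quad (lincomb n w c))"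

lemma lincomb_in: "(\<And>i. i < n \<Longrightarrow> w i \<in> D) \<Longrightarrow> lincomb n w c \<in> D"
  unfolding lincomb_def by (intro D_sum) auto

lemma orthonormal_in: "orthonormal n e \<Longrightarrow> i < n \<Longrightarrow> e i \<in> D"
  by (simp add: orthonormal_def)

lemma coeff_lincomb:
  assumes "orthonormal n e" "j < n"
  shows "h (lincomb n e c) (e j) = c j"
proof -
  have "h (lincomb n e c) (e j) = (\<Sum>i<n. c i * h (e i) (e j))"
    unfolding lincomb_def using assms by (subst sum_left) (auto simp: orthonormal_in scale_left)
  also have "\<dots> = (\<Sum>i<n. if i = j then c j else 0)"
    using assms by (intro sum.cong) (auto simp: orthonormal_def)
  finally show ?thesis using assms by simp
qed

lemma pairing_lincomb:
  assumes "\<And>i. i < n \<Longrightarrow> e i \<in> D" "u \<in> D"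
  shows "h u (lincomb n e c) = (\<Sum>i<n. cnj (c i) * h u (e i))"
  unfolding lincomb_def using assms by (subst sum_right) (auto simp: scale_right)

lemma quad_lincomb:
  assumes "orthonormal n e"
  shows "quad (lincomb n e c) = (\<Sum>i<n. (cmod (c i))\<^sup>2)"
proof -
  have "h (lincomb n e c) (lincomb n e c) = (\<Sum>i<n. cnj (c i) * c i)"
    using assms by (simp add: pairing_lincomb orthonormal_in lincomb_in coeff_lincomb)
  then show ?thesis
    by (simp add: mult.commute flip: complex_norm_square)
qed

text \<open>The orthogonal projection onto the span of an orthonormal family, and its remainder.\<close>

definition proj :: "nat \<Rightarrow> (nat \<Rightarrow> 'v) \<Rightarrow> 'v \<Rightarrow> 'v" where
  "proj n e u = lincomb n e (\<lambda>i. h u (e i))"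

lemma proj_in: "orthonormal n e \<Longrightarrow> proj n e u \<in> D"
  by (simp add: proj_def lincomb_in orthonormal_in)

lemma remainder_orthogonal:
  assumes "orthonormal n e" "u \<in> D" "i < n"
  shows "h (u - proj n e u) (e i) = 0"
  using assms by (simp add: diff_left proj_in orthonormal_in) (simp add: proj_def coeff_lincomb)

lemma quad_remainder:
  assumes "orthonormal n e" "u \<in> D"
  shows "quad (u - proj n e u) = quad u - (\<Sum>i<n. (cmod (h u (e i)))\<^sup>2)"
proof -
  have "h u (proj n e u) = (\<Sum>i<n. cnj (h u (e i)) * h u (e i))"
    using assms by (simp add: proj_def pairing_lincomb orthonormal_in)
  then have "Re (h u (proj n e u)) = (\<Sum>i<n. (cmod (h u (e i)))\<^sup>2)"
    by (simp add: mult.commute flip: complex_norm_square)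
  then show ?thesis
    using assms by (simp add: quad_diff proj_in) (simp add: proj_def quad_lincomb)
qed

lemma pos_familyD: "pos_family n w \<Longrightarrow> \<exists>i<n. c i \<noteq> 0 \<Longrightarrow> 0 < quad (lincomb n w c)"
  by (simp add: pos_family_def)

lemma pos_family_mono:
  assumes "pos_family n w" "m \<le> n"
  shows "pos_family m w"
  unfolding pos_family_def
proof (intro conjI allI impI)
  fix c :: "nat \<Rightarrow> complex" assume "\<exists>i<m. c i \<noteq> 0"
  then have "\<exists>i<n. (if i < m then c i else 0) \<noteq> 0"
    using assms(2) by (meson order_less_le_trans)
  then have "0 < quad (lincomb n w (\<lambda>i. if i < m then c i else 0))"
    by (rule pos_familyD[OF assms(1)])
  moreover have "lincomb n w (\<lambda>i. if i < m then c i else 0) = lincomb m w c"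
    unfolding lincomb_def using assms(2)
    by (intro sum.mono_neutral_cong_right) auto
  ultimately show "0 < quad (lincomb m w c)" by simp
qed (use assms in \<open>auto simp: pos_family_def\<close>)

lemma pos_family_mono_form:
  assumes h': "hermitian_form scale D h'" and fam: "pos_family n w"
    and le: "\<And>u. u \<in> D \<Longrightarrow> Re (h u u) \<le> Re (h' u u)"
  shows "hermitian_form.pos_family scale D h' n w"
proof -
  interpret h': hermitian_form scale D h' by fact
  have wD: "\<And>i. i < n \<Longrightarrow> w i \<in> D" using fam by (simp add: pos_family_def)
  show ?thesis
    unfolding h'.pos_family_def
  proof (intro conjI allI impI)
    fix c :: "nat \<Rightarrow> complex" assume "\<exists>i<n. c i \<noteq> 0"
    from pos_familyD[OF fam this] le[OF lincomb_in[OF wD]]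
    show "0 < Re (h' (lincomb n w c) (lincomb n w c))" by (meson less_le_trans)
  qed (rule wD)
qed

lemma lincomb_add: "lincomb n w c + lincomb n w d = lincomb n w (\<lambda>i. c i + d i)"
  by (simp add: lincomb_def scale_left_distrib sum.distrib)

lemma lincomb_scale: "a *\<^sub>C lincomb n w c = lincomb n w (\<lambda>i. a * c i)"
  by (simp add: lincomb_def scale_sum_right)

lemma lincomb_lincomb:
  assumes "\<And>i. i < m \<Longrightarrow> \<exists>d. e i = lincomb n w d"
  shows "\<exists>d. lincomb m e c = lincomb n w d"
  using assms
proof (induction m)
  case 0
  show ?case by (rule exI[of _ "\<lambda>_. 0"]) (simp add: lincomb_def)
next
  case (Suc m)
  then obtain d d' where d: "lincomb m e c = lincomb n w d" "e m = lincomb n w d'"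
    by (meson less_Suc_eq)
  have "lincomb (Suc m) e c = lincomb m e c + c m *\<^sub>C e m"
    by (simp add: lincomb_def)
  then show ?case using d lincomb_scale lincomb_add by metis
qed

lemma gram_schmidt:
  assumes "pos_family n w"
  shows "\<exists>e. orthonormal n e \<and> (\<forall>i<n. \<exists>d. e i = lincomb n w d)"
  using assms
proof (induction n)
  case 0
  then show ?case by (auto simp: orthonormal_def)
next
  case (Suc n)
  then obtain e where e: "orthonormal n e" and span: "\<forall>i<n. \<exists>d. e i = lincomb n w d"
    using pos_family_mono[of "Suc n" w n] by auto
  have wD: "w i \<in> D" if "i < Suc n" for i using Suc.prems that by (simp add: pos_family_def)
  define r where "r = w n - proj n e (w n)"
  have extend: "\<exists>d'. lincomb n w d = lincomb (Suc n) w d'" for d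
    by (rule exI[of _ "d(n := 0)"]) (simp add: lincomb_def)
  obtain d where d: "proj n e (w n) = lincomb n w d"
    using lincomb_lincomb[of n e n w] span unfolding proj_def by blast
  have r_eq: "r = lincomb (Suc n) w (\<lambda>i. if i < n then - d i else 1)"
    unfolding r_def d lincomb_def by (simp add: sum_negf)
  have rD: "r \<in> D" by (simp add: r_def wD proj_in e)
  have pos: "0 < quad r"
    unfolding r_eq by (rule pos_familyD[OF Suc.prems]) (auto intro!: exI[of _ n])
  define f where "f = complex_of_real (1 / sqrt (quad r)) *\<^sub>C r"
  have fD: "f \<in> D" by (simp add: f_def rD)
  have "quad f = 1"
    unfolding f_def using rD pos by (simp add: quad_scale power_divide norm_divide)
  then have ff: "h f f = 1" using Im_diag[OF fD] by (simp add: complex_eq_iff)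
  have fe: "h f (e i) = 0" if "i < n" for i
    using remainder_orthogonal[OF e, of "w n" i] that wD e rD
    by (simp add: f_def scale_left orthonormal_in flip: r_def)
  have ef: "h (e i) f = 0" if "i < n" for i
    using fe[OF that] hermitian[of f "e i"] fD orthonormal_in[OF e that] by simp
  have "orthonormal (Suc n) (e(n := f))"
    using e fD ff fe ef by (auto simp: orthonormal_def less_Suc_eq)
  moreover have "\<exists>d. (e(n := f)) i = lincomb (Suc n) w d" if "i < Suc n" for i
    using that span extend lincomb_scale r_eq f_def by (metis fun_upd_apply less_Suc_eq)
  ultimately show ?case by blast
qed

lemma orthonormal_pos_family: "orthonormal n e \<Longrightarrow> pos_family n e"
  unfolding pos_family_def
proof (intro conjI allI impI)
  fix c :: "nat \<Rightarrow> complex" assume e: "orthonormal n e" and "\<exists>i<n. c i \<noteq> 0"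
  then obtain i where i: "i < n" "c i \<noteq> 0" by auto
  have "0 < (cmod (c i))\<^sup>2" using i by simp
  also have "\<dots> \<le> (\<Sum>i<n. (cmod (c i))\<^sup>2)"
    using i by (intro member_le_sum) auto
  finally show "0 < quad (lincomb n e c)" using e by (simp add: quad_lincomb)
qed (auto simp: orthonormal_in)

text \<open>
  On the orthogonal complement of a positive family of maximal size the form is non-positive.
  Hence, if the positive index is finite, the form is dominated by finitely many of its own
  coordinate functionals. This replaces compactness in the construction of eigenvectors below.
\<close>

lemma finite_index_bound:
  assumes bounded: "\<And>n w. pos_family n w \<Longrightarrow> n \<le> N0"
  shows "\<exists>N e. orthonormal N e \<and> (\<forall>u\<in>D. quad u \<le> (\<Sum>i<N. (cmod (h u (e i)))\<^sup>2))"
proof -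
  define N where "N = (GREATEST n. \<exists>w. pos_family n w)"
  have ex0: "\<exists>w. pos_family 0 w" by (simp add: pos_family_def)
  have "\<exists>w. pos_family N w"
    unfolding N_def by (rule GreatestI_nat[where b = N0 and k = 0]) (use ex0 bounded in auto)
  then obtain e where e: "orthonormal N e" using gram_schmidt by blast
  have max: "n \<le> N" if "pos_family n w" for n w
    unfolding N_def by (rule Greatest_le_nat[where b = N0]) (use that bounded in auto)
  have "quad u \<le> (\<Sum>i<N. (cmod (h u (e i)))\<^sup>2)" if u: "u \<in> D" for u
  proof (rule ccontr)
    assume neg: "\<not> ?thesis"
    define r where "r = u - proj N e u"
    have rD: "r \<in> D" by (simp add: r_def u proj_in e)
    have pos: "0 < quad r" using neg quad_remainder[OF e u] by (simp add: r_def)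
    have re: "h r (e i) = 0" if "i < N" for i
      using remainder_orthogonal[OF e u that] by (simp add: r_def)
    have "pos_family (Suc N) (e(N := r))"
      unfolding pos_family_def
    proof (intro conjI allI impI)
      fix c :: "nat \<Rightarrow> complex" assume c: "\<exists>i<Suc N. c i \<noteq> 0"
      have eq: "lincomb (Suc N) (e(N := r)) c = c N *\<^sub>C r + lincomb N e c"
        unfolding lincomb_def by (simp add: add.commute)
      have "h (c N *\<^sub>C r) (lincomb N e c) = 0"
        using rD re e by (simp add: pairing_lincomb orthonormal_in scale_left)
      then have q: "quad (lincomb (Suc N) (e(N := r)) c) = (cmod (c N))\<^sup>2 * quad r + (\<Sum>i<N. (cmod (c i))\<^sup>2)"
        unfolding eq using rD e by (simp add: quad_add lincomb_in orthonormal_in quad_scale quad_lincomb)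
      show "0 < quad (lincomb (Suc N) (e(N := r)) c)"
      proof (cases "c N = 0")
        case True
        then have "\<exists>i<N. c i \<noteq> 0" using c less_Suc_eq by auto
        then show ?thesis
          using pos_familyD[OF orthonormal_pos_family[OF e], of c] quad_lincomb[OF e] True q by simp
      next
        case False
        then have "0 < (cmod (c N))\<^sup>2 * quad r" using pos by simp
        then show ?thesis unfolding q by (simp add: add_pos_nonneg sum_nonneg)
      qed
    qed (use rD e in \<open>auto simp: less_Suc_eq orthonormal_in\<close>)
    then show False using max by fastforce
  qed
  then show ?thesis using e by blast
qed

end

locale psd_form = hermitian_form +
  assumes nonneg: "\<And>u. u \<in> D \<Longrightarrow> 0 \<le> quad u"
begin

lemma cauchy_schwarz:
  assumes "u \<in> D" "v \<in> D"
  shows "(cmod (h u v))\<^sup>2 \<le> quad u * quad v"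
proof -
  define z where "z = h u v"
  have key: "0 \<le> quad u + (x\<^sup>2 * quad v - 2 * x) * (cmod z)\<^sup>2" for x :: real
  proof -
    define c where "c = complex_of_real x * z"
    have "h u (c *\<^sub>C v) = complex_of_real x * (z * cnj z)"
      using assms by (simp add: scale_right c_def z_def)
    then have "h u (c *\<^sub>C v) = complex_of_real (x * (cmod z)\<^sup>2)"
      by (simp only: complex_norm_square of_real_mult)
    then have "Re (h u (c *\<^sub>C v)) = x * (cmod z)\<^sup>2" by (simp only: Re_complex_of_real)
    moreover have "(cmod c)\<^sup>2 = x\<^sup>2 * (cmod z)\<^sup>2" by (simp add: c_def norm_mult power_mult_distrib)
    moreover have "0 \<le> quad (u - c *\<^sub>C v)" using assms by (intro nonneg) simp
    ultimately have "0 \<le> quad u - 2 * (x * (cmod z)\<^sup>2) + x\<^sup>2 * (cmod z)\<^sup>2 * quad v"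
      using quad_diff[OF assms(1) D_scale[OF assms(2)], of c] quad_scale[OF assms(2), of c] by simp
    then show ?thesis by (simp only: algebra_simps)
  qed
  show ?thesis
  proof (cases "quad v = 0")
    case True
    have "z = 0"
    proof (rule ccontr)
      assume "z \<noteq> 0"
      then have pos: "(cmod z)\<^sup>2 > 0" by simp
      define x where "x = (quad u + 1) / (2 * (cmod z)\<^sup>2)"
      have "2 * x * (cmod z)\<^sup>2 = quad u + 1" using pos by (simp add: x_def)
      moreover have "0 \<le> quad u - 2 * x * (cmod z)\<^sup>2" using key[of x] True by simp
      ultimately show False by linarith
    qed
    then show ?thesis using True by (simp add: z_def)
  next
    case False
    then have pos: "quad v > 0" using nonneg[OF assms(2)] by simp
    have "(1 / quad v)\<^sup>2 * quad v - 2 * (1 / quad v) = - 1 / quad v"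
      using pos by (simp add: field_simps power2_eq_square)
    then have "0 \<le> quad u - (cmod z)\<^sup>2 / quad v" using key[of "1 / quad v"] by simp
    then show ?thesis using pos by (simp add: field_simps z_def)
  qed
qed

lemma cauchy_schwarz_sqrt: "u \<in> D \<Longrightarrow> v \<in> D \<Longrightarrow> cmod (h u v) \<le> sqrt (quad u) * sqrt (quad v)"
  using real_le_rsqrt[OF cauchy_schwarz, of u v] by (simp only: real_sqrt_mult)

lemma quad_add_le: "u \<in> D \<Longrightarrow> v \<in> D \<Longrightarrow> quad (u + v) \<le> 2 * quad u + 2 * quad v"
  using parallelogram[of u v] nonneg[OF D_diff, of u v] by linarith

lemma bessel:
  assumes "orthonormal n e" "u \<in> D"
  shows "(\<Sum>i<n. (cmod (h u (e i)))\<^sup>2) \<le> quad u"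
  using quad_remainder[OF assms] nonneg[OF D_diff[OF assms(2) proj_in[OF assms(1), of u]]] by simp

lemma projection_best:
  assumes e: "orthonormal n e" and u: "u \<in> D"
  shows "quad (u - proj n e u) \<le> quad (u - lincomb n e c)"
proof -
  define d where "d i = h u (e i) - c i" for i
  have in_D: "u - proj n e u \<in> D" "lincomb n e d \<in> D"
    using e u by (auto simp: proj_in lincomb_in orthonormal_in)
  have eq: "u - lincomb n e c = (u - proj n e u) + lincomb n e d"
    by (simp add: proj_def lincomb_def d_def scale_left_diff_distrib sum_subtractf)
  have "h (u - proj n e u) (lincomb n e d) = 0"
    using e u in_D by (simp add: pairing_lincomb orthonormal_in remainder_orthogonal)
  then show ?thesis
    unfolding eq using in_D by (simp add: quad_add quad_lincomb[OF e] sum_nonneg)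
qed

lemma null_pairing: "u \<in> D \<Longrightarrow> v \<in> D \<Longrightarrow> quad u = 0 \<Longrightarrow> h u v = 0"
  using cauchy_schwarz[of u v] by simp

lemma tendsto_pairing:
  assumes U: "\<And>n. U n \<in> D" and "u \<in> D" "v \<in> D" and lim: "(\<lambda>n. quad (U n - u)) \<longlonglongrightarrow> 0"
  shows "(\<lambda>n. h (U n) v) \<longlonglongrightarrow> h u v"
proof (rule LIM_zero_cancel, rule Lim_null_comparison)
  show "\<forall>\<^sub>F n in sequentially. norm (h (U n) v - h u v) \<le> sqrt (quad (U n - u)) * sqrt (quad v)"
    using assms by (intro always_eventually allI) (simp add: cauchy_schwarz_sqrt flip: diff_left)
  show "(\<lambda>n. sqrt (quad (U n - u)) * sqrt (quad v)) \<longlonglongrightarrow> 0"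
    using tendsto_mult_right[OF tendsto_real_sqrt[OF lim]] by simp
qed

lemma tendsto_quad:
  assumes U: "\<And>n. U n \<in> D" and u: "u \<in> D" and lim: "(\<lambda>n. quad (U n - u)) \<longlonglongrightarrow> 0"
  shows "(\<lambda>n. quad (U n)) \<longlonglongrightarrow> quad u"
proof -
  have "quad (U n) = quad (U n - u) + 2 * Re (h (U n) u) - quad u" for n
    using quad_diff[OF U u, of n] by linarith
  moreover have "(\<lambda>n. quad (U n - u) + 2 * Re (h (U n) u) - quad u) \<longlonglongrightarrow> 0 + 2 * Re (h u u) - quad u"
    by (intro tendsto_intros lim tendsto_pairing U u)
  ultimately show ?thesis by simp
qed

text \<open>Completeness of \<open>D\<close> in the seminorm of the form; limits need not be unique.\<close>

definition form_complete :: bool where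
  "form_complete \<longleftrightarrow> (\<forall>U. (\<forall>n::nat. U n \<in> D) \<longrightarrow>
     (\<forall>\<epsilon>>0. \<exists>N. \<forall>m\<ge>N. \<forall>n\<ge>N. quad (U m - U n) < \<epsilon>) \<longrightarrow> (\<exists>u\<in>D. (\<lambda>n. quad (U n - u)) \<longlonglongrightarrow> 0))"

text \<open>Riesz representation, by minimising \<open>quad u - 2 Re (l u)\<close>.\<close>

lemma riesz:
  assumes complete: form_complete
    and l_add: "\<And>u v. u \<in> D \<Longrightarrow> v \<in> D \<Longrightarrow> l (u + v) = l u + l v"
    and l_scale: "\<And>c u. u \<in> D \<Longrightarrow> l (c *\<^sub>C u) = cnj c * l u"
    and l_bound: "\<And>u. u \<in> D \<Longrightarrow> (cmod (l u))\<^sup>2 \<le> K * quad u"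
  shows "\<exists>u\<in>D. \<forall>v\<in>D. h u v = l v"
proof -
  define J where "J u = quad u - 2 * Re (l u)" for u
  have l_diff: "l (u - v) = l u - l v" if "u \<in> D" "v \<in> D" for u v
    using l_add[of "u - v" v] that by simp
  have J_lower: "- \<bar>K\<bar> \<le> J u" if u: "u \<in> D" for u
  proof -
    have "(cmod (l u))\<^sup>2 \<le> \<bar>K\<bar> * quad u"
      using l_bound[OF u] nonneg[OF u] by (smt (verit) mult_right_mono)
    then have "cmod (l u) \<le> sqrt \<bar>K\<bar> * sqrt (quad u)"
      unfolding real_sqrt_mult[symmetric] by (rule real_le_rsqrt)
    moreover have "0 \<le> (sqrt (quad u) - sqrt \<bar>K\<bar>)\<^sup>2" by simp
    then have "2 * (sqrt \<bar>K\<bar> * sqrt (quad u)) \<le> quad u + \<bar>K\<bar>"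
      using nonneg[OF u] by (simp add: power2_diff mult.commute)
    moreover have "Re (l u) \<le> cmod (l u)" by (rule complex_Re_le_cmod)
    ultimately show ?thesis by (simp add: J_def)
  qed
  define d where "d = (INF u\<in>D. J u)"
  have bdd: "bdd_below (J ` D)" using J_lower by (intro bdd_belowI[of _ "- \<bar>K\<bar>"]) auto
  have d_le: "d \<le> J u" if "u \<in> D" for u unfolding d_def using that bdd by (intro cINF_lower)
  have "\<exists>u\<in>D. J u < d + 1 / real (Suc n)" for n
  proof -
    have "D \<noteq> {}" using D_zero by blast
    moreover have "d < d + 1 / real (Suc n)" by simp
    ultimately show ?thesis
      using cINF_less_iff[of D J "d + 1 / real (Suc n)"] bdd unfolding d_def by blast
  qed
  then obtain U where U: "\<And>n. U n \<in> D" and JU: "\<And>n. J (U n) < d + 1 / real (Suc n)"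
    by metis
  have dist: "quad (U m - U n) \<le> 2 / real (Suc m) + 2 / real (Suc n)" for m n
  proof -
    define w where "w = (1/2) *\<^sub>C (U m + U n)"
    have w: "w \<in> D" by (simp add: w_def U)
    have "quad w = quad (U m + U n) / 4" unfolding w_def using U by (subst quad_scale) (auto simp: power2_eq_square norm_divide)
    moreover have "2 * Re (l w) = Re (l (U m)) + Re (l (U n))"
      unfolding w_def using U by (simp add: l_scale l_add)
    moreover have "d \<le> J w" by (rule d_le[OF w])
    ultimately have "4 * d \<le> quad (U m + U n) - 4 * (Re (l (U m)) + Re (l (U n)))"
      by (simp add: J_def)
    then show ?thesis
      using parallelogram[of "U m" "U n"] U JU[of m] JU[of n] by (simp add: J_def)
  qed
  have "\<exists>N. \<forall>m\<ge>N. \<forall>n\<ge>N. quad (U m - U n) < \<epsilon>" if "\<epsilon> > 0" for \<epsilon> :: real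
  proof -
    have "\<epsilon> / 4 > 0" using that by simp
    then obtain N where N: "inverse (real (Suc N)) < \<epsilon> / 4" using reals_Archimedean by blast
    have small: "2 / real (Suc k) < \<epsilon> / 2" if "k \<ge> N" for k
    proof -
      have "1 / real (Suc k) \<le> inverse (real (Suc N))"
        using that by (simp add: field_simps)
      moreover have "2 / real (Suc k) = 2 * (1 / real (Suc k))" by simp
      ultimately show ?thesis using N by linarith
    qed
    have "quad (U m - U n) < \<epsilon>" if "m \<ge> N" "n \<ge> N" for m n
      using dist[of m n] small[OF that(1)] small[OF that(2)] by linarith
    then show ?thesis by blast
  qed
  then obtain u where u: "u \<in> D" and lim: "(\<lambda>n. quad (U n - u)) \<longlonglongrightarrow> 0"
    using complete U unfolding form_complete_def by blast
  have Re_l: "(\<lambda>n. Re (l (U n))) \<longlonglongrightarrow> Re (l u)"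
  proof (rule LIM_zero_cancel, rule Lim_null_comparison)
    have "norm (Re (l (U n)) - Re (l u)) \<le> sqrt (\<bar>K\<bar> * quad (U n - u))" for n
    proof -
      have "(cmod (l (U n - u)))\<^sup>2 \<le> \<bar>K\<bar> * quad (U n - u)"
        using l_bound[of "U n - u"] nonneg[of "U n - u"] U u
        by (smt (verit) D_diff mult_right_mono)
      then have "cmod (l (U n - u)) \<le> sqrt (\<bar>K\<bar> * quad (U n - u))" by (rule real_le_rsqrt)
      moreover have "\<bar>Re (l (U n - u))\<bar> \<le> cmod (l (U n - u))" by (rule abs_Re_le_cmod)
      ultimately show ?thesis using U u by (simp add: l_diff)
    qed
    then show "\<forall>\<^sub>F n in sequentially. norm (Re (l (U n)) - Re (l u)) \<le> sqrt (\<bar>K\<bar> * quad (U n - u))"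
      by simp
    show "(\<lambda>n. sqrt (\<bar>K\<bar> * quad (U n - u))) \<longlonglongrightarrow> 0"
      using tendsto_real_sqrt[OF tendsto_mult_left[OF lim, of "\<bar>K\<bar>"]] by simp
  qed
  have "(\<lambda>n. J (U n)) \<longlonglongrightarrow> J u"
    unfolding J_def by (intro tendsto_intros tendsto_quad U u lim Re_l)
  moreover have "(\<lambda>n. d + 1 / real (Suc n)) \<longlonglongrightarrow> d"
    using tendsto_add[OF tendsto_const LIMSEQ_inverse_real_of_nat, of d] by (simp add: inverse_eq_divide)
  ultimately have "J u \<le> d"
    using JU by (intro LIMSEQ_le[of "\<lambda>n. J (U n)"]) (auto intro: less_imp_le)
  then have min: "J u \<le> J w" if "w \<in> D" for w using d_le[OF that] by simp
  have "h u v = l v" if v: "v \<in> D" for v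
  proof (rule ccontr)
    assume "h u v \<noteq> l v"
    define z where "z = h u v - l v"
    have z: "0 < (cmod z)\<^sup>2" using \<open>h u v \<noteq> l v\<close> by (simp add: z_def)
    define x where "x = 1 / (quad v + 1)"
    have x: "x > 0" "x * quad v < 1" using nonneg[OF v] by (auto simp: x_def field_simps)
    define c where "c = - complex_of_real x * z"
    have "Re (h u (c *\<^sub>C v)) - Re (l (c *\<^sub>C v)) = Re (cnj c * z)"
      using u v by (simp add: scale_right l_scale z_def algebra_simps)
    also have "\<dots> = - x * (cmod z)\<^sup>2"
      by (simp add: c_def cmod_power2) (simp add: power2_eq_square algebra_simps)
    finally have "J (u + c *\<^sub>C v) - J u = (cmod c)\<^sup>2 * quad v - 2 * x * (cmod z)\<^sup>2"
      using u v by (simp add: J_def quad_add quad_scale l_add)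
    also have "\<dots> = x * (cmod z)\<^sup>2 * (x * quad v - 2)"
      by (simp add: c_def norm_mult power_mult_distrib power2_eq_square algebra_simps)
    also have "\<dots> < 0" using x z by (intro mult_pos_neg) auto
    finally show False using min[of "u + c *\<^sub>C v"] u v by simp
  qed
  then show ?thesis using u by blast
qed

text \<open>
  Given orthonormal eigenvectors \<open>e\<close> of \<open>s\<close> and a vector \<open>u0\<close> orthogonal to them with Rayleigh
  quotient below \<open>\<rho>\<close>, the infimum \<open>l\<close> of the Rayleigh quotient over the orthogonal complement
  \<open>E\<close> of \<open>e\<close> is attained, at a further eigenvector. The form \<open>g = s - l h\<close> is non-negative on
  \<open>E\<close> and tends to zero along a minimising sequence, hence along its differences \<open>d\<close>. Now
  \<open>(\<rho> - l) h d d = r d d + g d d\<close> with \<open>r = \<rho> h - s\<close>, and \<open>r\<close> is dominated by finitely many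
  coordinate functionals, which converge along a subsequence. So the subsequence is Cauchy.
\<close>

lemma eigenvector_step:
  assumes s: "hermitian_form scale D s"
    and lower: "\<And>u. u \<in> D \<Longrightarrow> - K * quad u \<le> Re (s u u)"
    and complete: "\<And>U. (\<And>n::nat. U n \<in> D) \<Longrightarrow>
        (\<And>\<epsilon>. \<epsilon> > 0 \<Longrightarrow> \<exists>N. \<forall>m\<ge>N. \<forall>n\<ge>N. quad (U m - U n) < \<epsilon> \<and> Re (s (U m - U n) (U m - U n)) < \<epsilon>) \<Longrightarrow>
        \<exists>u\<in>D. (\<lambda>n. quad (U n - u)) \<longlonglongrightarrow> 0 \<and> (\<lambda>n. Re (s (U n - u) (U n - u))) \<longlonglongrightarrow> 0"
    and bounded: "\<And>n w. hermitian_form.pos_family scale D (\<lambda>u v. complex_of_real \<rho> * h u v - s u v) n w \<Longrightarrow> n \<le> N0"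
    and e: "orthonormal k e"
    and eig: "\<And>i v. i < k \<Longrightarrow> v \<in> D \<Longrightarrow> s (e i) v = complex_of_real (\<mu> i) * h (e i) v"
    and u0: "u0 \<in> D" "\<And>i. i < k \<Longrightarrow> h u0 (e i) = 0" "Re (s u0 u0) < \<rho> * quad u0"
  shows "\<exists>f l. f \<in> D \<and> h f f = 1 \<and> (\<forall>i<k. h f (e i) = 0) \<and> l < \<rho> \<and>
           (\<forall>v\<in>D. s f v = complex_of_real l * h f v)"
proof -
  interpret s: hermitian_form scale D s by (rule s)
  define r where "r = (\<lambda>u v. complex_of_real \<rho> * h u v - s u v)"
  interpret r: hermitian_form scale D r
    by unfold_locales
      (simp_all add: r_def subspace add_left s.add_left scale_left s.scale_left hermitian[symmetric]
        s.hermitian[symmetric] algebra_simps)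
  have sK_nonneg: "0 \<le> Re (s u u) + K * quad u" if "u \<in> D" for u
    using lower[OF that] by simp
  define sK where "sK = (\<lambda>u v. s u v + complex_of_real K * h u v)"
  interpret sK: psd_form scale D sK
    by unfold_locales
      (use sK_nonneg in \<open>simp_all add: sK_def subspace add_left s.add_left scale_left s.scale_left
        hermitian[symmetric] s.hermitian[symmetric] algebra_simps\<close>)
  define E where "E = {u \<in> D. \<forall>i<k. h u (e i) = 0}"
  have ED: "u \<in> D" if "u \<in> E" for u using that by (simp add: E_def)
  have subE: "subspace E"
    using e unfolding subspace_def E_def by (auto simp: add_left scale_left orthonormal_in)
  have pos0: "0 < quad u0"
  proof (rule ccontr)
    assume "\<not> 0 < quad u0"
    then have "quad u0 = 0" using nonneg[OF u0(1)] by simp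
    then show False using lower[OF u0(1)] u0(3) by simp
  qed
  \<comment> \<open>A vector of seminorm zero has \<open>s\<close>-value at least zero by the lower bound, so it does not
    matter that \<open>h\<close> may be degenerate.\<close>
  define S where "S = {u \<in> E. quad u = 1}"
  define l where "l = (INF u\<in>S. Re (s u u))"
  have bdd: "bdd_below ((\<lambda>u. Re (s u u)) ` S)"
    using lower by (intro bdd_belowI[of _ "- K"]) (fastforce simp: S_def E_def)
  have normalised: "complex_of_real (1 / sqrt (quad u)) *\<^sub>C u \<in> S"
    "Re (s (complex_of_real (1 / sqrt (quad u)) *\<^sub>C u) (complex_of_real (1 / sqrt (quad u)) *\<^sub>C u)) = Re (s u u) / quad u"
    if "u \<in> E" "0 < quad u" for u
  proof -
    define c where "c = complex_of_real (1 / sqrt (quad u))"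
    have sq: "(cmod c)\<^sup>2 = 1 / quad u"
      using that(2) by (simp add: c_def power_divide norm_divide)
    have "quad (c *\<^sub>C u) = 1"
      using that by (simp add: quad_scale[OF ED] sq)
    moreover have "c *\<^sub>C u \<in> E" using that subspace_scale[OF subE] by simp
    ultimately show "complex_of_real (1 / sqrt (quad u)) *\<^sub>C u \<in> S"
      unfolding c_def[symmetric] S_def by simp
    show "Re (s (complex_of_real (1 / sqrt (quad u)) *\<^sub>C u) (complex_of_real (1 / sqrt (quad u)) *\<^sub>C u)) = Re (s u u) / quad u"
      unfolding c_def[symmetric] using that by (simp add: s.quad_scale[OF ED] sq)
  qed
  have l_le: "l * quad u \<le> Re (s u u)" if u: "u \<in> E" for u
  proof (cases "quad u = 0")
    case True
    then show ?thesis using lower[OF ED[OF u]] by simp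
  next
    case False
    then have p: "0 < quad u" using nonneg[OF ED[OF u]] by simp
    have "l \<le> Re (s u u) / quad u"
      unfolding l_def normalised(2)[OF u p, symmetric] by (intro cINF_lower bdd normalised u p)
    then show ?thesis using p by (simp add: field_simps)
  qed
  have u0E: "u0 \<in> E" using u0 by (simp add: E_def)
  have l_less: "l < \<rho>"
  proof -
    have "l * quad u0 < \<rho> * quad u0" using l_le[OF u0E] u0(3) by simp
    then show ?thesis using pos0 by simp
  qed
  define g where "g = (\<lambda>u v. s u v - complex_of_real l * h u v)"
  interpret g: psd_form scale E g
    by unfold_locales
      (use l_le in \<open>simp_all add: g_def subE ED add_left s.add_left scale_left s.scale_left
        hermitian[symmetric] s.hermitian[symmetric] algebra_simps\<close>)
  have S_ne: "S \<noteq> {}" using normalised(1)[OF u0E pos0] by blast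
  have "\<exists>u\<in>S. Re (s u u) < l + 1 / real (Suc n)" for n
  proof -
    have "l < l + 1 / real (Suc n)" by simp
    then show ?thesis using cINF_less_iff[OF S_ne bdd, of "l + 1 / real (Suc n)"] unfolding l_def by blast
  qed
  then obtain U where US: "\<And>n. U n \<in> S" and sU: "\<And>n. Re (s (U n) (U n)) < l + 1 / real (Suc n)"
    by metis
  have UE: "U n \<in> E" and UD: "U n \<in> D" and qU: "quad (U n) = 1" for n
    using US[of n] by (auto simp: S_def E_def)
  obtain N w where w: "r.orthonormal N w"
    and dom: "\<And>u. u \<in> D \<Longrightarrow> Re (r u u) \<le> (\<Sum>i<N. (cmod (r u (w i)))\<^sup>2)"
    using r.finite_index_bound[of N0] bounded unfolding r_def by blast
  have wD: "w i \<in> D" if "i < N" for i using r.orthonormal_in[OF w that] .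
  have bdd_range: "bounded (range (\<lambda>n. r (U n) (w i)))" if i: "i < N" for i
  proof (rule boundedI, clarify)
    fix n
    have "cmod (h (U n) (w i)) \<le> sqrt (quad (w i))"
      using cauchy_schwarz_sqrt[OF UD[of n] wD[OF i]] by (simp add: qU)
    moreover have "cmod (sK (U n) (w i)) \<le> sqrt (l + 1 + K) * sqrt (Re (sK (w i) (w i)))"
    proof -
      have "1 / real (Suc n) \<le> 1" by simp
      then have "Re (s (U n) (U n)) \<le> l + 1" using sU[of n] by linarith
      then have "Re (sK (U n) (U n)) \<le> l + 1 + K"
        using qU[of n] unfolding sK_def by simp
      then have "sqrt (Re (sK (U n) (U n))) \<le> sqrt (l + 1 + K)" by simp
      then have "sqrt (Re (sK (U n) (U n))) * sqrt (Re (sK (w i) (w i))) \<le> sqrt (l + 1 + K) * sqrt (Re (sK (w i) (w i)))"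
        using sK.nonneg[OF wD[OF i]] by (intro mult_right_mono) auto
      then show ?thesis using sK.cauchy_schwarz_sqrt[OF UD[of n] wD[OF i]] by linarith
    qed
    moreover have "r (U n) (w i) = complex_of_real (\<rho> + K) * h (U n) (w i) - sK (U n) (w i)"
      by (simp add: r_def sK_def algebra_simps)
    then have "cmod (r (U n) (w i)) \<le> \<bar>\<rho> + K\<bar> * cmod (h (U n) (w i)) + cmod (sK (U n) (w i))"
      using norm_triangle_ineq4[of "complex_of_real (\<rho> + K) * h (U n) (w i)" "sK (U n) (w i)"]
      by (simp add: norm_mult del: of_real_add)
    moreover have "\<bar>\<rho> + K\<bar> * cmod (h (U n) (w i)) \<le> \<bar>\<rho> + K\<bar> * sqrt (quad (w i))"
      using calculation(1) by (intro mult_left_mono) auto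
    ultimately show "cmod (r (U n) (w i)) \<le> \<bar>\<rho> + K\<bar> * sqrt (quad (w i)) + sqrt (l + 1 + K) * sqrt (Re (sK (w i) (w i)))"
      by linarith
  qed
  \<comment> \<open>The coordinates are bounded along the sequence because \<open>h\<close> and \<open>s + K h\<close> are.\<close>
  obtain \<sigma> where \<sigma>: "strict_mono \<sigma>" and conv: "\<And>i. i < N \<Longrightarrow> convergent ((\<lambda>n. r (U n) (w i)) \<circ> \<sigma>)"
    using bounded_tuple_convergent_subseq[of N "\<lambda>i n. r (U n) (w i)"] bdd_range by blast
  define V where "V n = U (\<sigma> n)" for n
  have VD: "V n \<in> D" and VE: "V n \<in> E" and qV: "quad (V n) = 1" for n
    by (simp_all add: V_def UD UE qU)
  have gV: "Re (g (V n) (V n)) \<le> 1 / real (Suc n)" for n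
  proof -
    have "n \<le> \<sigma> n" using seq_suble[OF \<sigma>] .
    then have "1 / real (Suc (\<sigma> n)) \<le> 1 / real (Suc n)" by (simp add: frac_le)
    moreover have "Re (g (V n) (V n)) = Re (s (V n) (V n)) - l"
      using qV[of n] by (simp add: g_def)
    ultimately show ?thesis using sU[of "\<sigma> n"] by (simp add: V_def)
  qed
  from conv obtain a where a: "\<And>i. i < N \<Longrightarrow> (\<lambda>n. r (V n) (w i)) \<longlonglongrightarrow> a i"
    unfolding convergent_def comp_def V_def by metis
  define B where "B n = (\<Sum>i<N. (cmod (r (V n) (w i) - a i))\<^sup>2)" for n
  define \<eta> where "\<eta> n = 2 * (1 / real (Suc n)) + 2 * B n" for n
  have "B \<longlonglongrightarrow> (\<Sum>i<N. 0)"
    unfolding B_def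
  proof (rule tendsto_sum)
    fix i assume "i \<in> {..<N}"
    then have "(\<lambda>n. cmod (r (V n) (w i) - a i)) \<longlonglongrightarrow> 0"
      using a[of i] by (intro tendsto_norm_zero LIM_zero) auto
    then show "(\<lambda>n. (cmod (r (V n) (w i) - a i))\<^sup>2) \<longlonglongrightarrow> 0"
      using tendsto_power[of _ 0 _ 2] by force
  qed
  then have B0: "B \<longlonglongrightarrow> 0" by simp
  have inv0: "(\<lambda>n. 1 / real (Suc n)) \<longlonglongrightarrow> 0"
    using LIMSEQ_inverse_real_of_nat by (simp add: inverse_eq_divide)
  have \<eta>0: "\<eta> \<longlonglongrightarrow> 0"
    unfolding \<eta>_def using tendsto_add[OF tendsto_mult_left[OF inv0, of 2] tendsto_mult_left[OF B0, of 2]] by simp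
  have B_nn: "0 \<le> B n" for n by (simp add: B_def sum_nonneg)
  have \<eta>_nn: "0 \<le> \<eta> n" for n by (simp add: \<eta>_def B_nn)
  have g_diff: "Re (g (V m - V n) (V m - V n)) \<le> \<eta> m + \<eta> n" for m n
  proof -
    have "Re (g (V m - V n) (V m - V n)) \<le> 2 * Re (g (V m) (V m)) + 2 * Re (g (V n) (V n))"
      using g.parallelogram[OF VE VE, of m n] g.nonneg[OF g.D_add[OF VE VE], of m n] by linarith
    then show ?thesis using gV[of m] gV[of n] B_nn[of m] B_nn[of n] unfolding \<eta>_def by linarith
  qed
  have quad_le: "(\<rho> - l) * quad (V m - V n) \<le> 2 * (\<eta> m + \<eta> n)" for m n
  proof -
    have "Re (r (V m - V n) (V m - V n)) \<le> (\<Sum>i<N. (cmod (r (V m - V n) (w i)))\<^sup>2)"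
      by (rule dom) (simp add: VD)
    also have "\<dots> \<le> (\<Sum>i<N. 2 * (cmod (r (V m) (w i) - a i))\<^sup>2 + 2 * (cmod (r (V n) (w i) - a i))\<^sup>2)"
    proof (rule sum_mono)
      fix i assume "i \<in> {..<N}"
      then have eq: "r (V m - V n) (w i) = (r (V m) (w i) - a i) - (r (V n) (w i) - a i)"
        by (simp add: r.diff_left VD wD)
      have "cmod (r (V m - V n) (w i)) \<le> cmod (r (V m) (w i) - a i) + cmod (r (V n) (w i) - a i)"
        unfolding eq by (rule norm_triangle_ineq4)
      then have "(cmod (r (V m - V n) (w i)))\<^sup>2 \<le> (cmod (r (V m) (w i) - a i) + cmod (r (V n) (w i) - a i))\<^sup>2"
        by (rule power_mono) simp
      also have "\<dots> \<le> 2 * (cmod (r (V m) (w i) - a i))\<^sup>2 + 2 * (cmod (r (V n) (w i) - a i))\<^sup>2"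
        by (smt (verit) sum_squares_bound power2_sum)
      finally show "(cmod (r (V m - V n) (w i)))\<^sup>2
          \<le> 2 * (cmod (r (V m) (w i) - a i))\<^sup>2 + 2 * (cmod (r (V n) (w i) - a i))\<^sup>2" .
    qed
    also have "\<dots> = 2 * B m + 2 * B n"
      by (simp add: B_def sum.distrib sum_distrib_left)
    also have "\<dots> \<le> \<eta> m + \<eta> n"
      by (simp add: \<eta>_def)
    finally have "Re (r (V m - V n) (V m - V n)) \<le> \<eta> m + \<eta> n" .
    from add_mono[OF this g_diff[of m n]]
    have "Re (r (V m - V n) (V m - V n)) + Re (g (V m - V n) (V m - V n)) \<le> 2 * (\<eta> m + \<eta> n)"
      by (simp only: mult_2)
    then show ?thesis by (simp add: r_def g_def algebra_simps)
  qed
  define C where "C = 2 / (\<rho> - l)"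
  have C: "0 < C" using l_less by (simp add: C_def)
  have quad_le': "quad (V m - V n) \<le> C * (\<eta> m + \<eta> n)" for m n
    using quad_le[of m n] l_less by (simp add: C_def field_simps)
  have s_le: "Re (s (V m - V n) (V m - V n)) \<le> (1 + \<bar>l\<bar> * C) * (\<eta> m + \<eta> n)" for m n
  proof -
    have "Re (s (V m - V n) (V m - V n)) = Re (g (V m - V n) (V m - V n)) + l * quad (V m - V n)"
      by (simp add: g_def)
    moreover have "l * quad (V m - V n) \<le> \<bar>l\<bar> * quad (V m - V n)"
      by (intro mult_right_mono nonneg) (simp_all add: VD)
    moreover have "\<bar>l\<bar> * quad (V m - V n) \<le> \<bar>l\<bar> * (C * (\<eta> m + \<eta> n))"
      by (intro mult_left_mono quad_le') simp
    ultimately show ?thesis using g_diff[of m n] by (simp add: algebra_simps)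
  qed
  have "\<exists>u\<in>D. (\<lambda>n. quad (V n - u)) \<longlonglongrightarrow> 0 \<and> (\<lambda>n. Re (s (V n - u) (V n - u))) \<longlonglongrightarrow> 0"
  proof (rule complete)
    fix \<epsilon> :: real assume \<epsilon>: "\<epsilon> > 0"
    define A where "A = C + (1 + \<bar>l\<bar> * C)"
    have A: "A > 0" using C by (simp add: A_def add_pos_pos add_pos_nonneg)
    have "eventually (\<lambda>n. \<eta> n < \<epsilon> / (2 * A)) sequentially"
      using \<eta>0 \<epsilon> A by (intro order_tendstoD) auto
    then obtain N where N: "\<And>n. n \<ge> N \<Longrightarrow> \<eta> n < \<epsilon> / (2 * A)"
      unfolding eventually_sequentially by blast
    have "quad (V m - V n) < \<epsilon> \<and> Re (s (V m - V n) (V m - V n)) < \<epsilon>" if "m \<ge> N" "n \<ge> N" for m n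
    proof -
      have "\<eta> m + \<eta> n < \<epsilon> / A" using N[OF that(1)] N[OF that(2)] by (simp add: field_simps)
      then have "A * (\<eta> m + \<eta> n) < \<epsilon>" using A by (simp add: field_simps)
      moreover have "C * (\<eta> m + \<eta> n) \<le> A * (\<eta> m + \<eta> n)" "(1 + \<bar>l\<bar> * C) * (\<eta> m + \<eta> n) \<le> A * (\<eta> m + \<eta> n)"
        using \<eta>_nn[of m] \<eta>_nn[of n] C by (intro mult_right_mono; simp add: A_def)+
      ultimately show ?thesis using quad_le'[of m n] s_le[of m n] by linarith
    qed
    then show "\<exists>N. \<forall>m\<ge>N. \<forall>n\<ge>N. quad (V m - V n) < \<epsilon> \<and> Re (s (V m - V n) (V m - V n)) < \<epsilon>" by blast
  qed (rule VD)
  then obtain u where u: "u \<in> D" and lim: "(\<lambda>n. quad (V n - u)) \<longlonglongrightarrow> 0"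
    and slim: "(\<lambda>n. Re (s (V n - u) (V n - u))) \<longlonglongrightarrow> 0" by blast
  have "quad u = 1"
    using tendsto_quad[OF VD u lim] by (simp add: qV LIMSEQ_const_iff)
  then have hu: "h u u = 1" using Im_diag[OF u] by (simp add: complex_eq_iff)
  have he: "h u (e i) = 0" if "i < k" for i
  proof -
    have "(\<lambda>n. h (V n) (e i)) \<longlonglongrightarrow> h u (e i)"
      by (rule tendsto_pairing[OF VD u orthonormal_in[OF e that] lim])
    moreover have "h (V n) (e i) = 0" for n using VE[of n] that by (simp add: E_def)
    ultimately show ?thesis by (simp add: LIMSEQ_const_iff)
  qed
  have uE: "u \<in> E" by (simp add: E_def u he)
  have "(\<lambda>n. Re (sK (V n - u) (V n - u))) \<longlonglongrightarrow> 0"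
    unfolding sK_def using tendsto_add[OF slim tendsto_mult_left[OF lim, of K]] by simp
  from sK.tendsto_quad[OF VD u this]
  have "(\<lambda>n. Re (s (V n) (V n)) + K) \<longlonglongrightarrow> Re (s u u) + K"
    using qV hu by (simp add: sK_def)
  moreover have "(\<lambda>n. Re (s (V n) (V n)) + K) \<longlonglongrightarrow> l + K"
  proof (rule tendsto_add[OF _ tendsto_const], rule tendsto_sandwich)
    show "\<forall>\<^sub>F n in sequentially. l \<le> Re (s (V n) (V n))"
      using l_le[OF VE] by (simp add: qV)
    have "Re (s (V n) (V n)) \<le> l + 1 / real (Suc n)" for n
      using gV[of n] by (simp add: g_def qV)
    then show "\<forall>\<^sub>F n in sequentially. Re (s (V n) (V n)) \<le> l + 1 / real (Suc n)" by simp
    show "(\<lambda>n. l + 1 / real (Suc n)) \<longlonglongrightarrow> l" using tendsto_add[OF tendsto_const inv0, of l] by simp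
  qed simp
  ultimately have su: "Re (s u u) = l" using LIMSEQ_unique by force
  \<comment> \<open>A zero of the non-negative form \<open>g\<close> is in its kernel; this is the eigenvalue equation
    tested on \<open>E\<close>. On the span of \<open>e\<close> it holds because \<open>e\<close> consists of eigenvectors.\<close>
  have g0: "Re (g u u) = 0" by (simp add: g_def su hu)
  have "s u v = complex_of_real l * h u v" if v: "v \<in> D" for v
  proof -
    define v' where "v' = v - proj k e v"
    have v'E: "v' \<in> E" using v e by (simp add: E_def v'_def proj_in remainder_orthogonal)
    have "g u v' = 0" by (rule g.null_pairing[OF uE v'E g0])
    moreover have "s u (proj k e v) = 0"
    proof -
      have "s u (e i) = 0" if "i < k" for i
      proof -
        have "s u (e i) = cnj (s (e i) u)" by (rule s.hermitian[OF orthonormal_in[OF e that] u])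
        also have "\<dots> = complex_of_real (\<mu> i) * h u (e i)"
          using eig[OF that u] hermitian[OF orthonormal_in[OF e that] u] by simp
        finally show ?thesis using he[OF that] by simp
      qed
      then show ?thesis unfolding proj_def using e u by (simp add: s.pairing_lincomb orthonormal_in)
    qed
    moreover have "h u (proj k e v) = 0"
      unfolding proj_def using e u he by (simp add: pairing_lincomb orthonormal_in)
    moreover have "v = v' + proj k e v" by (simp add: v'_def)
    moreover have "proj k e v \<in> D" "v' \<in> D" using e v'E by (auto simp: proj_in ED)
    ultimately show ?thesis
      using u add_right[of v' "proj k e v" u] s.add_right[of v' "proj k e v" u] by (simp add: g_def)
  qed
  then show ?thesis using u hu he l_less by blast
qed

theorem eigenvectors_below:
  assumes s: "hermitian_form scale D s"
    and lower: "\<And>u. u \<in> D \<Longrightarrow> - K * quad u \<le> Re (s u u)"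
    and complete: "\<And>U. (\<And>n::nat. U n \<in> D) \<Longrightarrow>
        (\<And>\<epsilon>. \<epsilon> > 0 \<Longrightarrow> \<exists>N. \<forall>m\<ge>N. \<forall>n\<ge>N. quad (U m - U n) < \<epsilon> \<and> Re (s (U m - U n) (U m - U n)) < \<epsilon>) \<Longrightarrow>
        \<exists>u\<in>D. (\<lambda>n. quad (U n - u)) \<longlonglongrightarrow> 0 \<and> (\<lambda>n. Re (s (U n - u) (U n - u))) \<longlonglongrightarrow> 0"
    and bounded: "\<And>n w. hermitian_form.pos_family scale D (\<lambda>u v. complex_of_real \<rho> * h u v - s u v) n w \<Longrightarrow> n \<le> N0"
    and family: "hermitian_form.pos_family scale D (\<lambda>u v. complex_of_real \<rho> * h u v - s u v) n w"
  shows "\<exists>e \<mu>. orthonormal n e \<and>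
           (\<forall>i<n. \<mu> i < \<rho> \<and> (\<forall>v\<in>D. s (e i) v = complex_of_real (\<mu> i) * h (e i) v))"
proof -
  interpret s: hermitian_form scale D s by (rule s)
  define r where "r = (\<lambda>u v. complex_of_real \<rho> * h u v - s u v)"
  interpret r: hermitian_form scale D r
    by unfold_locales
      (simp_all add: r_def subspace add_left s.add_left scale_left s.scale_left hermitian[symmetric]
        s.hermitian[symmetric] algebra_simps)
  have fam: "r.pos_family n w" using family by (simp add: r_def)
  then have wD: "w i \<in> D" if "i < n" for i using that by (simp add: r.pos_family_def)
  have "\<exists>e \<mu>. orthonormal k e \<and>
           (\<forall>i<k. \<mu> i < \<rho> \<and> (\<forall>v\<in>D. s (e i) v = complex_of_real (\<mu> i) * h (e i) v))" if "k \<le> n" for k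
    using that
  proof (induction k)
    case 0
    then show ?case by (simp add: orthonormal_def)
  next
    case (Suc k)
    then obtain e \<mu> where e: "orthonormal k e"
      and eig: "\<And>i. i < k \<Longrightarrow> \<mu> i < \<rho> \<and> (\<forall>v\<in>D. s (e i) v = complex_of_real (\<mu> i) * h (e i) v)"
      by auto
    obtain c where c: "\<exists>i<n. c i \<noteq> 0" and c0: "\<And>j. j < k \<Longrightarrow> (\<Sum>i<n. c i * h (w i) (e j)) = 0"
      using nontrivial_solution[of "{..<n}" k "\<lambda>j i. h (w i) (e j)"] Suc.prems by auto
    define u0 where "u0 = lincomb n w c"
    have u0: "u0 \<in> D" by (simp add: u0_def lincomb_in wD)
    have orth: "h u0 (e j) = 0" if "j < k" for j
      unfolding u0_def lincomb_def using c0[OF that] wD e that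
      by (subst sum_left) (auto simp: scale_left orthonormal_in)
    have "0 < Re (r u0 u0)" unfolding u0_def by (rule r.pos_familyD[OF fam c])
    then have neg: "Re (s u0 u0) < \<rho> * quad u0" by (simp add: r_def)
    have "\<exists>f l. f \<in> D \<and> h f f = 1 \<and> (\<forall>i<k. h f (e i) = 0) \<and> l < \<rho> \<and>
           (\<forall>v\<in>D. s f v = complex_of_real l * h f v)"
    proof (rule eigenvector_step[OF s lower complete bounded e])
      show "s (e i) v = complex_of_real (\<mu> i) * h (e i) v" if "i < k" "v \<in> D" for i v
        using eig that by blast
    qed (use u0 orth neg in auto)
    then obtain f l where f: "f \<in> D" "h f f = 1" "\<And>i. i < k \<Longrightarrow> h f (e i) = 0" "l < \<rho>"
      "\<And>v. v \<in> D \<Longrightarrow> s f v = complex_of_real l * h f v"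
      by blast
    have "h (e i) f = 0" if "i < k" for i
      using f(3)[OF that] hermitian[OF f(1) orthonormal_in[OF e that]] by simp
    then have "orthonormal (Suc k) (e(k := f))"
      using e f by (auto simp: orthonormal_def less_Suc_eq)
    moreover have "(\<mu>(k := l)) i < \<rho> \<and> (\<forall>v\<in>D. s ((e(k := f)) i) v = complex_of_real ((\<mu>(k := l)) i) * h ((e(k := f)) i) v)"
      if "i < Suc k" for i
      using that eig f by (auto simp: less_Suc_eq)
    ultimately show ?case by blast
  qed
  then show ?thesis by blast
qed

lemma eigenvectors_pos_family:
  assumes s: "hermitian_form scale D s" and e: "orthonormal n e"
    and eig: "\<And>i v. i < n \<Longrightarrow> v \<in> D \<Longrightarrow> s (e i) v = complex_of_real (\<mu> i) * h (e i) v"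
    and less: "\<And>i. i < n \<Longrightarrow> \<mu> i < \<rho>"
  shows "hermitian_form.pos_family scale D (\<lambda>u v. complex_of_real \<rho> * h u v - s u v) n e"
proof -
  interpret s: hermitian_form scale D s by (rule s)
  define r where "r = (\<lambda>u v. complex_of_real \<rho> * h u v - s u v)"
  interpret r: hermitian_form scale D r
    by unfold_locales
      (simp_all add: r_def subspace add_left s.add_left scale_left s.scale_left hermitian[symmetric]
        s.hermitian[symmetric] algebra_simps)
  have eD: "e i \<in> D" if "i < n" for i using orthonormal_in[OF e that] .
  have "r.pos_family n e"
    unfolding r.pos_family_def
  proof (intro conjI allI impI)
    fix c :: "nat \<Rightarrow> complex" assume "\<exists>i<n. c i \<noteq> 0"
    then obtain j where j: "j < n" "c j \<noteq> 0" by blast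
    define x where "x = lincomb n e c"
    have x: "x \<in> D" unfolding x_def by (rule lincomb_in[OF eD])
    have "s x x = (\<Sum>i<n. c i * s (e i) x)"
      unfolding x_def using eD x[unfolded x_def] unfolding lincomb_def
      by (subst s.sum_left) (auto simp: s.scale_left)
    also have "\<dots> = (\<Sum>i<n. complex_of_real (\<mu> i * (cmod (c i))\<^sup>2))"
    proof (rule sum.cong)
      fix i assume "i \<in> {..<n}"
      then have i: "i < n" by simp
      have "h (e i) x = cnj (h x (e i))" by (rule hermitian[OF x eD[OF i]])
      then have "h (e i) x = cnj (c i)" unfolding x_def coeff_lincomb[OF e i] .
      then have "c i * s (e i) x = complex_of_real (\<mu> i) * (c i * cnj (c i))"
        using eig[OF i x] by (simp add: mult_ac)
      then show "c i * s (e i) x = complex_of_real (\<mu> i * (cmod (c i))\<^sup>2)"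
        by (simp only: complex_norm_square of_real_mult)
    qed simp
    finally have "Re (s x x) = (\<Sum>i<n. \<mu> i * (cmod (c i))\<^sup>2)" by (simp only: Re_sum Re_complex_of_real)
    moreover have "quad x = (\<Sum>i<n. (cmod (c i))\<^sup>2)" unfolding x_def by (rule quad_lincomb[OF e])
    ultimately have "Re (r x x) = (\<Sum>i<n. (\<rho> - \<mu> i) * (cmod (c i))\<^sup>2)"
      by (simp add: r_def left_diff_distrib sum_subtractf sum_distrib_left)
    moreover have "0 < (\<rho> - \<mu> j) * (cmod (c j))\<^sup>2" using less[OF j(1)] j(2) by simp
    moreover have "(\<rho> - \<mu> j) * (cmod (c j))\<^sup>2 \<le> (\<Sum>i<n. (\<rho> - \<mu> i) * (cmod (c i))\<^sup>2)"
    proof (rule member_le_sum)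
      fix i assume "i \<in> {..<n} - {j}"
      then have "\<mu> i < \<rho>" using less by simp
      then show "0 \<le> (\<rho> - \<mu> i) * (cmod (c i))\<^sup>2" by simp
    qed (use j in auto)
    ultimately show "0 < Re (r (lincomb n e c) (lincomb n e c))" by (simp add: x_def)
  qed (rule eD)
  then show ?thesis by (simp add: r_def)
qed

end

section \<open>The form of a measure on square-integrable functions\<close>

text \<open>Pointwise multiplication of a function by a complex scalar.\<close>

definition fscale :: "complex \<Rightarrow> ('a \<Rightarrow> complex) \<Rightarrow> 'a \<Rightarrow> complex" where
  "fscale c u = (\<lambda>x. c * u x)"

lemma fscale_apply [simp]: "fscale c u x = c * u x"
  by (simp add: fscale_def)

lemma vector_space_fscale: "vector_space fscale"
  by unfold_locales (auto simp: fun_eq_iff algebra_simps)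

lemma subspace_fscale: "module.subspace fscale A \<longleftrightarrow> fun_subspace A"
proof -
  interpret vector_space fscale by (rule vector_space_fscale)
  show ?thesis
    unfolding subspace_def fun_subspace_def
    by (auto simp: plus_fun_def zero_fun_def fscale_def)
qed

lemma hermitian_formI:
  assumes "fun_subspace D"
    and "\<And>u v w. u \<in> D \<Longrightarrow> v \<in> D \<Longrightarrow> w \<in> D \<Longrightarrow> h (u + v) w = h u w + h v w"
    and "\<And>c u v. u \<in> D \<Longrightarrow> v \<in> D \<Longrightarrow> h (fscale c u) v = c * h u v"
    and "\<And>u v. u \<in> D \<Longrightarrow> v \<in> D \<Longrightarrow> h v u = cnj (h u v)"
  shows "hermitian_form fscale D h"
  unfolding hermitian_form_def hermitian_form_axioms_def
  unfolding subspace_fscale using assms vector_space_fscale by blast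

lemma hermitian_form_subset:
  assumes "hermitian_form fscale D h" "fun_subspace E" "E \<subseteq> D"
  shows "hermitian_form fscale E h"
proof -
  interpret hermitian_form fscale D h by fact
  show ?thesis
  proof (rule hermitian_formI[OF assms(2)])
    fix u v assume "u \<in> E" "v \<in> E"
    then show "h v u = cnj (h u v)" using assms(3) by (intro hermitian) auto
  qed (use assms(3) in \<open>auto intro!: add_left scale_left\<close>)
qed

lemma L2_measurable [measurable_dest]: "u \<in> L2 M \<Longrightarrow> u \<in> borel_measurable M"
  and L2_integrable: "u \<in> L2 M \<Longrightarrow> integrable M (\<lambda>x. (cmod (u x))\<^sup>2)"
  by (simp_all add: L2_def)

lemma measurable_cnj [measurable (raw)]:
  "f \<in> borel_measurable M \<Longrightarrow> (\<lambda>x. cnj (f x)) \<in> borel_measurable M"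
  by (rule measurable_compose[OF _ borel_measurable_continuous_onI[OF continuous_on_cnj[OF continuous_on_id]]])

lemma integrable_L2_product:
  assumes "u \<in> L2 M" "v \<in> L2 M"
  shows "integrable M (\<lambda>x. u x * cnj (v x))"
proof (rule Bochner_Integration.integrable_bound)
  have [measurable]: "u \<in> borel_measurable M" "v \<in> borel_measurable M"
    using assms by (auto simp: L2_measurable)
  show "integrable M (\<lambda>x. (cmod (u x))\<^sup>2 + (cmod (v x))\<^sup>2)"
    using assms by (simp add: L2_integrable)
  show "(\<lambda>x. u x * cnj (v x)) \<in> borel_measurable M"
    by measurable
  have "cmod (u x * cnj (v x)) \<le> (cmod (u x))\<^sup>2 + (cmod (v x))\<^sup>2" for x
  proof -
    have "2 * (cmod (u x) * cmod (v x)) \<le> (cmod (u x))\<^sup>2 + (cmod (v x))\<^sup>2"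
      using sum_squares_bound[of "cmod (u x)" "cmod (v x)"] by simp
    then show ?thesis by (simp add: norm_mult) (smt (verit) mult_nonneg_nonneg norm_ge_zero)
  qed
  then show "AE x in M. norm (u x * cnj (v x)) \<le> norm ((cmod (u x))\<^sup>2 + (cmod (v x))\<^sup>2)"
    by simp
qed

lemma fun_subspace_L2: "fun_subspace (L2 M)"
  unfolding fun_subspace_def
proof (intro conjI ballI allI)
  fix u v assume uv: "u \<in> L2 M" "v \<in> L2 M"
  then have [measurable]: "u \<in> borel_measurable M" "v \<in> borel_measurable M"
    by (auto simp: L2_measurable)
  have "integrable M (\<lambda>x. (cmod (u x + v x))\<^sup>2)"
  proof (rule Bochner_Integration.integrable_bound)
    show "integrable M (\<lambda>x. 2 * (cmod (u x))\<^sup>2 + 2 * (cmod (v x))\<^sup>2)"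
      using uv by (simp add: L2_integrable)
    have "(cmod (u x + v x))\<^sup>2 \<le> 2 * (cmod (u x))\<^sup>2 + 2 * (cmod (v x))\<^sup>2" for x
    proof -
      have "(cmod (u x + v x))\<^sup>2 \<le> (cmod (u x) + cmod (v x))\<^sup>2"
        by (intro power_mono norm_triangle_ineq) simp
      also have "\<dots> \<le> 2 * (cmod (u x))\<^sup>2 + 2 * (cmod (v x))\<^sup>2"
        using sum_squares_bound[of "cmod (u x)" "cmod (v x)"] by (simp add: power2_sum)
      finally show ?thesis .
    qed
    then show "AE x in M. norm ((cmod (u x + v x))\<^sup>2) \<le> norm (2 * (cmod (u x))\<^sup>2 + 2 * (cmod (v x))\<^sup>2)"
      by simp
  qed measurable
  then show "(\<lambda>x. u x + v x) \<in> L2 M" by (simp add: L2_def)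
next
  fix c u assume u: "u \<in> L2 M"
  then show "(\<lambda>x. c * u x) \<in> L2 M"
    by (simp add: L2_def norm_mult power_mult_distrib borel_measurable_times)
qed (simp add: L2_def)

lemma quad_L2_inner: "L2_inner M u u = complex_of_real (\<integral>x. (cmod (u x))\<^sup>2 \<partial>M)"
  unfolding L2_inner_def by (simp only: complex_norm_square[symmetric] integral_complex_of_real)

lemma psd_form_L2: "psd_form fscale (L2 M) (L2_inner M)"
proof -
  have "hermitian_form fscale (L2 M) (L2_inner M)"
  proof (rule hermitian_formI[OF fun_subspace_L2])
    fix u v w assume "u \<in> L2 M" "v \<in> L2 M" "w \<in> L2 M"
    then show "L2_inner M (u + v) w = L2_inner M u w + L2_inner M v w"
      unfolding L2_inner_def plus_fun_apply distrib_right
      by (intro Bochner_Integration.integral_add integrable_L2_product)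
  next
    fix c u v assume "u \<in> L2 M" "v \<in> L2 M"
    then show "L2_inner M (fscale c u) v = c * L2_inner M u v"
      unfolding L2_inner_def fscale_apply mult.assoc by simp
  next
    fix u v assume "u \<in> L2 M" "v \<in> L2 M"
    show "L2_inner M v u = cnj (L2_inner M u v)"
      unfolding L2_inner_def by (simp add: mult.commute flip: Bochner_Integration.integral_cnj)
  qed
  then show ?thesis
    unfolding psd_form_def psd_form_axioms_def by (simp add: quad_L2_inner)
qed

lemma quad_L2_zero_iff:
  assumes "u \<in> L2 M"
  shows "Re (L2_inner M u u) = 0 \<longleftrightarrow> (AE x in M. u x = 0)"
  using integral_nonneg_eq_0_iff_AE[OF L2_integrable[OF assms]] by (simp add: quad_L2_inner)

lemma L2_density_iff:
  assumes "V \<in> borel_measurable M" "AE x in M. 0 \<le> V x"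
  shows "u \<in> L2 (density M (\<lambda>x. ennreal (V x))) \<longleftrightarrow>
    u \<in> borel_measurable M \<and> integrable M (\<lambda>x. V x * (cmod (u x))\<^sup>2)"
  unfolding L2_def using assms by (auto simp: integrable_density)

lemma quad_L2_density:
  assumes "V \<in> borel_measurable M" "AE x in M. 0 \<le> V x" "u \<in> borel_measurable M"
  shows "Re (L2_inner (density M (\<lambda>x. ennreal (V x))) u u) = (\<integral>x. V x * (cmod (u x))\<^sup>2 \<partial>M)"
  unfolding quad_L2_inner using assms by (simp add: integral_density)

lemma L2_inner_cong_AE:
  assumes "AE x in M. u x = u' x" "AE x in M. v x = v' x"
    and [measurable]: "u \<in> borel_measurable M" "u' \<in> borel_measurable M"
      "v \<in> borel_measurable M" "v' \<in> borel_measurable M"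
  shows "L2_inner M u v = L2_inner M u' v'"
  unfolding L2_inner_def
proof (rule integral_cong_AE)
qed (use assms in auto)

text \<open>
  Riesz--Fischer. Choose indices along which the \<open>k\<close>-th increment \<open>d k\<close> has squared norm at most
  \<open>4 powr -k\<close>. Then \<open>\<Sum>k. 2 ^ k * \<bar>d k x\<bar>\<^sup>2\<close> is integrable, hence finite almost everywhere, which
  forces pointwise convergence. Fatou's lemma gives convergence in norm.
\<close>

lemma L2_complete:
  assumes U: "\<And>n::nat. U n \<in> L2 M"
    and Cauchy: "\<And>\<epsilon>. \<epsilon> > 0 \<Longrightarrow> \<exists>N. \<forall>m\<ge>N. \<forall>n\<ge>N. Re (L2_inner M (U m - U n) (U m - U n)) < \<epsilon>"
  shows "\<exists>u\<in>L2 M. (\<lambda>n. Re (L2_inner M (U n - u) (U n - u))) \<longlonglongrightarrow> 0"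
proof -
  interpret H: psd_form fscale "L2 M" "L2_inner M" by (rule psd_form_L2)
  have [measurable]: "U n \<in> borel_measurable M" for n using U by (rule L2_measurable)
  have nn: "(\<integral>\<^sup>+x. ennreal ((cmod (v x))\<^sup>2) \<partial>M) = ennreal (Re (L2_inner M v v))" if "v \<in> L2 M" for v
    using L2_integrable[OF that] by (subst nn_integral_eq_integral) (auto simp: quad_L2_inner)
  have "\<forall>k. \<exists>N. \<forall>m\<ge>N. \<forall>n\<ge>N. Re (L2_inner M (U m - U n) (U m - U n)) < (1/4)^k"
    using Cauchy by simp
  then obtain N where N: "\<And>k m n. m \<ge> N k \<Longrightarrow> n \<ge> N k \<Longrightarrow> Re (L2_inner M (U m - U n) (U m - U n)) < (1/4)^k"
    by metis
  define \<sigma> where "\<sigma> k = Max (N ` {..k})" for k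
  have \<sigma>: "N j \<le> \<sigma> k" if "j \<le> k" for j k unfolding \<sigma>_def using that by (intro Max_ge) auto
  define d where "d k x = U (\<sigma> (Suc k)) x - U (\<sigma> k) x" for k x
  have d_int: "(\<integral>\<^sup>+x. ennreal (2^k * (cmod (d k x))\<^sup>2) \<partial>M) \<le> ennreal ((1/2)^k)" for k
  proof -
    have "(\<integral>\<^sup>+x. ennreal (2^k * (cmod (d k x))\<^sup>2) \<partial>M)
        = ennreal (2^k) * (\<integral>\<^sup>+x. ennreal ((cmod ((U (\<sigma> (Suc k)) - U (\<sigma> k)) x))\<^sup>2) \<partial>M)"
      unfolding d_def by (subst nn_integral_cmult[symmetric]) (auto simp: ennreal_mult)
    also have "\<dots> = ennreal (2^k * Re (L2_inner M (U (\<sigma> (Suc k)) - U (\<sigma> k)) (U (\<sigma> (Suc k)) - U (\<sigma> k))))"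
      using H.nonneg[OF H.D_diff[OF U U]] by (subst nn) (auto simp: U ennreal_mult)
    also have "\<dots> \<le> ennreal (2^k * (1/4)^k)"
      using N[of k "\<sigma> (Suc k)" "\<sigma> k"] \<sigma>[of k "Suc k"] \<sigma>[of k k] by (intro ennreal_leI mult_left_mono) auto
    also have "2^k * (1/4)^k = (1/2 :: real)^k" by (simp flip: power_mult_distrib)
    finally show ?thesis .
  qed
  have "(\<integral>\<^sup>+x. (\<Sum>k. ennreal (2^k * (cmod (d k x))\<^sup>2)) \<partial>M) = (\<Sum>k. \<integral>\<^sup>+x. ennreal (2^k * (cmod (d k x))\<^sup>2) \<partial>M)"
    by (rule nn_integral_suminf) (simp add: d_def)
  also have "\<dots> \<le> (\<Sum>k. ennreal ((1/2)^k))"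
    by (intro suminf_le d_int) auto
  also have "\<dots> = ennreal (\<Sum>k. (1/2)^k)"
    by (rule suminf_ennreal2) (auto intro!: summable_geometric)
  finally have "(\<integral>\<^sup>+x. (\<Sum>k. ennreal (2^k * (cmod (d k x))\<^sup>2)) \<partial>M) \<noteq> \<infinity>"
    by (auto simp: top_unique)
  then have "AE x in M. (\<Sum>k. ennreal (2^k * (cmod (d k x))\<^sup>2)) \<noteq> \<infinity>"
    by (rule nn_integral_PInf_AE[rotated]) (simp add: d_def)
  then have conv: "AE x in M. convergent (\<lambda>k. U (\<sigma> k) x)"
  proof eventually_elim
    fix x assume fin: "(\<Sum>k. ennreal (2^k * (cmod (d k x))\<^sup>2)) \<noteq> \<infinity>"
    then have s: "summable (\<lambda>k. 2^k * (cmod (d k x))\<^sup>2)"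
      by (intro summable_suminf_not_top) auto
    define B where "B = (\<Sum>k. 2^k * (cmod (d k x))\<^sup>2)"
    have "cmod (d k x) \<le> sqrt B * (1 / sqrt 2)^k" for k
    proof -
      have "2^k * (cmod (d k x))\<^sup>2 \<le> B"
        using sum_le_suminf[OF s, of "{k}"] by (simp add: B_def)
      then have "(cmod (d k x))\<^sup>2 \<le> B / 2^k" by (simp add: field_simps)
      then have "cmod (d k x) \<le> sqrt (B / 2^k)" by (rule real_le_rsqrt)
      then show ?thesis by (simp add: real_sqrt_divide real_sqrt_power power_divide)
    qed
    then have "summable (\<lambda>k. d k x)"
      by (intro summable_comparison_test'[OF summable_mult[OF summable_geometric[of "1 / sqrt 2"]], of 0]) simp_all
    then have "convergent (\<lambda>k. U (\<sigma> 0) x + (\<Sum>j<k. d j x))"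
      by (intro convergent_add convergent_const) (simp add: summable_iff_convergent)
    moreover have "U (\<sigma> 0) x + (\<Sum>j<k. d j x) = U (\<sigma> k) x" for k
      unfolding d_def by (subst sum_lessThan_telescope) simp
    ultimately show "convergent (\<lambda>k. U (\<sigma> k) x)" by simp
  qed
  define u where "u x = lim (\<lambda>k. U (\<sigma> k) x)" for x
  have [measurable]: "u \<in> borel_measurable M" unfolding u_def by measurable
  have fatou: "(\<integral>\<^sup>+x. ennreal ((cmod ((U n - u) x))\<^sup>2) \<partial>M) \<le> ennreal ((1/4)^k)" if n: "n \<ge> N k" for n k
  proof -
    have "AE x in M. ennreal ((cmod ((U n - u) x))\<^sup>2) = liminf (\<lambda>j. ennreal ((cmod (U n x - U (\<sigma> j) x))\<^sup>2))"
      using conv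
    proof eventually_elim
      fix x assume "convergent (\<lambda>k. U (\<sigma> k) x)"
      then have "(\<lambda>k. U (\<sigma> k) x) \<longlonglongrightarrow> u x" by (simp add: u_def convergent_LIMSEQ_iff)
      then have "(\<lambda>j. (cmod (U n x - U (\<sigma> j) x))\<^sup>2) \<longlonglongrightarrow> (cmod (U n x - u x))\<^sup>2"
        by (intro tendsto_intros)
      from lim_imp_Liminf[OF sequentially_bot tendsto_ennrealI[OF this]]
      show "ennreal ((cmod ((U n - u) x))\<^sup>2) = liminf (\<lambda>j. ennreal ((cmod (U n x - U (\<sigma> j) x))\<^sup>2))"
        by simp
    qed
    then have "(\<integral>\<^sup>+x. ennreal ((cmod ((U n - u) x))\<^sup>2) \<partial>M)
        = (\<integral>\<^sup>+x. liminf (\<lambda>j. ennreal ((cmod (U n x - U (\<sigma> j) x))\<^sup>2)) \<partial>M)"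
      by (rule nn_integral_cong_AE)
    also have "\<dots> \<le> liminf (\<lambda>j. \<integral>\<^sup>+x. ennreal ((cmod (U n x - U (\<sigma> j) x))\<^sup>2) \<partial>M)"
      by (rule nn_integral_liminf) measurable
    also have "\<dots> \<le> ennreal ((1/4)^k)"
    proof (rule Liminf_le)
      have "(\<integral>\<^sup>+x. ennreal ((cmod (U n x - U (\<sigma> j) x))\<^sup>2) \<partial>M) \<le> ennreal ((1/4)^k)" if "j \<ge> k" for j
        using nn[OF H.D_diff[OF U U], of n "\<sigma> j"] N[of k n "\<sigma> j"] n \<sigma>[OF that] by (simp add: ennreal_leI)
      then show "\<forall>\<^sub>F j in sequentially. (\<integral>\<^sup>+x. ennreal ((cmod (U n x - U (\<sigma> j) x))\<^sup>2) \<partial>M) \<le> ennreal ((1/4)^k)"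
        by (auto simp: eventually_sequentially)
    qed simp
    finally show ?thesis .
  qed
  have "integrable M (\<lambda>x. (cmod ((U (N 0) - u) x))\<^sup>2)"
  proof (rule integrableI_nonneg)
    show "(\<integral>\<^sup>+x. ennreal ((cmod ((U (N 0) - u) x))\<^sup>2) \<partial>M) < \<infinity>"
      using fatou[of 0 "N 0"] by (auto simp: le_less_trans)
  qed auto
  moreover have "U (N 0) - u \<in> borel_measurable M" unfolding fun_diff_def by measurable
  ultimately have "U (N 0) - u \<in> L2 M" by (simp add: L2_def)
  then have "U (N 0) - (U (N 0) - u) \<in> L2 M" using U by (rule H.D_diff[rotated])
  moreover have "U (N 0) - (U (N 0) - u) = u" by (simp add: fun_eq_iff)
  ultimately have u: "u \<in> L2 M" by simp
  have small: "Re (L2_inner M (U n - u) (U n - u)) \<le> (1/4)^k" if "n \<ge> N k" for n k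
    using fatou[OF that] nn[OF H.D_diff[OF U u], of n] by simp
  have "(\<lambda>n. Re (L2_inner M (U n - u) (U n - u))) \<longlonglongrightarrow> 0"
  proof (rule LIMSEQ_I)
    fix r :: real assume "r > 0"
    then obtain k where k: "(1/4::real)^k < r" using real_arch_pow_inv[of r "1/4"] by auto
    have "norm (Re (L2_inner M (U n - u) (U n - u)) - 0) < r" if "n \<ge> N k" for n
      using small[OF that] k H.nonneg[OF H.D_diff[OF U u], of n] by simp
    then show "\<exists>no. \<forall>n\<ge>no. norm (Re (L2_inner M (U n - u) (U n - u)) - 0) < r" by blast
  qed
  then show ?thesis using u by blast
qed

section \<open>The inequalities of Young and Hoelder\<close>

lemma weighted_young:
  fixes a :: real
  assumes "0 < a" "a < 1" "0 \<le> x" "0 \<le> y"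
  shows "x powr a * y powr (1 - a) \<le> a * x + (1 - a) * y"
proof (cases "x = 0 \<or> y = 0")
  case True
  then show ?thesis using assms by auto
next
  case False
  then show ?thesis using assms by (intro Youngs_inequality_0) auto
qed

lemma hoelder:
  fixes f g :: "'a \<Rightarrow> real"
  assumes a: "0 < a" "a < 1"
    and nn: "\<And>x. 0 \<le> f x" "\<And>x. 0 \<le> g x"
    and int: "integrable M f" "integrable M g"
  shows "integrable M (\<lambda>x. f x powr a * g x powr (1 - a))"
    and "(\<integral>x. f x powr a * g x powr (1 - a) \<partial>M) \<le> (\<integral>x. f x \<partial>M) powr a * (\<integral>x. g x \<partial>M) powr (1 - a)"
proof -
  have [measurable]: "f \<in> borel_measurable M" "g \<in> borel_measurable M" using int by auto
  show I: "integrable M (\<lambda>x. f x powr a * g x powr (1 - a))"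
  proof (rule Bochner_Integration.integrable_bound)
    show "integrable M (\<lambda>x. a * f x + (1 - a) * g x)" using int by simp
    show "AE x in M. norm (f x powr a * g x powr (1 - a)) \<le> norm (a * f x + (1 - a) * g x)"
      using weighted_young[OF a nn] nn a by (auto simp: abs_of_nonneg)
  qed measurable
  define F G where "F = (\<integral>x. f x \<partial>M)" and "G = (\<integral>x. g x \<partial>M)"
  have FG: "0 \<le> F" "0 \<le> G" using nn by (auto simp: F_def G_def)
  show "(\<integral>x. f x powr a * g x powr (1 - a) \<partial>M) \<le> F powr a * G powr (1 - a)"
  proof (cases "F = 0 \<or> G = 0")
    case True
    then have "AE x in M. f x powr a * g x powr (1 - a) = 0"
    proof
      assume "F = 0"
      then have "AE x in M. f x = 0"
        using integral_nonneg_eq_0_iff_AE[OF int(1)] nn by (simp add: F_def)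
      then show ?thesis by eventually_elim simp
    next
      assume "G = 0"
      then have "AE x in M. g x = 0"
        using integral_nonneg_eq_0_iff_AE[OF int(2)] nn by (simp add: G_def)
      then show ?thesis by eventually_elim simp
    qed
    then have "(\<integral>x. f x powr a * g x powr (1 - a) \<partial>M) = 0"
      by (subst integral_cong_AE[where g = "\<lambda>x. 0"]) auto
    then show ?thesis by simp
  next
    case False
    then have pos: "0 < F" "0 < G" using FG by auto
    define P where "P = F powr a * G powr (1 - a)"
    have P: "0 < P" using pos by (simp add: P_def)
    have "f x powr a * g x powr (1 - a) \<le> P * (a * (f x / F) + (1 - a) * (g x / G))" for x
    proof -
      have "f x powr a * g x powr (1 - a) = P * ((f x / F) powr a * (g x / G) powr (1 - a))"
        using nn[of x] pos by (simp add: P_def powr_divide)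
      also have "\<dots> \<le> P * (a * (f x / F) + (1 - a) * (g x / G))"
        using P nn[of x] pos a by (intro mult_left_mono weighted_young) auto
      finally show ?thesis .
    qed
    then have "(\<integral>x. f x powr a * g x powr (1 - a) \<partial>M) \<le> (\<integral>x. P * (a * (f x / F) + (1 - a) * (g x / G)) \<partial>M)"
      using int by (intro integral_mono I) auto
    also have "\<dots> = P * (a * (F / F) + (1 - a) * (G / G))"
      using int by (simp add: F_def G_def)
    also have "\<dots> = P" using pos by simp
    finally show ?thesis by (simp add: P_def)
  qed
qed

lemma hoelder_sum:
  fixes f g :: "'i \<Rightarrow> real"
  assumes "0 < a" "a < 1" "\<And>x. 0 \<le> f x" "\<And>x. 0 \<le> g x" "finite I"
  shows "(\<Sum>x\<in>I. f x powr a * g x powr (1 - a)) \<le> (\<Sum>x\<in>I. f x) powr a * (\<Sum>x\<in>I. g x) powr (1 - a)"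
  using hoelder(2)[OF assms(1-4) integrable_count_space[OF assms(5)] integrable_count_space[OF assms(5)]] assms(5)
  by (simp add: lebesgue_integral_count_space_finite)

section \<open>Step functions and a discrete decay estimate\<close>

lemma L2_simple_approx:
  assumes u: "u \<in> L2 M" and \<epsilon>: "0 < \<epsilon>"
  shows "\<exists>s. simple_function M s \<and> s \<in> L2 M \<and> Re (L2_inner M (u - s) (u - s)) < \<epsilon>"
proof -
  have [measurable]: "u \<in> borel_measurable M" using u by (rule L2_measurable)
  obtain F where F: "\<And>i. simple_function M (F i)" "\<And>x. x \<in> space M \<Longrightarrow> (\<lambda>i. F i x) \<longlonglongrightarrow> u x"
    "\<And>i x. x \<in> space M \<Longrightarrow> dist (F i x) 0 \<le> 2 * dist (u x) 0"
    using borel_measurable_implies_sequence_metric[OF \<open>u \<in> borel_measurable M\<close>, of 0] by blast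
  have [measurable]: "F i \<in> borel_measurable M" for i using F(1) by (rule borel_measurable_simple_function)
  have sq: "(cmod (F i x))\<^sup>2 \<le> 4 * (cmod (u x))\<^sup>2" if "x \<in> space M" for i x
  proof -
    have "cmod (F i x) \<le> 2 * cmod (u x)" using F(3)[OF that] by simp
    from power_mono[OF this, of 2] show ?thesis by (simp add: power_mult_distrib)
  qed
  have F_L2: "F i \<in> L2 M" for i
    unfolding L2_def
  proof (intro CollectI conjI, measurable, rule Bochner_Integration.integrable_bound)
    show "integrable M (\<lambda>x. 4 * (cmod (u x))\<^sup>2)" using L2_integrable[OF u] by simp
    show "AE x in M. norm ((cmod (F i x))\<^sup>2) \<le> norm (4 * (cmod (u x))\<^sup>2)" using sq by (intro AE_I2) auto
  qed measurable
  have "(\<lambda>i. \<integral>x. (cmod ((u - F i) x))\<^sup>2 \<partial>M) \<longlonglongrightarrow> (\<integral>x. 0 \<partial>M)"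
  proof (rule integral_dominated_convergence)
    show "integrable M (\<lambda>x. 10 * (cmod (u x))\<^sup>2)" using L2_integrable[OF u] by simp
    show "AE x in M. (\<lambda>i. (cmod ((u - F i) x))\<^sup>2) \<longlonglongrightarrow> 0"
    proof (rule AE_I2)
      fix x assume "x \<in> space M"
      from F(2)[OF this] have "(\<lambda>i. (cmod (u x - F i x))\<^sup>2) \<longlonglongrightarrow> (cmod (u x - u x))\<^sup>2"
        by (intro tendsto_intros)
      then show "(\<lambda>i. (cmod ((u - F i) x))\<^sup>2) \<longlonglongrightarrow> 0" by simp
    qed
    show "AE x in M. norm ((cmod ((u - F i) x))\<^sup>2) \<le> 10 * (cmod (u x))\<^sup>2" for i
    proof (rule AE_I2)
      fix x assume "x \<in> space M"
      have "(cmod (u x - F i x))\<^sup>2 \<le> (cmod (u x) + cmod (F i x))\<^sup>2"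
        by (intro power_mono norm_triangle_ineq4) simp
      also have "\<dots> \<le> 2 * (cmod (u x))\<^sup>2 + 2 * (cmod (F i x))\<^sup>2"
        using sum_squares_bound[of "cmod (u x)" "cmod (F i x)"] by (simp add: power2_sum)
      finally show "norm ((cmod ((u - F i) x))\<^sup>2) \<le> 10 * (cmod (u x))\<^sup>2"
        using sq[OF \<open>x \<in> space M\<close>, of i] by simp
    qed
  qed (simp_all add: fun_diff_def)
  then have "(\<lambda>i. \<integral>x. (cmod ((u - F i) x))\<^sup>2 \<partial>M) \<longlonglongrightarrow> 0" by simp
  then have "eventually (\<lambda>i. (\<integral>x. (cmod ((u - F i) x))\<^sup>2 \<partial>M) < \<epsilon>) sequentially"
    using \<epsilon> by (rule order_tendstoD)
  then obtain i where "(\<integral>x. (cmod ((u - F i) x))\<^sup>2 \<partial>M) < \<epsilon>"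
    by (auto simp: eventually_sequentially)
  then show ?thesis using F(1) F_L2 by (intro exI[of _ "F i"]) (simp add: quad_L2_inner)
qed

text \<open>
  Finitely many square-integrable functions are approximated simultaneously in the span of a
  non-negative orthonormal family, namely the normalised indicators of the cells of a partition.
\<close>

lemma nonneg_orthonormal_approx:
  fixes n :: nat
  assumes u: "\<And>j. j < n \<Longrightarrow> u j \<in> L2 M" and \<epsilon>: "0 < \<epsilon>"
  shows "\<exists>N e. hermitian_form.orthonormal (L2 M) (L2_inner M) N e \<and>
      (\<forall>i<N. \<exists>f. (\<forall>x. 0 \<le> f x) \<and> e i = (\<lambda>x. complex_of_real (f x))) \<and>
      (\<forall>j<n. Re (L2_inner M (u j - hermitian_form.proj fscale (L2_inner M) N e (u j))
                             (u j - hermitian_form.proj fscale (L2_inner M) N e (u j))) < \<epsilon>)"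
proof -
  interpret H: psd_form fscale "L2 M" "L2_inner M" by (rule psd_form_L2)
  have "\<forall>j. \<exists>s. j < n \<longrightarrow> simple_function M s \<and> s \<in> L2 M \<and> Re (L2_inner M (u j - s) (u j - s)) < \<epsilon>"
    using L2_simple_approx[OF u \<epsilon>] by blast
  then obtain s where s: "\<And>j. j < n \<Longrightarrow> simple_function M (s j)" "\<And>j. j < n \<Longrightarrow> s j \<in> L2 M"
    "\<And>j. j < n \<Longrightarrow> Re (L2_inner M (u j - s j) (u j - s j)) < \<epsilon>"
    by metis
  define T where "T x = restrict (\<lambda>j. s j x) {..<n}" for x
  have "T ` space M \<subseteq> PiE {..<n} (\<lambda>j. s j ` space M)" by (auto simp: T_def split: if_splits)
  moreover have "finite (PiE {..<n} (\<lambda>j. s j ` space M))"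
    using s(1) by (intro finite_PiE) (auto simp: simple_function_def)
  ultimately have finT: "finite (T ` space M)" by (rule finite_subset)
  define B where "B v = {x \<in> space M. T x = v}" for v
  have B_sets: "B v \<in> sets M" if "v \<in> T ` space M" for v
  proof -
    have "B v = {x \<in> space M. \<forall>j\<in>{..<n}. s j x = v j}"
      using that by (auto simp: B_def T_def fun_eq_iff restrict_def)
    also have "\<dots> = space M \<inter> (\<Inter>j\<in>{..<n}. s j -` {v j} \<inter> space M) \<union> (if n = 0 then space M else {})"
      by auto
    also have "\<dots> \<in> sets M"
    proof (cases "n = 0")
      case False
      then have "(\<Inter>j\<in>{..<n}. s j -` {v j} \<inter> space M) \<in> sets M"
        using simple_functionD(2)[OF s(1)] by (intro sets.finite_INT) auto
      then show ?thesis using False by (simp add: sets.Int)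
    qed auto
    finally show ?thesis .
  qed
  define V where "V = {v \<in> T ` space M. (\<exists>j<n. v j \<noteq> 0) \<and> emeasure M (B v) \<noteq> 0}"
  have finV: "finite V" using finT by (simp add: V_def)
  have B_pos: "0 < measure M (B v)" and B_fin: "emeasure M (B v) < \<infinity>" if v: "v \<in> V" for v
  proof -
    obtain j where j: "j < n" "v j \<noteq> 0" using v by (auto simp: V_def)
    have [measurable]: "B v \<in> sets M" using v by (intro B_sets) (simp add: V_def)
    have "ennreal ((cmod (v j))\<^sup>2) * emeasure M (B v) = (\<integral>\<^sup>+x. ennreal ((cmod (v j))\<^sup>2) * indicator (B v) x \<partial>M)"
      by (simp add: nn_integral_cmult_indicator)
    also have "\<dots> \<le> (\<integral>\<^sup>+x. ennreal ((cmod (s j x))\<^sup>2) \<partial>M)"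
    proof (rule nn_integral_mono)
      fix x
      have "v j = s j x" if "x \<in> B v" using that j by (auto simp: B_def T_def)
      then show "ennreal ((cmod (v j))\<^sup>2) * indicator (B v) x \<le> ennreal ((cmod (s j x))\<^sup>2)"
        by (simp add: indicator_def)
    qed
    also have "\<dots> < \<infinity>"
      using L2_integrable[OF s(2)[OF j(1)]] by (subst nn_integral_eq_integral) auto
    finally have "ennreal ((cmod (v j))\<^sup>2) * emeasure M (B v) < \<infinity>" .
    then show fin: "emeasure M (B v) < \<infinity>"
      using j(2) by (auto simp: ennreal_mult_less_top)
    show "0 < measure M (B v)"
      using v fin by (auto simp: V_def measure_def enn2real_positive_iff less_top zero_less_iff_neq_zero)
  qed
  obtain \<beta> where \<beta>: "bij_betw \<beta> {..<card V} V"
    using ex_bij_betw_nat_finite[OF finV] by (auto simp: lessThan_atLeast0)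
  define N where "N = card V"
  have \<beta>V: "\<beta> i \<in> V" if "i < N" for i using \<beta> that by (auto simp: bij_betw_def N_def)
  define f where "f i x = indicator (B (\<beta> i)) x / sqrt (measure M (B (\<beta> i)))" for i x
  define e where "e i = (\<lambda>x. complex_of_real (f i x))" for i
  have B_meas [measurable]: "B (\<beta> i) \<in> sets M" if "i < N" for i
    using \<beta>V[OF that] by (intro B_sets) (simp add: V_def)
  have f_sq: "(f i x)\<^sup>2 = indicator (B (\<beta> i)) x / measure M (B (\<beta> i))" if "i < N" for i x
    using B_pos[OF \<beta>V[OF that]] by (simp add: f_def power_divide indicator_def)
  have int_ind: "integrable M (indicator (B (\<beta> i)) :: 'a \<Rightarrow> real)" if "i < N" for i
    using B_fin[OF \<beta>V[OF that]] B_meas[OF that] by (simp add: integrable_indicator_iff)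
  have eL2: "e i \<in> L2 M" if "i < N" for i
  proof -
    have "f i \<in> borel_measurable M"
      unfolding f_def using B_meas[OF that] by measurable
    moreover have "integrable M (\<lambda>x. (f i x)\<^sup>2)"
      using f_sq[OF that] int_ind[OF that] by simp
    ultimately show ?thesis
      unfolding L2_def e_def by (simp add: power2_abs)
  qed
  have disj: "f i x * f j x = 0" if "i < N" "j < N" "i \<noteq> j" for i j x
  proof -
    have "\<beta> i \<noteq> \<beta> j" using \<beta> that by (auto simp: bij_betw_def N_def inj_on_def)
    then show ?thesis by (auto simp: f_def B_def indicator_def)
  qed
  have inner: "L2_inner M (e i) (e j) = complex_of_real (\<integral>x. f i x * f j x \<partial>M)" for i j
    unfolding L2_inner_def e_def by (simp flip: of_real_mult)
  have orth: "H.orthonormal N e"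
    unfolding H.orthonormal_def
  proof (intro conjI allI impI)
    fix i j assume ij: "i < N" "j < N"
    show "L2_inner M (e i) (e j) = (if i = j then 1 else 0)"
    proof (cases "i = j")
      case True
      have "(\<integral>x. f i x * f i x \<partial>M) = (\<integral>x. indicator (B (\<beta> i)) x / measure M (B (\<beta> i)) \<partial>M)"
        using f_sq[OF ij(1)] by (simp add: power2_eq_square)
      also have "\<dots> = 1"
        using B_pos[OF \<beta>V[OF ij(1)]] B_meas[OF ij(1)] B_fin[OF \<beta>V[OF ij(1)]] by simp
      finally show ?thesis unfolding inner using True by simp
    next
      case False
      then have "(\<lambda>x. f i x * f j x) = (\<lambda>x. 0)" using disj[OF ij] by (intro ext) blast
      then show ?thesis unfolding inner using False by simp
    qed
  qed (rule eL2)
  have step: "\<exists>c. AE x in M. s j x = H.lincomb N e c x" if j: "j < n" for j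
  proof -
    define c where "c i = \<beta> i j * complex_of_real (sqrt (measure M (B (\<beta> i))))" for i
    define Z where "Z = (\<Union>v\<in>{v \<in> T ` space M. emeasure M (B v) = 0}. B v)"
    have "Z \<in> null_sets M"
      unfolding Z_def
    proof (rule null_sets_UN')
      show "countable {v \<in> T ` space M. emeasure M (B v) = 0}"
        using finT by (intro countable_finite) auto
      show "B v \<in> null_sets M" if "v \<in> {v \<in> T ` space M. emeasure M (B v) = 0}" for v
        using that B_sets by auto
    qed
    moreover have "s j x = H.lincomb N e c x" if x: "x \<in> space M" "x \<notin> Z" for x
    proof -
      have nz: "emeasure M (B (T x)) \<noteq> 0" using x by (auto simp: Z_def B_def)
      have lin: "H.lincomb N e c x = (\<Sum>i<N. \<beta> i j * indicator (B (\<beta> i)) x)"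
      proof -
        have "H.lincomb N e c x = (\<Sum>i<N. c i * e i x)"
        proof -
          have "(\<Sum>i<m. fscale (c i) (e i)) x = (\<Sum>i<m. c i * e i x)" for m
            by (induction m) auto
          then show ?thesis by (simp add: H.lincomb_def)
        qed
        also have "\<dots> = (\<Sum>i<N. \<beta> i j * indicator (B (\<beta> i)) x)"
        proof (rule sum.cong)
          fix i assume "i \<in> {..<N}"
          then have "measure M (B (\<beta> i)) > 0" using B_pos[OF \<beta>V] by auto
          then show "c i * e i x = \<beta> i j * indicator (B (\<beta> i)) x"
            by (auto simp: c_def e_def f_def indicator_def)
        qed simp
        finally show ?thesis .
      qed
      also have "\<dots> = (\<Sum>v\<in>V. v j * indicator (B v) x)"
        using sum.reindex_bij_betw[OF \<beta>, of "\<lambda>v. v j * indicator (B v) x"] by (simp add: N_def)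
      also have "\<dots> = (\<Sum>v\<in>V. if v = T x then T x j else 0)"
        using x by (intro sum.cong) (auto simp: B_def indicator_def)
      also have "\<dots> = (if T x \<in> V then T x j else 0)"
        using finV by simp
      also have "\<dots> = s j x"
        using nz x j by (auto simp: V_def T_def)
      finally show ?thesis by simp
    qed
    ultimately have "AE x in M. s j x = H.lincomb N e c x"
      by (intro AE_I'[of Z]) auto
    then show ?thesis by blast
  qed
  have "Re (L2_inner M (u j - H.proj N e (u j)) (u j - H.proj N e (u j))) < \<epsilon>" if j: "j < n" for j
  proof -
    obtain c where c: "AE x in M. s j x = H.lincomb N e c x" using step[OF j] by blast
    have lin: "H.lincomb N e c \<in> L2 M" using eL2 by (intro H.lincomb_in)
    have "Re (L2_inner M (u j - H.proj N e (u j)) (u j - H.proj N e (u j)))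
        \<le> Re (L2_inner M (u j - H.lincomb N e c) (u j - H.lincomb N e c))"
      by (rule H.projection_best[OF orth u[OF j]])
    also have "\<dots> = Re (L2_inner M (u j - s j) (u j - s j))"
      using c u[OF j] s(2)[OF j] lin
      by (intro arg_cong[where f = Re] L2_inner_cong_AE) (auto intro!: L2_measurable H.D_diff)
    also have "\<dots> < \<epsilon>" by (rule s(3)[OF j])
    finally show ?thesis .
  qed
  moreover have "(\<forall>x. 0 \<le> f i x) \<and> e i = (\<lambda>x. complex_of_real (f i x))" for i
    by (simp add: e_def f_def)
  ultimately show ?thesis
    using orth by blast
qed

text \<open>
  Implicit Euler steps of size \<open>1 / n\<close> for the differential inequality
  \<open>z' \<le> - \<kappa> z powr (1 + s)\<close>: after \<open>n\<close> steps the solution has a bound independent of its initial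
  value, provided that \<open>n\<close> is large in terms of a bound \<open>A\<close> for that value. While
  \<open>\<kappa> / n * z powr s\<close> exceeds one, each step at least halves \<open>z\<close>, so this phase lasts for at most
  half of the steps; from then on \<open>z powr - s\<close> grows linearly.
\<close>

lemma discrete_decay:
  fixes A \<kappa> s :: real
  assumes "0 < \<kappa>" "0 < s" "s \<le> 1"
  shows "\<exists>n\<ge>1. \<forall>z :: nat \<Rightarrow> real. (\<forall>k. 0 \<le> z k) \<longrightarrow> z 0 \<le> A \<longrightarrow>
           (\<forall>k. z (Suc k) + \<kappa> / real n * z (Suc k) powr (1 + s) \<le> z k) \<longrightarrow>
           z n \<le> (8 / (s * \<kappa>)) powr (1 / s)"
proof -
  obtain m0 where m0: "A * \<kappa> powr (1 / s) < 2 ^ m0"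
    using real_arch_pow[of 2 "A * \<kappa> powr (1 / s)"] by auto
  define m where "m = Suc m0"
  have "2 ^ m0 \<le> (2::real) ^ m" by (simp add: m_def)
  then have m: "A * \<kappa> powr (1 / s) < 2 ^ m" "1 \<le> m" using m0 by (linarith, simp add: m_def)
  define c where "c = \<kappa> / real (2 * m)"
  have c: "0 < c" "c \<le> \<kappa>" using assms m by (auto simp: c_def field_simps)
  have "z (2 * m) \<le> (8 / (s * \<kappa>)) powr (1 / s)"
    if nn: "\<And>k. 0 \<le> z k" and z0: "z 0 \<le> A" and rec: "\<And>k. z (Suc k) + c * z (Suc k) powr (1 + s) \<le> z k" for z
  proof (cases "z (2 * m) = 0")
    case False
    have dec: "z (Suc k) \<le> z k" for k
    proof -
      have "0 \<le> c * z (Suc k) powr (1 + s)" using c by simp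
      then show ?thesis using rec[of k] by linarith
    qed
    have anti: "z l \<le> z k" if "k \<le> l" for k l
      using dec that by (rule lift_Suc_antimono_le)
    have pos: "0 < z k" if "k \<le> 2 * m" for k
      using anti[OF that] False nn[of "2 * m"] by linarith
    have step: "z (Suc k) * (1 + c * z (Suc k) powr s) \<le> z k" if "Suc k \<le> 2 * m" for k
      using rec[of k] pos[OF that] by (simp add: powr_add algebra_simps)
    have mid: "c * z m powr s \<le> 1"
    proof (rule ccontr)
      assume large: "\<not> ?thesis"
      have "z m * 2 ^ j \<le> z (m - j)" if "j \<le> m" for j
        using that
      proof (induction j)
        case (Suc j)
        define k where "k = m - Suc j"
        have k: "m - j = Suc k" "Suc k \<le> 2 * m" "Suc k \<le> m" using Suc.prems by (auto simp: k_def)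
        have "z m powr s \<le> z (Suc k) powr s"
          using anti[OF k(3)] nn assms by (intro powr_mono2) auto
        then have "c * z m powr s \<le> c * z (Suc k) powr s" using c by simp
        then have "1 \<le> c * z (Suc k) powr s" using large by linarith
        then have "z (Suc k) * 2 \<le> z (Suc k) * (1 + c * z (Suc k) powr s)"
          using nn by (intro mult_left_mono) auto
        also have "\<dots> \<le> z k" by (rule step[OF k(2)])
        finally have "z (Suc k) * 2 \<le> z k" .
        then show ?case using Suc k by (simp add: k_def)
      qed simp
      from this[of m] have zm: "z m * 2 ^ m \<le> A" using z0 by simp
      have "1 < \<kappa> * z m powr s"
        using large c mult_right_mono[of c \<kappa> "z m powr s"] by simp
      then have "1 < (\<kappa> * z m powr s) powr (1 / s)"
        using assms by (intro gr_one_powr) auto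
      also have "\<dots> = \<kappa> powr (1 / s) * z m"
        using assms pos[of m] by (simp add: powr_mult powr_powr)
      finally have "2 ^ m < \<kappa> powr (1 / s) * z m * 2 ^ m" by simp
      also have "\<dots> \<le> \<kappa> powr (1 / s) * A"
        using mult_left_mono[OF zm, of "\<kappa> powr (1 / s)"] by (simp add: algebra_simps)
      finally show False using m(1) by (simp add: mult.commute)
    qed
    have grow: "real j * (s * c / 4) \<le> z (m + j) powr - s" if "j \<le> m" for j
      using that
    proof (induction j)
      case (Suc j)
      define y where "y = z (Suc (m + j))"
      have le: "Suc (m + j) \<le> 2 * m" using Suc.prems by simp
      have y: "0 < y" unfolding y_def by (rule pos[OF le])
      define x where "x = c * y powr s"
      have x0: "0 < x" using c y by (simp add: x_def)
      have "y powr s \<le> z m powr s"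
        unfolding y_def using assms nn by (intro powr_mono2 anti) auto
      then have "c * y powr s \<le> c * z m powr s" using c by simp
      then have x1: "x \<le> 1" using mid unfolding x_def by linarith
      have "x / 2 \<le> x / (1 + x)" using x0 x1 by (intro divide_left_mono) auto
      also have "\<dots> = 1 - 1 / (1 + x)" using x0 by (simp add: field_simps)
      also have "\<dots> \<le> ln (1 + x)"
        using ln_le_minus_one[of "1 / (1 + x)"] x0 by (simp add: ln_div)
      finally have ln: "s * (x / 2) \<le> s * ln (1 + x)" using assms by simp
      have "1 + s * (x / 2) \<le> exp (s * (x / 2))" by (rule exp_ge_add_one_self)
      also have "\<dots> \<le> exp (s * ln (1 + x))" using ln by simp
      also have "\<dots> = (1 + x) powr s" using x0 by (simp add: powr_def)
      finally have pw: "1 + s * (x / 2) \<le> (1 + x) powr s" .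
      have sx: "0 < s * x" "s * x \<le> 1" using assms x0 x1 by (auto intro: mult_le_one)
      have "(1 + x) powr - s \<le> 1 / (1 + s * (x / 2))"
        unfolding powr_minus_divide using pw sx x0 by (intro divide_left_mono mult_pos_pos) auto
      also have "\<dots> \<le> 1 - s * x / 4"
      proof -
        have "1 \<le> (1 - s * x / 4) * (1 + s * (x / 2))"
          using sx mult_left_mono[of "s * x" 1 "s * x"] by (simp add: algebra_simps)
        then show ?thesis using sx by (simp add: divide_le_eq)
      qed
      finally have "y powr - s * (1 + x) powr - s \<le> y powr - s * (1 - s * x / 4)"
        by (intro mult_left_mono) auto
      also have "\<dots> = y powr - s - s * c / 4"
        using y by (simp add: x_def algebra_simps flip: powr_add)
      finally have "(y * (1 + x)) powr - s \<le> y powr - s - s * c / 4"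
        using y x0 by (simp add: powr_mult)
      moreover have "z (m + j) powr - s \<le> (y * (1 + x)) powr - s"
        using step[OF le] y x0 assms by (intro powr_mono2') (auto simp: y_def x_def)
      ultimately show ?case using Suc by (simp add: y_def algebra_simps)
    qed simp
    have "s * \<kappa> / 8 \<le> z (2 * m) powr - s"
      using grow[of m] m by (simp add: c_def field_simps flip: mult_2)
    then have "(z (2 * m) powr - s) powr - (1 / s) \<le> (s * \<kappa> / 8) powr - (1 / s)"
      using assms by (intro powr_mono2') auto
    moreover have "(s * \<kappa> / 8) powr - (1 / s) = (8 / (s * \<kappa>)) powr (1 / s)"
      using assms by (simp add: powr_minus powr_divide)
    ultimately show ?thesis
      using assms pos[of "2 * m"] by (simp add: powr_powr)
  qed simp
  then show ?thesis
    using m(2) unfolding c_def by (intro exI[of _ "2 * m"]) auto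
qed

section \<open>Negative eigenvalues of a positivity preserving form with a Sobolev inequality\<close>

text \<open>
  A complete form with a Sobolev inequality that does not increase under \<open>u \<mapsto> \<bar>Re u\<bar>\<close>.
\<close>

locale sobolev_form = psd_form fscale D a
  for D :: "('a \<Rightarrow> complex) set" and a :: "'a sform" +
  fixes M :: "'a measure" and q S :: real
  assumes complete: form_complete
    and D_measurable: "\<And>u. u \<in> D \<Longrightarrow> u \<in> borel_measurable M"
    and q: "2 < q" and S: "0 < S"
    and integrable_q: "\<And>u. u \<in> D \<Longrightarrow> integrable M (\<lambda>x. cmod (u x) powr q)"
    and sobolev: "\<And>u. u \<in> D \<Longrightarrow> S * (\<integral>x. cmod (u x) powr q \<partial>M) powr (2 / q) \<le> quad u"
    and abs_Re_in: "\<And>u. u \<in> D \<Longrightarrow> (\<lambda>x. complex_of_real \<bar>Re (u x)\<bar>) \<in> D"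
    and abs_Re_le: "\<And>u. u \<in> D \<Longrightarrow> quad (\<lambda>x. complex_of_real \<bar>Re (u x)\<bar>) \<le> quad u"
begin

lemma null_AE:
  assumes u: "u \<in> D" "quad u = 0"
  shows "AE x in M. u x = 0"
proof -
  have "(\<integral>x. cmod (u x) powr q \<partial>M) powr (2 / q) \<le> 0"
    using sobolev[OF u(1)] u(2) S by (simp add: mult_le_0_iff)
  then have "(\<integral>x. cmod (u x) powr q \<partial>M) = 0"
    by (metis powr_eq_0_iff powr_ge_zero order_antisym)
  then have "AE x in M. cmod (u x) powr q = 0"
    using integral_nonneg_eq_0_iff_AE[OF integrable_q[OF u(1)]] by simp
  then show ?thesis by eventually_elim simp
qed

end

text \<open>
  In addition, a potential \<open>W \<ge> 0\<close> in the Lebesgue space with exponent \<open>p\<close> conjugate to \<open>q / 2\<close>;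
  it serves as the density of the measure \<open>MW\<close>.
\<close>

locale weighted_sobolev_form = sobolev_form D a M q S
  for D :: "('a \<Rightarrow> complex) set" and a and M :: "'a measure" and q S +
  fixes W :: "'a \<Rightarrow> real"
  assumes W_measurable [measurable]: "W \<in> borel_measurable M"
    and W_nonneg: "AE x in M. 0 \<le> W x"
    and W_integrable: "integrable M (\<lambda>x. W x powr (q / (q - 2)))"
begin

definition p :: real where "p = q / (q - 2)"

definition I :: real where "I = (\<integral>x. W x powr p \<partial>M)"

abbreviation MW :: "'a measure" where "MW \<equiv> density M (\<lambda>x. ennreal (W x))"

abbreviation wquad :: "('a \<Rightarrow> complex) \<Rightarrow> real" where "wquad u \<equiv> Re (L2_inner MW u u)"

sublocale HW: psd_form fscale "L2 MW" "L2_inner MW"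
  by (rule psd_form_L2)

lemma p_gt_1: "1 < p"
  using q by (simp add: p_def field_simps)

lemma inverse_p: "1 / p = 1 - 2 / q"
  using q by (simp add: p_def field_simps)

lemma I_nonneg: "0 \<le> I"
  by (simp add: I_def)

lemmas L2_MW_iff = L2_density_iff[OF W_measurable W_nonneg]
  and wquad_eq = quad_L2_density[OF W_measurable W_nonneg]

lemma AE_MW: "AE x in M. P x \<Longrightarrow> AE x in MW. P x"
  by (subst AE_density) (auto elim: AE_mp)

text \<open>Hoelder's inequality and the Sobolev inequality bound the weighted norm by the form.\<close>

lemma D_embeds:
  assumes u: "u \<in> D"
  shows "u \<in> L2 MW" and "wquad u \<le> I powr (1 / p) / S * quad u"
proof -
  note [measurable] = D_measurable[OF u]
  have exps: "0 < 1 / p" "1 / p < 1" using p_gt_1 by auto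
  have exp_q: "1 - 1 / p = 2 / q" by (simp only: inverse_p)
  define F where "F x = (W x powr p) powr (1 / p) * (cmod (u x) powr q) powr (1 - 1 / p)" for x
  have [measurable]: "F \<in> borel_measurable M" unfolding F_def by measurable
  have FW: "AE x in M. F x = W x * (cmod (u x))\<^sup>2"
    using W_nonneg
  proof eventually_elim
    fix x assume "0 \<le> W x"
    then show "F x = W x * (cmod (u x))\<^sup>2"
      using p_gt_1 q by (simp add: F_def exp_q powr_powr)
  qed
  have intW: "integrable M (\<lambda>x. W x powr p)" using W_integrable by (simp add: p_def)
  have "integrable M F"
    unfolding F_def by (rule hoelder(1)[OF exps(1,2) _ _ intW integrable_q[OF u]]) auto
  then have "integrable M (\<lambda>x. W x * (cmod (u x))\<^sup>2)"
    using FW by (subst (asm) integrable_cong_AE) auto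
  then show L2: "u \<in> L2 MW" by (simp add: L2_MW_iff)
  have "wquad u = (\<integral>x. F x \<partial>M)"
    unfolding wquad_eq[OF D_measurable[OF u]]
    using FW by (intro integral_cong_AE) auto
  also have "\<dots> \<le> I powr (1 / p) * (\<integral>x. cmod (u x) powr q \<partial>M) powr (1 - 1 / p)"
    unfolding F_def I_def by (rule hoelder(2)[OF exps(1,2) _ _ intW integrable_q[OF u]]) auto
  also have "\<dots> \<le> I powr (1 / p) * (quad u / S)"
    using sobolev[OF u] S unfolding exp_q by (intro mult_left_mono) (auto simp: field_simps)
  finally show "wquad u \<le> I powr (1 / p) / S * quad u" by simp
qed

lemma D_subset: "D \<subseteq> L2 MW" using D_embeds by blast

lemma fun_subspace_D: "fun_subspace D"
  using subspace subspace_fscale by blast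

lemma hermitian_form_D: "hermitian_form fscale D (L2_inner MW)"
  by (rule hermitian_form_subset[OF HW.hermitian_form_axioms fun_subspace_D D_subset])

end

text \<open>
  Let \<open>A\<close> be the operator of \<open>a\<close> in \<open>L2 MW\<close>. The form \<open>b\<close> is that of \<open>A + lam\<close>. That \<open>u\<close>
  solves \<open>(A + lam) u = lam f\<close> is expressed by \<open>solves f u\<close>, and \<open>P f\<close> is a chosen
  solution. Solutions are unique up to null functions only, so \<open>P\<close> is linear only modulo these.
\<close>

locale weighted_resolvent = weighted_sobolev_form D a M q S W
  for D :: "('a \<Rightarrow> complex) set" and a and M :: "'a measure" and q S and W +
  fixes lam :: real
  assumes lam: "0 < lam"
begin

definition b :: "'a sform" where
  "b u v = a u v + complex_of_real lam * L2_inner MW u v"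

lemma psd_form_b: "psd_form fscale D b"
proof -
  interpret HD: hermitian_form fscale D "L2_inner MW" by (rule hermitian_form_D)
  have "hermitian_form fscale D b"
  proof (rule hermitian_formI[OF fun_subspace_D])
    fix u v assume "u \<in> D" "v \<in> D"
    then show "b v u = cnj (b u v)"
      using hermitian[of u v] HD.hermitian[of u v] by (simp add: b_def)
  qed (simp_all add: b_def add_left HD.add_left scale_left HD.scale_left algebra_simps)
  moreover have "0 \<le> Re (b u u)" if "u \<in> D" for u
    using nonneg[OF that] HW.nonneg[of u] D_embeds(1)[OF that] lam by (simp add: b_def)
  ultimately show ?thesis by (simp add: psd_form_def psd_form_axioms_def)
qed

sublocale B: psd_form fscale D b by (rule psd_form_b)

lemma b_quad: "Re (b u u) = quad u + lam * wquad u"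
  by (simp add: b_def)

lemma b_null:
  assumes "u \<in> D" "Re (b u u) \<le> 0"
  shows "wquad u = 0" and "quad u = 0"
proof -
  have "0 \<le> quad u" "0 \<le> lam * wquad u"
    using nonneg[OF assms(1)] HW.nonneg D_embeds(1)[OF assms(1)] lam by auto
  then have "quad u = 0 \<and> lam * wquad u = 0" using assms(2) unfolding b_quad by linarith
  then show "wquad u = 0" "quad u = 0" using lam by auto
qed

lemma b_complete: "B.form_complete"
  unfolding B.form_complete_def
proof (intro allI impI)
  fix U assume U: "\<forall>n::nat. U n \<in> D"
    and cau: "\<forall>\<epsilon>>0. \<exists>N. \<forall>m\<ge>N. \<forall>n\<ge>N. Re (b (U m - U n) (U m - U n)) < \<epsilon>"
  have le: "quad u \<le> Re (b u u)" if "u \<in> D" for u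
    using HW.nonneg D_embeds(1)[OF that] lam by (simp add: b_quad)
  have "\<forall>\<epsilon>>0. \<exists>N. \<forall>m\<ge>N. \<forall>n\<ge>N. quad (U m - U n) < \<epsilon>"
    using cau le D_diff U by (meson order_le_less_trans)
  then obtain u where u: "u \<in> D" and lim: "(\<lambda>n. quad (U n - u)) \<longlonglongrightarrow> 0"
    using complete U unfolding form_complete_def by blast
  define C where "C = I powr (1 / p) / S"
  have "(\<lambda>n. Re (b (U n - u) (U n - u))) \<longlonglongrightarrow> 0"
  proof (rule tendsto_sandwich[OF _ _ tendsto_const])
    show "\<forall>\<^sub>F n in sequentially. 0 \<le> Re (b (U n - u) (U n - u))"
      using U u by (intro always_eventually allI B.nonneg B.D_diff) auto
    show "\<forall>\<^sub>F n in sequentially. Re (b (U n - u) (U n - u)) \<le> (1 + lam * C) * quad (U n - u)"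
    proof (intro always_eventually allI)
      fix n
      have "lam * wquad (U n - u) \<le> lam * (C * quad (U n - u))"
        using U u lam D_embeds(2)[of "U n - u"] unfolding C_def by (intro mult_left_mono) auto
      then show "Re (b (U n - u) (U n - u)) \<le> (1 + lam * C) * quad (U n - u)"
        by (simp add: b_quad algebra_simps)
    qed
    show "(\<lambda>n. (1 + lam * C) * quad (U n - u)) \<longlonglongrightarrow> 0"
      using tendsto_mult_left[OF lim, of "1 + lam * C"] by simp
  qed
  then show "\<exists>u\<in>D. (\<lambda>n. Re (b (U n - u) (U n - u))) \<longlonglongrightarrow> 0" using u by blast
qed

definition solves :: "('a \<Rightarrow> complex) \<Rightarrow> ('a \<Rightarrow> complex) \<Rightarrow> bool" where
  "solves f u \<longleftrightarrow> u \<in> D \<and> (\<forall>v\<in>D. b u v = complex_of_real lam * L2_inner MW f v)"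

definition P :: "('a \<Rightarrow> complex) \<Rightarrow> 'a \<Rightarrow> complex" where
  "P f = (SOME u. solves f u)"

lemma solves_P:
  assumes f: "f \<in> L2 MW"
  shows "solves f (P f)"
proof -
  have "\<exists>u\<in>D. \<forall>v\<in>D. b u v = complex_of_real lam * L2_inner MW f v"
  proof (rule B.riesz[OF b_complete])
    fix u v assume "u \<in> D" "v \<in> D"
    then show "complex_of_real lam * L2_inner MW f (u + v)
        = complex_of_real lam * L2_inner MW f u + complex_of_real lam * L2_inner MW f v"
      using f D_subset by (subst HW.add_right) (auto simp: distrib_left)
  next
    fix c u assume "u \<in> D"
    then show "complex_of_real lam * L2_inner MW f (fscale c u) = cnj c * (complex_of_real lam * L2_inner MW f u)"
      using f D_subset by (subst HW.scale_right) (auto simp: mult_ac)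
  next
    fix u assume u: "u \<in> D"
    have "(cmod (L2_inner MW f u))\<^sup>2 \<le> wquad f * wquad u"
      by (rule HW.cauchy_schwarz[OF f D_embeds(1)[OF u]])
    then have "lam\<^sup>2 * (cmod (L2_inner MW f u))\<^sup>2 \<le> lam\<^sup>2 * (wquad f * wquad u)"
      by (rule mult_left_mono) simp
    also have "\<dots> = lam * wquad f * (lam * wquad u)" by (simp add: power2_eq_square)
    also have "\<dots> \<le> lam * wquad f * Re (b u u)"
      using nonneg[OF u] HW.nonneg[OF f] lam by (intro mult_left_mono) (auto simp: b_quad)
    finally show "(cmod (complex_of_real lam * L2_inner MW f u))\<^sup>2 \<le> lam * wquad f * Re (b u u)"
      by (simp add: norm_mult power_mult_distrib)
  qed
  then have "\<exists>u. solves f u" by (auto simp: solves_def)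
  then show ?thesis unfolding P_def by (rule someI_ex)
qed

lemma P_in: "f \<in> L2 MW \<Longrightarrow> P f \<in> D"
  using solves_P by (simp add: solves_def)

lemma P_pairing: "f \<in> L2 MW \<Longrightarrow> v \<in> D \<Longrightarrow> b (P f) v = complex_of_real lam * L2_inner MW f v"
  using solves_P by (simp add: solves_def)

lemma solves_unique:
  assumes "solves f u" "solves f v"
  shows "wquad (u - v) = 0"
proof (rule b_null(1))
  show "u - v \<in> D" using assms by (simp add: solves_def)
  then have "b (u - v) (u - v) = 0" using assms by (simp add: solves_def B.diff_left)
  then show "Re (b (u - v) (u - v)) \<le> 0" by simp
qed

lemma solves_energy:
  assumes f: "f \<in> L2 MW" and u: "solves f u"
  shows "quad u \<le> lam / 2 * (wquad f - wquad u)" and "wquad u \<le> wquad f"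
proof -
  have uD: "u \<in> D" using u by (simp add: solves_def)
  have uW: "u \<in> L2 MW" by (rule D_embeds(1)[OF uD])
  have "0 \<le> wquad (f - u)" using f uW by (intro HW.nonneg HW.D_diff)
  then have "2 * Re (L2_inner MW f u) \<le> wquad f + wquad u"
    unfolding HW.quad_diff[OF f uW] by linarith
  then have "lam * (2 * Re (L2_inner MW f u)) \<le> lam * (wquad f + wquad u)"
    using lam by (intro mult_left_mono) auto
  moreover have "quad u + lam * wquad u = lam * Re (L2_inner MW f u)"
    using u uD unfolding b_quad[symmetric] by (simp add: solves_def)
  ultimately show en: "quad u \<le> lam / 2 * (wquad f - wquad u)"
    by (simp add: algebra_simps)
  then have "0 \<le> lam / 2 * (wquad f - wquad u)" using nonneg[OF uD] by linarith
  then show "wquad u \<le> wquad f" using lam by (simp add: zero_le_mult_iff)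
qed

lemma solves_lincomb:
  assumes f: "\<And>i. i < n \<Longrightarrow> f i \<in> L2 MW" and u: "\<And>i. i < n \<Longrightarrow> solves (f i) (u i)"
  shows "solves (HW.lincomb n f c) (HW.lincomb n u c)"
  unfolding solves_def
proof (intro conjI ballI)
  have uD: "u i \<in> D" if "i < n" for i using u[OF that] by (simp add: solves_def)
  then show "HW.lincomb n u c \<in> D" by (rule lincomb_in)
  fix v assume v: "v \<in> D"
  have "b (HW.lincomb n u c) v = (\<Sum>i<n. c i * b (u i) v)"
    unfolding lincomb_def using uD v by (subst B.sum_left) (auto simp: B.scale_left)
  also have "\<dots> = (\<Sum>i<n. complex_of_real lam * (c i * L2_inner MW (f i) v))"
    using u v by (intro sum.cong) (auto simp: solves_def)
  also have "\<dots> = complex_of_real lam * L2_inner MW (HW.lincomb n f c) v"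
    unfolding lincomb_def using f D_embeds(1)[OF v]
    by (subst HW.sum_left) (auto simp: HW.scale_left sum_distrib_left)
  finally show "b (HW.lincomb n u c) v = complex_of_real lam * L2_inner MW (HW.lincomb n f c) v" .
qed

lemma solves_diff:
  assumes "f \<in> L2 MW" "g \<in> L2 MW" "solves f u" "solves g v"
  shows "solves (f - g) (u - v)"
  using assms D_embeds(1) unfolding solves_def by (simp add: B.diff_left HW.diff_left algebra_simps)

lemma solves_cong:
  assumes "f \<in> L2 MW" "g \<in> L2 MW" "wquad (f - g) = 0" "solves f u"
  shows "solves g u"
proof -
  have "L2_inner MW f v = L2_inner MW g v" if "v \<in> D" for v
    using HW.null_pairing[OF HW.D_diff[OF assms(1,2)] D_embeds(1)[OF that] assms(3)]
      HW.diff_left[OF assms(1,2) D_embeds(1)[OF that]] by simp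
  then show ?thesis using assms(4) by (simp add: solves_def)
qed

lemma P_L2: "f \<in> L2 MW \<Longrightarrow> P f \<in> L2 MW"
  using P_in D_subset by blast

lemma Pk_L2: "f \<in> L2 MW \<Longrightarrow> (P ^^ k) f \<in> L2 MW"
  by (induction k) (auto simp: P_L2)

lemma Pk_in: "f \<in> L2 MW \<Longrightarrow> (P ^^ Suc k) f \<in> D"
  by (simp add: Pk_L2 P_in)

lemma P_selfadjoint:
  assumes "f \<in> L2 MW" "g \<in> L2 MW"
  shows "L2_inner MW (P f) g = L2_inner MW f (P g)"
proof -
  have "complex_of_real lam * L2_inner MW f (P g) = b (P f) (P g)"
    using P_pairing[OF assms(1) P_in[OF assms(2)]] by simp
  also have "\<dots> = cnj (b (P g) (P f))" using assms by (intro B.hermitian P_in)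
  also have "\<dots> = complex_of_real lam * cnj (L2_inner MW g (P f))"
    using P_pairing[OF assms(2) P_in[OF assms(1)]] by simp
  also have "cnj (L2_inner MW g (P f)) = L2_inner MW (P f) g"
    using assms by (intro HW.hermitian[symmetric] P_L2)
  finally show ?thesis using lam by simp
qed

lemma Pk_selfadjoint:
  assumes "f \<in> L2 MW" "g \<in> L2 MW"
  shows "L2_inner MW ((P ^^ k) f) g = L2_inner MW f ((P ^^ k) g)"
  using assms(2)
proof (induction k arbitrary: g)
  case (Suc k)
  have "L2_inner MW ((P ^^ Suc k) f) g = L2_inner MW ((P ^^ k) f) (P g)"
    using P_selfadjoint[OF Pk_L2[OF assms(1)] Suc.prems] by simp
  also have "\<dots> = L2_inner MW f ((P ^^ k) (P g))" by (rule Suc.IH[OF P_L2[OF Suc.prems]])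
  finally show ?case by (simp add: funpow_swap1)
qed simp

lemma Pk_contraction: "f \<in> L2 MW \<Longrightarrow> wquad ((P ^^ k) f) \<le> wquad f"
proof (induction k)
  case (Suc k)
  then have "wquad (P ((P ^^ k) f)) \<le> wquad ((P ^^ k) f)"
    by (intro solves_energy(2) solves_P Pk_L2)
  also have "\<dots> \<le> wquad f" using Suc by blast
  finally show ?case by (simp only: funpow.simps comp_apply)
qed simp

lemma Pk_diff:
  assumes "f \<in> L2 MW" "g \<in> L2 MW"
  shows "wquad ((P ^^ k) f - (P ^^ k) g) \<le> wquad (f - g)"
proof (induction k)
  case (Suc k)
  note L = Pk_L2[OF assms(1), of k] Pk_L2[OF assms(2), of k]
  have "wquad (P ((P ^^ k) f) - P ((P ^^ k) g)) \<le> wquad ((P ^^ k) f - (P ^^ k) g)"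
    using L by (intro solves_energy(2) solves_diff solves_P HW.D_diff)
  also have "\<dots> \<le> wquad (f - g)" by (rule Suc)
  finally show ?case by (simp only: funpow.simps comp_apply)
qed simp

lemma Pk_lincomb:
  assumes e: "\<And>i. i < n \<Longrightarrow> e i \<in> L2 MW"
  shows "wquad ((P ^^ k) (HW.lincomb n e c) - HW.lincomb n (\<lambda>i. (P ^^ k) (e i)) c) = 0"
proof (induction k)
  case (Suc k)
  define f where "f = (P ^^ k) (HW.lincomb n e c)"
  define g where "g = HW.lincomb n (\<lambda>i. (P ^^ k) (e i)) c"
  have f: "f \<in> L2 MW" unfolding f_def using e by (intro Pk_L2 HW.lincomb_in)
  have g: "g \<in> L2 MW" unfolding g_def using e by (intro Pk_L2 HW.lincomb_in)
  have "wquad (g - f) = wquad (f - g)" by (rule HW.quad_commute[OF g f])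
  also have "\<dots> = 0" unfolding f_def g_def by (rule Suc)
  finally have "wquad (g - f) = 0" .
  moreover have "solves g (HW.lincomb n (\<lambda>i. P ((P ^^ k) (e i))) c)"
    unfolding g_def using e by (intro solves_lincomb solves_P Pk_L2)
  ultimately have "solves f (HW.lincomb n (\<lambda>i. P ((P ^^ k) (e i))) c)"
    by (rule solves_cong[OF g f])
  from solves_unique[OF solves_P[OF f] this] show ?case by (simp only: f_def funpow.simps comp_apply)
next
  case 0
  show ?case by (simp add: L2_inner_def)
qed

text \<open>
  Non-negativity of a function is expressed by \<open>f x = \<bar>Re (f x)\<bar>\<close>. The solution
  \<open>u\<close> of the resolvent equation minimises a functional that does not increase when \<open>u\<close> is
  replaced by \<open>\<bar>Re u\<bar>\<close>.
\<close>

lemma P_nonneg: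
  assumes f: "f \<in> L2 MW" and nn: "AE x in M. f x = complex_of_real \<bar>Re (f x)\<bar>"
  shows "AE x in M. P f x = complex_of_real \<bar>Re (P f x)\<bar>"
proof -
  define u where "u = P f"
  define w where "w = (\<lambda>x. complex_of_real \<bar>Re (u x)\<bar>)"
  have u: "u \<in> D" unfolding u_def by (rule P_in[OF f])
  have w: "w \<in> D" unfolding w_def by (rule abs_Re_in[OF u])
  note uW = D_embeds(1)[OF u] and wW = D_embeds(1)[OF w]
  have "wquad w \<le> wquad u"
    unfolding quad_L2_inner Re_complex_of_real
  proof (rule integral_mono)
    show "(cmod (w x))\<^sup>2 \<le> (cmod (u x))\<^sup>2" for x
      unfolding w_def using abs_Re_le_cmod[of "u x"] by (intro power_mono) auto
  qed (use uW wW in \<open>auto intro: L2_integrable\<close>)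
  moreover have "quad w \<le> quad u" unfolding w_def by (rule abs_Re_le[OF u])
  ultimately have bw: "Re (b w w) \<le> Re (b u u)"
    unfolding b_quad using lam by (intro add_mono mult_left_mono) auto
  have "Re (L2_inner MW f u) \<le> Re (L2_inner MW f w)"
  proof -
    have Re_int: "Re (L2_inner MW f v) = (\<integral>x. Re (f x * cnj (v x)) \<partial>MW)"
      "integrable MW (\<lambda>x. Re (f x * cnj (v x)))" if "v \<in> L2 MW" for v
      unfolding L2_inner_def using integrable_L2_product[OF f that]
      by (rule integral_Re[symmetric], rule integrable_Re)
    have "(\<integral>x. Re (f x * cnj (u x)) \<partial>MW) \<le> (\<integral>x. Re (f x * cnj (w x)) \<partial>MW)"
    proof (rule integral_mono_AE[OF Re_int(2)[OF uW] Re_int(2)[OF wW]])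
      show "AE x in MW. Re (f x * cnj (u x)) \<le> Re (f x * cnj (w x))"
        using AE_MW[OF nn]
      proof eventually_elim
        fix x assume eq: "f x = complex_of_real \<bar>Re (f x)\<bar>"
        have "\<bar>Re (f x)\<bar> * Re (u x) \<le> \<bar>Re (f x)\<bar> * \<bar>Re (u x)\<bar>" by (intro mult_left_mono) auto
        then show "Re (f x * cnj (u x)) \<le> Re (f x * cnj (w x))"
          by (subst (1 2) eq) (simp add: w_def)
      qed
    qed
    then show ?thesis by (simp only: Re_int(1)[OF uW] Re_int(1)[OF wW])
  qed
  then have "lam * Re (L2_inner MW f u) \<le> lam * Re (L2_inner MW f w)"
    using lam by (intro mult_left_mono) auto
  moreover have "Re (b u u) = lam * Re (L2_inner MW f u)" "Re (b u w) = lam * Re (L2_inner MW f w)"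
    using P_pairing[OF f u] P_pairing[OF f w] by (simp_all add: u_def)
  ultimately have "Re (b (u - w) (u - w)) \<le> 0"
    unfolding B.quad_diff[OF u w] using bw by linarith
  then have "quad (u - w) = 0" using u w by (intro b_null(2)) auto
  then have "AE x in M. (u - w) x = 0" by (rule null_AE[OF D_diff[OF u w]])
  then show ?thesis
    by eventually_elim (simp add: u_def w_def)
qed

lemma Pk_nonneg:
  assumes "f \<in> L2 MW" "AE x in M. f x = complex_of_real \<bar>Re (f x)\<bar>"
  shows "AE x in M. (P ^^ k) f x = complex_of_real \<bar>Re ((P ^^ k) f x)\<bar>"
proof (induction k)
  case (Suc k)
  then show ?case using P_nonneg[OF Pk_L2[OF assms(1)], of k] by simp
qed (use assms in simp)

text \<open>
  On vectors with Rayleigh quotient at most one with respect to \<open>MW\<close>, powers of \<open>P\<close> decay no faster than for an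
  eigenvector with eigenvalue one; \<open>k \<mapsto> \<parallel>P^k u\<parallel>\<close> is log-convex.
\<close>

lemma Pk_lower_bound:
  assumes u: "u \<in> D" "wquad u = 1" "quad u \<le> 1"
  shows "(lam / (1 + lam)) ^ (2 * k) \<le> wquad ((P ^^ k) u)"
proof -
  have uW: "u \<in> L2 MW" by (rule D_embeds(1)[OF u(1)])
  define N where "N k = sqrt (wquad ((P ^^ k) u))" for k
  have N_nn: "0 \<le> N k" for k unfolding N_def using HW.nonneg[OF Pk_L2[OF uW]] by simp
  have N_sq: "wquad ((P ^^ k) u) = (N k)\<^sup>2" for k unfolding N_def using HW.nonneg[OF Pk_L2[OF uW]] by simp
  define r where "r = lam / (1 + lam)"
  have r: "0 < r" using lam by (simp add: r_def)
  have N0: "N 0 = 1" by (simp add: N_def u(2))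
  have r1: "r \<le> N 1"
  proof -
    have "(cmod (b (P u) u))\<^sup>2 \<le> Re (b (P u) (P u)) * Re (b u u)"
      by (rule B.cauchy_schwarz[OF P_in[OF uW] u(1)])
    moreover have "(cmod (b (P u) u))\<^sup>2 = lam\<^sup>2"
    proof -
      have "L2_inner MW u u = 1" using u(2) HW.Im_diag[OF uW] by (simp add: complex_eq_iff)
      then show ?thesis using P_pairing[OF uW u(1)] by simp
    qed
    moreover have "Re (b (P u) (P u)) \<le> lam * N 1"
    proof -
      have "Re (L2_inner MW u (P u)) \<le> cmod (L2_inner MW u (P u))" by (rule complex_Re_le_cmod)
      also have "\<dots> \<le> sqrt (wquad u) * sqrt (wquad (P u))"
        by (rule HW.cauchy_schwarz_sqrt[OF uW P_L2[OF uW]])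
      finally have "lam * Re (L2_inner MW u (P u)) \<le> lam * N 1"
        using lam u(2) by (intro mult_left_mono) (auto simp: N_def)
      then show ?thesis using P_pairing[OF uW P_in[OF uW]] by simp
    qed
    moreover have "Re (b u u) \<le> 1 + lam" using u(2,3) by (simp add: b_quad)
    moreover have "0 \<le> Re (b u u)" by (rule B.nonneg[OF u(1)])
    ultimately have "lam\<^sup>2 \<le> lam * N 1 * (1 + lam)"
      using mult_mono[of "Re (b (P u) (P u))" "lam * N 1" "Re (b u u)" "1 + lam"] lam N_nn by auto
    then have "lam * lam \<le> lam * (N 1 * (1 + lam))" by (simp add: power2_eq_square mult.assoc)
    then have "lam \<le> N 1 * (1 + lam)" using lam by (simp only: mult_le_cancel_left_pos)
    then show ?thesis unfolding r_def using lam by (subst pos_divide_le_eq) auto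
  qed
  have convex: "(N (Suc k))\<^sup>2 \<le> N k * N (Suc (Suc k))" for k
  proof -
    have "L2_inner MW ((P ^^ Suc k) u) ((P ^^ Suc k) u) = L2_inner MW ((P ^^ k) u) ((P ^^ Suc (Suc k)) u)"
      using P_selfadjoint[OF Pk_L2[OF uW] Pk_L2[OF uW], of k "Suc k"] by simp
    then have "(N (Suc k))\<^sup>2 = Re (L2_inner MW ((P ^^ k) u) ((P ^^ Suc (Suc k)) u))"
      unfolding N_sq[symmetric] by simp
    also have "\<dots> \<le> cmod (L2_inner MW ((P ^^ k) u) ((P ^^ Suc (Suc k)) u))" by (rule complex_Re_le_cmod)
    also have "\<dots> \<le> N k * N (Suc (Suc k))"
      unfolding N_def by (rule HW.cauchy_schwarz_sqrt[OF Pk_L2[OF uW] Pk_L2[OF uW]])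
    finally show ?thesis .
  qed
  have step: "0 < N k \<and> r * N k \<le> N (Suc k)" for k
  proof (induction k)
    case 0
    then show ?case using N0 r1 by simp
  next
    case (Suc k)
    have "0 < r * N k" using Suc r by simp
    then have pos: "0 < N (Suc k)" using Suc by linarith
    have "N k * (r * N (Suc k)) = (r * N k) * N (Suc k)" by simp
    also have "\<dots> \<le> N (Suc k) * N (Suc k)" using Suc pos by (intro mult_right_mono) auto
    also have "\<dots> \<le> N k * N (Suc (Suc k))" using convex[of k] by (simp add: power2_eq_square)
    finally show ?case using Suc pos by simp
  qed
  have "r ^ k \<le> N k"
  proof (induction k)
    case (Suc k)
    have "r * r ^ k \<le> r * N k" using Suc r by (intro mult_left_mono) auto
    then show ?case using step[of k] by simp
  qed (simp add: N0)
  then have "(r ^ k)\<^sup>2 \<le> (N k)\<^sup>2" using r by (intro power_mono) auto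
  then show ?thesis by (simp add: N_sq r_def power_mult[symmetric] mult.commute flip: power_mult)
qed

text \<open>
  The function \<open>W powr (1 / (q - 2))\<close> has squared norm \<open>I\<close> in \<open>L2 MW\<close>; \<open>interpolation\<close> bounds the
  weighted norm of a non-negative \<open>K\<close> by its norm with exponent \<open>q\<close> and its pairing with that
  function.
\<close>

lemma weight_power_L2:
  defines "g \<equiv> \<lambda>x. complex_of_real (W x powr (1 / (q - 2)))"
  shows "g \<in> L2 MW" and "wquad g = I"
proof -
  have eq: "AE x in M. W x * (cmod (g x))\<^sup>2 = W x powr p"
    using W_nonneg
  proof eventually_elim
    fix x assume "0 \<le> W x"
    have exps: "p = 1 + (1 / (q - 2) + 1 / (q - 2))" using q by (simp add: p_def field_simps)
    have "W x * (cmod (g x))\<^sup>2 = W x powr 1 * (W x powr (1 / (q - 2)) * W x powr (1 / (q - 2)))"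
      using \<open>0 \<le> W x\<close> unfolding g_def by (simp add: power2_eq_square)
    also have "\<dots> = W x powr p" unfolding exps by (simp only: powr_add)
    finally show "W x * (cmod (g x))\<^sup>2 = W x powr p" .
  qed
  have [measurable]: "g \<in> borel_measurable M" unfolding g_def by measurable
  have int: "integrable M (\<lambda>x. W x powr p)" using W_integrable by (simp add: p_def)
  then have "integrable M (\<lambda>x. W x * (cmod (g x))\<^sup>2)"
    using eq by (subst integrable_cong_AE) auto
  then show "g \<in> L2 MW" by (simp add: L2_MW_iff)
  show "wquad g = I"
    unfolding I_def using eq by (subst wquad_eq) (auto intro!: integral_cong_AE)
qed

lemma interpolation:
  assumes K: "K \<in> D" and nn: "AE x in M. K x = complex_of_real \<bar>Re (K x)\<bar>"
  defines "g \<equiv> \<lambda>x. complex_of_real (W x powr (1 / (q - 2)))"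
  shows "wquad K \<le> (\<integral>x. cmod (K x) powr q \<partial>M) powr (1 / (q - 1))
           * cmod (L2_inner MW K g) powr (1 - 1 / (q - 1))"
proof -
  note [measurable] = D_measurable[OF K]
  have KW: "K \<in> L2 MW" by (rule D_embeds(1)[OF K])
  have gW: "g \<in> L2 MW" unfolding g_def by (rule weight_power_L2)
  have [measurable]: "g \<in> borel_measurable M" unfolding g_def by measurable
  define G where "G x = cmod (K x) * W x powr ((q - 1) / (q - 2))" for x
  have exps: "0 < 1 / (q - 1)" "1 / (q - 1) < 1" "(q - 1) / (q - 2) = 1 + 1 / (q - 2)"
    using q by (auto simp: field_simps)
  have prod: "AE x in M. W x *\<^sub>R (K x * cnj (g x)) = complex_of_real (G x)"
    using nn W_nonneg
  proof eventually_elim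
    fix x assume eq: "K x = complex_of_real \<bar>Re (K x)\<bar>" and W: "0 \<le> W x"
    have "cmod (K x) = \<bar>Re (K x)\<bar>" by (subst eq) simp
    then have "K x = complex_of_real (cmod (K x))" using eq by simp
    then have "W x *\<^sub>R (K x * cnj (g x)) = complex_of_real (W x * (cmod (K x) * W x powr (1 / (q - 2))))"
      unfolding g_def by (metis complex_cnj_complex_of_real of_real_mult scaleR_conv_of_real)
    also have "W x * (cmod (K x) * W x powr (1 / (q - 2))) = G x"
      using W unfolding G_def exps by (cases "W x = 0") (simp_all add: powr_add)
    finally show "W x *\<^sub>R (K x * cnj (g x)) = complex_of_real (G x)" .
  qed
  have "integrable M (\<lambda>x. W x *\<^sub>R (K x * cnj (g x)))"
    using integrable_L2_product[OF KW gW] W_nonneg by (subst (asm) integrable_density) auto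
  then have "integrable M (\<lambda>x. complex_of_real (G x))"
    using prod by (subst (asm) integrable_cong_AE) (auto simp: G_def)
  then have intG: "integrable M G" by (simp add: complex_of_real_integrable_eq)
  have "L2_inner MW K g = (\<integral>x. W x *\<^sub>R (K x * cnj (g x)) \<partial>M)"
    unfolding L2_inner_def using W_nonneg by (intro integral_density) auto
  also have "\<dots> = (\<integral>x. complex_of_real (G x) \<partial>M)"
    using prod by (intro integral_cong_AE) (auto simp: G_def)
  also have "\<dots> = complex_of_real (\<integral>x. G x \<partial>M)" by simp
  finally have inner: "cmod (L2_inner MW K g) = (\<integral>x. G x \<partial>M)"
    by (simp add: G_def)
  have "wquad K = (\<integral>x. (cmod (K x) powr q) powr (1 / (q - 1)) * G x powr (1 - 1 / (q - 1)) \<partial>M)"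
    unfolding wquad_eq[OF D_measurable[OF K]]
  proof (rule integral_cong_AE)
    show "AE x in M. W x * (cmod (K x))\<^sup>2 = (cmod (K x) powr q) powr (1 / (q - 1)) * G x powr (1 - 1 / (q - 1))"
      using W_nonneg
    proof eventually_elim
      fix x assume W: "0 \<le> W x"
      have e1: "q / (q - 1) + (1 - 1 / (q - 1)) = 2" "(q - 1) / (q - 2) * (1 - 1 / (q - 1)) = 1"
      proof -
        have "q / (q - 1) = 1 + 1 / (q - 1)" "1 - 1 / (q - 1) = (q - 2) / (q - 1)"
          using q by (auto simp: field_simps)
        then show "q / (q - 1) + (1 - 1 / (q - 1)) = 2" "(q - 1) / (q - 2) * (1 - 1 / (q - 1)) = 1"
          using q by simp_all
      qed
      show "W x * (cmod (K x))\<^sup>2 = (cmod (K x) powr q) powr (1 / (q - 1)) * G x powr (1 - 1 / (q - 1))"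
      proof (cases "K x = 0")
        case False
        have "(cmod (K x) powr q) powr (1 / (q - 1)) * G x powr (1 - 1 / (q - 1))
            = cmod (K x) powr (q / (q - 1) + (1 - 1 / (q - 1))) * W x powr ((q - 1) / (q - 2) * (1 - 1 / (q - 1)))"
          unfolding G_def using W by (simp only: powr_mult powr_powr powr_add) simp
        also have "\<dots> = W x * (cmod (K x))\<^sup>2"
          unfolding e1 using W False by (simp add: powr_numeral)
        finally show ?thesis by simp
      qed (simp add: G_def)
    qed
  qed (auto simp: G_def)
  also have "\<dots> \<le> (\<integral>x. cmod (K x) powr q \<partial>M) powr (1 / (q - 1)) * (\<integral>x. G x \<partial>M) powr (1 - 1 / (q - 1))"
    by (rule hoelder(2)[OF exps(1,2) _ _ integrable_q[OF K] intG]) (auto simp: G_def)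
  finally show ?thesis unfolding inner .
qed

text \<open>
  A discrete-time version of the differential inequality of Li and Yau for the trace of the heat
  semigroup, tested only on a finite non-negative orthonormal family. Non-negativity is what allows
  the pairings of \<open>P^k (e i)\<close> with \<open>g = W powr (1 / (q - 2))\<close> to enter; their squares are summed by
  self-adjointness of \<open>P\<close> and Bessel's inequality for \<open>P^k g\<close>.
\<close>

lemma trace_decay:
  assumes e: "HW.orthonormal N e"
    and nn: "\<And>i. i < N \<Longrightarrow> AE x in M. e i x = complex_of_real \<bar>Re (e i x)\<bar>"
    and I_pos: "0 < I"
  defines "z \<equiv> \<lambda>k. \<Sum>i<N. wquad ((P ^^ k) (e i))"
  shows "z (Suc k) + 2 * S / I powr (1 / p) / lam * z (Suc k) powr (1 + 1 / p) \<le> z k"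
proof -
  define g where "g = (\<lambda>x. complex_of_real (W x powr (1 / (q - 2))))"
  have g: "g \<in> L2 MW" "wquad g = I" unfolding g_def by (rule weight_power_L2)+
  define K where "K i = (P ^^ Suc k) (e i)" for i
  have eL: "e i \<in> L2 MW" if "i < N" for i using HW.orthonormal_in[OF e that] .
  have KD: "K i \<in> D" if "i < N" for i unfolding K_def by (rule Pk_in[OF eL[OF that]])
  define \<alpha> where "\<alpha> = q / (2 * (q - 1))"
  have \<alpha>: "0 < \<alpha>" "\<alpha> < 1" "2 / q * \<alpha> = 1 / (q - 1)" "2 * (1 - \<alpha>) = 1 - 1 / (q - 1)"
    "1 / \<alpha> = 1 + 1 / p" "(1 - \<alpha>) / \<alpha> = 1 / p"
    using q by (auto simp: \<alpha>_def p_def field_simps)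
  define X where "X i = (\<integral>x. cmod (K i x) powr q \<partial>M) powr (2 / q)" for i
  define Y where "Y i = (cmod (L2_inner MW (K i) g))\<^sup>2" for i
  define \<delta> where "\<delta> = z k - z (Suc k)"
  have "z (Suc k) \<le> (\<Sum>i<N. X i powr \<alpha> * Y i powr (1 - \<alpha>))"
    unfolding z_def
  proof (rule sum_mono)
    fix i assume "i \<in> {..<N}"
    then have i: "i < N" by simp
    have "AE x in M. K i x = complex_of_real \<bar>Re (K i x)\<bar>"
      unfolding K_def by (rule Pk_nonneg[OF eL[OF i] nn[OF i]])
    from interpolation[OF KD[OF i] this]
    have "wquad (K i) \<le> (\<integral>x. cmod (K i x) powr q \<partial>M) powr (1 / (q - 1)) * cmod (L2_inner MW (K i) g) powr (1 - 1 / (q - 1))"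
      by (simp add: g_def)
    also have "\<dots> = X i powr \<alpha> * Y i powr (1 - \<alpha>)"
    proof -
      have "X i powr \<alpha> = (\<integral>x. cmod (K i x) powr q \<partial>M) powr (1 / (q - 1))"
        unfolding X_def powr_powr \<alpha>(3) ..
      moreover have "Y i = cmod (L2_inner MW (K i) g) powr 2" by (simp add: Y_def powr_numeral)
      then have "Y i powr (1 - \<alpha>) = cmod (L2_inner MW (K i) g) powr (1 - 1 / (q - 1))"
        unfolding \<alpha>(4)[symmetric] by (simp only: powr_powr)
      ultimately show ?thesis by simp
    qed
    finally show "wquad ((P ^^ Suc k) (e i)) \<le> X i powr \<alpha> * Y i powr (1 - \<alpha>)" by (simp only: K_def)
  qed
  also have "\<dots> \<le> (\<Sum>i<N. X i) powr \<alpha> * (\<Sum>i<N. Y i) powr (1 - \<alpha>)"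
    by (rule hoelder_sum[OF \<alpha>(1,2)]) (auto simp: X_def Y_def)
  also have "\<dots> \<le> (lam / (2 * S) * \<delta>) powr \<alpha> * I powr (1 - \<alpha>)"
  proof (rule mult_mono)
    have "(\<Sum>i<N. X i) \<le> (\<Sum>i<N. lam / (2 * S) * (wquad ((P ^^ k) (e i)) - wquad ((P ^^ Suc k) (e i))))"
    proof (rule sum_mono)
      fix i assume "i \<in> {..<N}"
      then have i: "i < N" by simp
      have "S * X i \<le> quad (K i)" unfolding X_def by (rule sobolev[OF KD[OF i]])
      also have "\<dots> \<le> lam / 2 * (wquad ((P ^^ k) (e i)) - wquad (K i))"
        unfolding K_def funpow.simps comp_apply using eL[OF i] by (intro solves_energy(1) solves_P Pk_L2)
      finally show "X i \<le> lam / (2 * S) * (wquad ((P ^^ k) (e i)) - wquad ((P ^^ Suc k) (e i)))"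
        using S unfolding K_def by (simp add: field_simps)
    qed
    also have "\<dots> = lam / (2 * S) * \<delta>"
      by (simp only: \<delta>_def z_def right_diff_distrib sum_subtractf sum_distrib_left)
    finally show "(\<Sum>i<N. X i) powr \<alpha> \<le> (lam / (2 * S) * \<delta>) powr \<alpha>"
      using \<alpha> by (intro powr_mono2) (auto simp: X_def sum_nonneg)
    have "(\<Sum>i<N. Y i) = (\<Sum>i<N. (cmod (L2_inner MW ((P ^^ Suc k) g) (e i)))\<^sup>2)"
    proof (rule sum.cong)
      fix i assume "i \<in> {..<N}"
      then have i: "i < N" by simp
      have "L2_inner MW (K i) g = L2_inner MW (e i) ((P ^^ Suc k) g)"
        unfolding K_def by (rule Pk_selfadjoint[OF eL[OF i] g(1)])
      also have "\<dots> = cnj (L2_inner MW ((P ^^ Suc k) g) (e i))"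
        by (rule HW.hermitian[OF Pk_L2[OF g(1)] eL[OF i]])
      finally show "Y i = (cmod (L2_inner MW ((P ^^ Suc k) g) (e i)))\<^sup>2" by (simp add: Y_def)
    qed simp
    also have "\<dots> \<le> wquad ((P ^^ Suc k) g)" by (rule HW.bessel[OF e Pk_L2[OF g(1)]])
    also have "\<dots> \<le> I" using Pk_contraction[OF g(1), of "Suc k"] g(2) by simp
    finally show "(\<Sum>i<N. Y i) powr (1 - \<alpha>) \<le> I powr (1 - \<alpha>)"
      using \<alpha> by (intro powr_mono2) (auto simp: Y_def sum_nonneg)
  qed auto
  finally have main: "z (Suc k) \<le> (lam / (2 * S) * \<delta>) powr \<alpha> * I powr (1 - \<alpha>)" .
  have zn: "0 \<le> z k" for k unfolding z_def using eL by (intro sum_nonneg HW.nonneg Pk_L2) auto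
  have \<delta>: "0 \<le> \<delta>"
    unfolding \<delta>_def z_def sum_subtractf[symmetric]
  proof (rule sum_nonneg)
    fix i assume "i \<in> {..<N}"
    then have "wquad (P ((P ^^ k) (e i))) \<le> wquad ((P ^^ k) (e i))"
      using eL by (intro solves_energy(2) solves_P Pk_L2) auto
    then show "0 \<le> wquad ((P ^^ k) (e i)) - wquad ((P ^^ Suc k) (e i))"
      unfolding funpow.simps comp_apply by linarith
  qed
  have "z (Suc k) powr (1 / \<alpha>) \<le> ((lam / (2 * S) * \<delta>) powr \<alpha> * I powr (1 - \<alpha>)) powr (1 / \<alpha>)"
    using \<alpha>(1) by (intro powr_mono2 main zn) simp
  also have "\<dots> = lam / (2 * S) * \<delta> * I powr (1 / p)"
    using \<alpha>(1) \<alpha>(6) \<delta> lam S by (simp add: powr_mult powr_powr)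
  finally have "z (Suc k) powr (1 + 1 / p) \<le> lam / (2 * S) * \<delta> * I powr (1 / p)" by (simp only: \<alpha>(5))
  then have "2 * S / I powr (1 / p) / lam * z (Suc k) powr (1 + 1 / p) \<le> \<delta>"
    using lam S I_pos by (simp add: field_simps)
  then show ?thesis by (simp add: \<delta>_def)
qed

end

context weighted_sobolev_form
begin

text \<open>
  The trace of \<open>P^k\<close> against the non-negative family \<open>e\<close> dominates its trace against the
  projections of an orthonormal family \<open>u\<close>: pointwise, by Bessel's inequality.
\<close>

lemma trace_projected:
  assumes e: "HW.orthonormal N e" and u: "HW.orthonormal n u"
    and G: "\<And>i. i < N \<Longrightarrow> G i \<in> L2 MW"
  shows "(\<Sum>j<n. wquad (HW.lincomb N G (\<lambda>i. L2_inner MW (u j) (e i)))) \<le> (\<Sum>i<N. wquad (G i))"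
proof -
  define L where "L j = HW.lincomb N G (\<lambda>i. L2_inner MW (u j) (e i))" for j
  have L: "L j \<in> L2 MW" for j unfolding L_def using G by (intro HW.lincomb_in)
  have pointwise: "(\<Sum>j<n. (cmod (L j x))\<^sup>2) \<le> (\<Sum>i<N. (cmod (G i x))\<^sup>2)" for x
  proof -
    define h where "h = HW.lincomb N e (\<lambda>i. cnj (G i x))"
    have h: "h \<in> L2 MW" unfolding h_def using e by (intro HW.lincomb_in HW.orthonormal_in)
    have "cmod (L j x) = cmod (L2_inner MW h (u j))" if j: "j < n" for j
    proof -
      have "(\<Sum>i<m. fscale (c i) (G i)) x = (\<Sum>i<m. c i * G i x)" for m c
        by (induction m) auto
      then have "L j x = (\<Sum>i<N. L2_inner MW (u j) (e i) * G i x)"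
        by (simp add: L_def HW.lincomb_def)
      also have "\<dots> = L2_inner MW (u j) h"
        unfolding h_def using e u j
        by (subst HW.pairing_lincomb) (auto simp: HW.orthonormal_in mult.commute)
      also have "\<dots> = cnj (L2_inner MW h (u j))"
        by (rule HW.hermitian[OF h HW.orthonormal_in[OF u j]])
      finally show ?thesis by simp
    qed
    then have "(\<Sum>j<n. (cmod (L j x))\<^sup>2) = (\<Sum>j<n. (cmod (L2_inner MW h (u j)))\<^sup>2)"
      by (intro sum.cong) auto
    also have "\<dots> \<le> wquad h" by (rule HW.bessel[OF u h])
    also have "\<dots> = (\<Sum>i<N. (cmod (G i x))\<^sup>2)" unfolding h_def by (simp add: HW.quad_lincomb[OF e])
    finally show ?thesis .
  qed
  have "(\<Sum>j<n. wquad (L j)) = (\<integral>x. (\<Sum>j<n. (cmod (L j x))\<^sup>2) \<partial>MW)"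
    using L2_integrable[OF L] by (simp add: quad_L2_inner Bochner_Integration.integral_sum)
  also have "\<dots> \<le> (\<integral>x. (\<Sum>i<N. (cmod (G i x))\<^sup>2) \<partial>MW)"
    using L2_integrable[OF L] L2_integrable[OF G] pointwise by (intro integral_mono) auto
  also have "\<dots> = (\<Sum>i<N. wquad (G i))"
    using L2_integrable[OF G] by (simp add: quad_L2_inner Bochner_Integration.integral_sum)
  finally show ?thesis by (simp add: L_def)
qed

text \<open>A bound of Cwikel--Lieb--Rozenblum type, with no attempt at a good constant.\<close>

theorem CLR_bound:
  assumes fam: "hermitian_form.pos_family fscale D (\<lambda>u v. L2_inner MW u v - a u v) n w"
  shows "real n \<le> 4 * exp 2 * (4 * p / S) powr p * I"
proof -
  interpret HD: hermitian_form fscale D "L2_inner MW" by (rule hermitian_form_D)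
  define r where "r = (\<lambda>u v. L2_inner MW u v - a u v)"
  interpret r: hermitian_form fscale D r
  proof (rule hermitian_formI[OF fun_subspace_D])
    fix u v assume "u \<in> D" "v \<in> D"
    then show "r v u = cnj (r u v)"
      using hermitian[of u v] HD.hermitian[of u v] by (simp add: r_def)
  qed (simp_all add: r_def add_left HD.add_left scale_left HD.scale_left algebra_simps)
  have fam: "r.pos_family n w" using fam by (simp add: r_def)
  have wD: "w i \<in> D" if "i < n" for i using fam that by (simp add: r.pos_family_def)
  have less: "quad (r.lincomb n w c) < wquad (r.lincomb n w c)" if "\<exists>i<n. c i \<noteq> 0" for c
    using r.pos_familyD[OF fam that] by (simp add: r_def)
  have "HD.pos_family n w"
    unfolding HD.pos_family_def
  proof (intro conjI allI impI)
    fix c :: "nat \<Rightarrow> complex" assume "\<exists>i<n. c i \<noteq> 0"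
    from less[OF this] nonneg[OF r.lincomb_in[of n w c]] wD
    show "0 < wquad (HD.lincomb n w c)" by simp
  qed (use wD in auto)
  from HD.gram_schmidt[OF this] obtain u where u: "HD.orthonormal n u"
    and span: "\<And>i. i < n \<Longrightarrow> \<exists>d. u i = HD.lincomb n w d" by blast
  have uD: "u i \<in> D" if "i < n" for i using HD.orthonormal_in[OF u that] .
  have uW: "u i \<in> L2 MW" if "i < n" for i using D_embeds(1)[OF uD[OF that]] .
  have uH: "HW.orthonormal n u" using u uW by (simp add: HW.orthonormal_def HD.orthonormal_def)
  have u1: "wquad (u i) = 1" if "i < n" for i using u that by (simp add: HD.orthonormal_def)
  have ua: "quad (u i) \<le> 1" if i: "i < n" for i
  proof -
    obtain d where d: "u i = HD.lincomb n w d" using span[OF i] by blast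
    have "\<exists>j<n. d j \<noteq> 0"
    proof (rule ccontr)
      assume "\<not> ?thesis"
      then have "u i = 0" unfolding d HD.lincomb_def by simp
      then show False using u1[OF i] HW.zero_left[OF HW.D_zero] by simp
    qed
    from less[OF this] show ?thesis using u1[OF i] d by simp
  qed
  show ?thesis
  proof (cases "n = 0")
    case True
    then show ?thesis using I_nonneg p_gt_1 by simp
  next
    case False
    have I_pos: "0 < I"
    proof (rule ccontr)
      assume "\<not> 0 < I"
      then have "I = 0" using I_nonneg by simp
      then show False
        using D_embeds(2)[OF uD[of 0]] u1[of 0] False p_gt_1 by simp
    qed
    \<comment> \<open>Below, \<open>exp (- 2)\<close> bounds \<open>\<parallel>P^k (u j)\<parallel>\<^sup>2\<close> from below; approximating \<open>u j\<close> up to the squared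
      error \<open>\<epsilon>\<close> loses at most half of it.\<close>
    define \<epsilon> where "\<epsilon> = exp (- 2 :: real) / 4"
    have "0 < \<epsilon>" by (simp add: \<epsilon>_def)
    from nonneg_orthonormal_approx[of n u MW, OF uW this] obtain N e where e: "HW.orthonormal N e"
      and nn: "\<And>i. i < N \<Longrightarrow> \<exists>f. (\<forall>x. 0 \<le> f x) \<and> e i = (\<lambda>x. complex_of_real (f x))"
      and approx: "\<And>j. j < n \<Longrightarrow> wquad (u j - HW.proj N e (u j)) < \<epsilon>"
      by blast
    have nn': "AE x in M. e i x = complex_of_real \<bar>Re (e i x)\<bar>" if "i < N" for i
      using nn[OF that] by (auto intro!: AE_I2)
    have eL: "e i \<in> L2 MW" if "i < N" for i using HW.orthonormal_in[OF e that] .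
    define \<kappa> where "\<kappa> = 2 * S / I powr (1 / p)"
    have \<kappa>: "0 < \<kappa>" using S I_pos by (simp add: \<kappa>_def)
    obtain k where k: "1 \<le> k" and decay: "\<And>z :: nat \<Rightarrow> real. (\<forall>k. 0 \<le> z k) \<Longrightarrow> z 0 \<le> real N \<Longrightarrow>
           (\<forall>j. z (Suc j) + \<kappa> / real k * z (Suc j) powr (1 + 1 / p) \<le> z j) \<Longrightarrow>
           z k \<le> (8 / (1 / p * \<kappa>)) powr (1 / (1 / p))"
      using discrete_decay[OF \<kappa>, of "1 / p" "real N"] p_gt_1 by auto
    \<comment> \<open>The number \<open>k\<close> of steps is also the resolvent parameter: \<open>P^k = (1 + A / k)^-k\<close>.\<close>
    interpret R: weighted_resolvent D a M q S W "real k"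
      by unfold_locales (use k in simp)
    define z where "z j = (\<Sum>i<N. wquad ((R.P ^^ j) (e i)))" for j
    have "z k \<le> (8 / (1 / p * \<kappa>)) powr (1 / (1 / p))"
    proof (rule decay)
      show "\<forall>k. 0 \<le> z k" unfolding z_def using eL by (intro allI sum_nonneg HW.nonneg R.Pk_L2) auto
      show "z 0 \<le> real N" unfolding z_def using e by (simp add: HW.orthonormal_def)
      show "\<forall>j. z (Suc j) + \<kappa> / real k * z (Suc j) powr (1 + 1 / p) \<le> z j"
        using R.trace_decay[OF e nn' I_pos] unfolding z_def \<kappa>_def by blast
    qed
    also have "8 / (1 / p * \<kappa>) = 4 * p / S * I powr (1 / p)"
      using S I_pos p_gt_1 by (simp add: \<kappa>_def field_simps)
    also have "\<dots> powr (1 / (1 / p)) = (4 * p / S) powr p * I"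
      using S I_pos p_gt_1 by (subst powr_mult) (auto simp: powr_powr)
    finally have z_le: "z k \<le> (4 * p / S) powr p * I" .
    have lower: "exp (- 2) \<le> (real k / (1 + real k)) ^ (2 * k)"
    proof -
      have "(1 + 1 / real k) ^ k \<le> exp (1 / real k) ^ k"
        using exp_ge_add_one_self[of "1 / real k"] by (intro power_mono) auto
      also have "\<dots> = exp 1" using k by (simp flip: exp_of_nat_mult)
      finally have "((1 + 1 / real k) ^ k)\<^sup>2 \<le> (exp 1)\<^sup>2" by (intro power_mono) auto
      then have "(1 + 1 / real k) ^ (2 * k) \<le> exp 2"
        by (simp add: power_mult[symmetric] mult.commute flip: exp_double)
      then have "1 / exp 2 \<le> 1 / (1 + 1 / real k) ^ (2 * k)"
        by (intro divide_left_mono mult_pos_pos zero_less_power) (auto simp: add_pos_nonneg)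
      also have "\<dots> = (1 / (1 + 1 / real k)) ^ (2 * k)" by (simp add: power_one_over)
      also have "1 / (1 + 1 / real k) = real k / (1 + real k)" using k by (simp add: field_simps)
      finally show ?thesis by (simp add: exp_minus inverse_eq_divide)
    qed
    have each: "exp (- 2) \<le> 2 * wquad (HW.lincomb N (\<lambda>i. (R.P ^^ k) (e i)) (\<lambda>i. L2_inner MW (u j) (e i))) + 2 * \<epsilon>"
      if j: "j < n" for j
    proof -
      define v where "v = HW.proj N e (u j)"
      have v: "v \<in> L2 MW" unfolding v_def by (rule HW.proj_in[OF e])
      define A where "A = (R.P ^^ k) (u j)"
      define B where "B = (R.P ^^ k) v"
      define L where "L = HW.lincomb N (\<lambda>i. (R.P ^^ k) (e i)) (\<lambda>i. L2_inner MW (u j) (e i))"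
      have AB: "A \<in> L2 MW" "B \<in> L2 MW" "L \<in> L2 MW"
        unfolding A_def B_def L_def using uW[OF j] v eL by (auto intro!: R.Pk_L2 HW.lincomb_in)
      have "exp (- 2) \<le> wquad A"
        unfolding A_def using lower R.Pk_lower_bound[OF uD[OF j] u1[OF j] ua[OF j], of k] by linarith
      also have "A = B + (A - B)" by simp
      also have "wquad (B + (A - B)) \<le> 2 * wquad B + 2 * wquad (A - B)"
        using AB by (intro HW.quad_add_le HW.D_diff)
      also have "wquad (A - B) \<le> wquad (u j - v)"
        unfolding A_def B_def by (rule R.Pk_diff[OF uW[OF j] v])
      also have "wquad (u j - v) \<le> \<epsilon>" using approx[OF j] by (simp add: v_def)
      also have "wquad B = wquad L"
      proof -
        have "wquad (B - L) = 0"
          unfolding B_def L_def v_def HW.proj_def by (rule R.Pk_lincomb[OF eL])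
        from HW.null_pairing[OF _ _ this] AB
        have "Re (L2_inner MW (B - L) L) = 0" "wquad (B - L) = 0" using \<open>wquad (B - L) = 0\<close> by auto
        moreover have "B = (B - L) + L" by simp
        ultimately show ?thesis using HW.quad_add[of "B - L" L] AB by simp
      qed
      finally show ?thesis by (simp add: L_def)
    qed
    have "real n * exp (- 2) = (\<Sum>j<n. exp (- 2))" by simp
    also have "\<dots> \<le> (\<Sum>j<n. 2 * wquad (HW.lincomb N (\<lambda>i. (R.P ^^ k) (e i)) (\<lambda>i. L2_inner MW (u j) (e i))) + 2 * \<epsilon>)"
      using each by (intro sum_mono) auto
    also have "\<dots> = 2 * (\<Sum>j<n. wquad (HW.lincomb N (\<lambda>i. (R.P ^^ k) (e i)) (\<lambda>i. L2_inner MW (u j) (e i)))) + 2 * real n * \<epsilon>"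
      by (simp add: sum.distrib sum_distrib_left)
    also have "\<dots> \<le> 2 * z k + 2 * real n * \<epsilon>"
      unfolding z_def using trace_projected[OF e uH, of "\<lambda>i. (R.P ^^ k) (e i)"] R.Pk_L2[OF eL] by simp
    finally have "real n * exp (- 2) \<le> 4 * z k" by (simp add: \<epsilon>_def)
    then have "real n \<le> 4 * exp 2 * z k" by (simp add: exp_minus field_simps)
    also have "\<dots> \<le> 4 * exp 2 * ((4 * p / S) powr p * I)" using z_le by simp
    finally show ?thesis by (simp add: mult.assoc)
  qed
qed

end

section \<open>Counting eigenvalues by dimensions of subspaces\<close>

lemma lincomb_apply:
  "hermitian_form.lincomb fscale n w c x = (\<Sum>i<n. c i * w i x)"
proof -
  interpret psd_form fscale "L2 M" "L2_inner M" for M by (rule psd_form_L2)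
  have "(\<Sum>i<m. fscale (c i) (w i)) x = (\<Sum>i<m. c i * w i x)" for m
    by (induction m) auto
  then show ?thesis by (simp add: lincomb_def)
qed

lemma L2_dim_family:
  assumes "enat m \<le> L2_dim M E"
  shows "\<exists>w. (\<forall>i<m. w i \<in> E) \<and> L2_independent M m w"
proof (rule ccontr)
  assume none: "\<not> ?thesis"
  have m: "0 < m"
  proof (rule ccontr)
    assume "\<not> 0 < m"
    then have "(\<forall>i<m. w i \<in> E) \<and> L2_independent M m w" for w
      by (simp add: L2_independent_def)
    then show False using none by blast
  qed
  have less: "n < m" if n: "\<forall>i<n. w i \<in> E" "L2_independent M n w" for n w
  proof (rule ccontr)
    assume "\<not> n < m"
    then have mn: "m \<le> n" by simp
    have "L2_independent M m w"
      unfolding L2_independent_def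
    proof (intro allI impI)
      fix c i assume c: "AE x in M. (\<Sum>i<m. c i * w i x) = 0" and i: "i < m"
      have "(\<Sum>i<n. (if i < m then c i else 0) * w i x) = (\<Sum>i<m. c i * w i x)" for x
        using mn by (intro sum.mono_neutral_cong_right) auto
      then have "AE x in M. (\<Sum>i<n. (if i < m then c i else 0) * w i x) = 0" using c by simp
      then have "(if i < m then c i else 0) = 0"
        using n(2)[unfolded L2_independent_def, rule_format, of "\<lambda>i. if i < m then c i else 0" i] mn i
        by linarith
      then show "c i = 0" using i by simp
    qed
    then show False using none n(1) mn by (meson less_le_trans)
  qed
  have "L2_dim M E \<le> enat (m - 1)"
    unfolding L2_dim_def
  proof (rule Sup_least)
    fix x assume "x \<in> {enat n |n. \<exists>w. (\<forall>i<n. w i \<in> E) \<and> L2_independent M n w}"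
    then obtain n where "x = enat n" "n < m" using less by blast
    then show "x \<le> enat (m - 1)" by simp
  qed
  with assms have "enat m \<le> enat (m - 1)" by (rule order_trans)
  then show False using m by simp
qed

lemma L2_dim_geI:
  "\<forall>i<n. w i \<in> E \<Longrightarrow> L2_independent M n w \<Longrightarrow> enat n \<le> L2_dim M E"
  unfolding L2_dim_def by (rule Sup_upper) auto

text \<open>
  To bound a sum of multiplicities it suffices to bound the sums of all natural numbers below them;
  infinite multiplicities are thereby included.
\<close>

lemma sum_enat_le:
  fixes e :: "'i \<Rightarrow> enat" and B :: ennreal
  assumes F: "finite F"
    and le: "\<And>m :: 'i \<Rightarrow> nat. (\<forall>i\<in>F. enat (m i) \<le> e i) \<Longrightarrow> of_nat (\<Sum>i\<in>F. m i) \<le> B"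
  shows "(\<Sum>i\<in>F. ennreal_of_enat (e i)) \<le> B"
proof (cases "\<forall>i\<in>F. e i \<noteq> \<infinity>")
  case True
  then have fin: "enat (the_enat (e i)) = e i" if "i \<in> F" for i using that by (cases "e i") auto
  have "(\<Sum>i\<in>F. ennreal_of_enat (e i)) = (\<Sum>i\<in>F. of_nat (the_enat (e i)))"
    using fin by (intro sum.cong) (metis ennreal_of_enat_enat)+
  also have "\<dots> = of_nat (\<Sum>i\<in>F. the_enat (e i))" by simp
  also have "\<dots> \<le> B" using fin by (intro le) auto
  finally show ?thesis .
next
  case False
  then obtain j where j: "j \<in> F" "e j = \<infinity>" by blast
  have "of_nat k \<le> B" for k
  proof -
    have "(\<Sum>i\<in>F. if i = j then k else 0) = k" using F j by simp
    moreover have "of_nat (\<Sum>i\<in>F. if i = j then k else 0) \<le> B" using j by (intro le) (auto simp flip: zero_enat_def)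
    ultimately show ?thesis by simp
  qed
  then have "B = \<infinity>"
    by (metis ennreal_Ex_less_of_nat infinity_ennreal_def leD top.not_eq_extremum)
  then show ?thesis by simp
qed

text \<open>
  A closed non-negative form with an interpolated Sobolev inequality which is real and does not
  increase when a real-valued function is replaced by its absolute value.
\<close>

locale interpolated_sobolev =
  fixes M :: "'a measure" and D :: "('a \<Rightarrow> complex) set" and t :: "'a sform"
    and q \<theta> S \<gamma> \<kappa> :: real
  assumes form: "nonneg_form M D t"
    and closed: "closed_form M D t"
    and q: "2 < q" and \<theta>: "0 < \<theta>" "\<theta> < 1" and S: "0 < S"
    and interpolation: "\<And>u. u \<in> D \<Longrightarrow> integrable M (\<lambda>x. cmod (u x) powr q) \<and>
          S * (\<integral>x. cmod (u x) powr q \<partial>M) powr (2 / q)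
            \<le> qform t u powr \<theta> * L2_norm M u powr (2 * (1 - \<theta>))"
    and Re_in: "\<And>f. f \<in> D \<Longrightarrow> (\<lambda>x. complex_of_real (Re (f x))) \<in> D"
    and qform_Re_Im: "\<And>u v :: 'a \<Rightarrow> real. (\<lambda>x. complex_of_real (u x)) \<in> D \<Longrightarrow> (\<lambda>x. complex_of_real (v x)) \<in> D \<Longrightarrow>
        qform t (\<lambda>x. complex_of_real (u x) + \<i> * complex_of_real (v x)) =
          qform t (\<lambda>x. complex_of_real (u x)) + qform t (\<lambda>x. complex_of_real (v x))"
    and qform_abs: "\<And>u :: 'a \<Rightarrow> real. (\<lambda>x. complex_of_real (u x)) \<in> D \<Longrightarrow>
        (\<lambda>x. complex_of_real \<bar>u x\<bar>) \<in> D \<and>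
        qform t (\<lambda>x. complex_of_real \<bar>u x\<bar>) \<le> qform t (\<lambda>x. complex_of_real (u x))"
    and \<gamma>: "\<gamma> = q * (1 - \<theta>) / (q - 2)" and \<kappa>: "\<kappa> = q * \<theta> / (q - 2)"
begin

lemma D_L2: "u \<in> D \<Longrightarrow> u \<in> L2 M"
  and fun_subspace_D: "fun_subspace D"
  using form by (auto simp: nonneg_form_def)

lemma D_measurable: "u \<in> D \<Longrightarrow> u \<in> borel_measurable M"
  using D_L2 by (rule L2_measurable)

lemma exponent_sum: "\<gamma> + \<kappa> = q / (q - 2)"
  unfolding \<gamma> \<kappa> add_divide_distrib[symmetric] by (simp add: algebra_simps)

lemma gamma_pos: "0 < \<gamma>" and kappa_pos: "0 < \<kappa>"
  using q \<theta> by (simp_all add: \<gamma> \<kappa>)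

lemma psd_form_t: "psd_form fscale D t"
proof -
  have "hermitian_form fscale D t"
  proof (rule hermitian_formI[OF fun_subspace_D])
    show "t (u + v) w = t u w + t v w" if "u \<in> D" "v \<in> D" "w \<in> D" for u v w
      using form that unfolding nonneg_form_def plus_fun_def by metis
    show "t (fscale c u) v = c * t u v" if "u \<in> D" "v \<in> D" for c u v
      using form that unfolding nonneg_form_def fscale_def by metis
    show "t v u = cnj (t u v)" if "u \<in> D" "v \<in> D" for u v
      using form that unfolding nonneg_form_def by metis
  qed
  then show ?thesis
    using form unfolding psd_form_def psd_form_axioms_def nonneg_form_def qform_def by blast
qed

sublocale T: psd_form fscale D t by (rule psd_form_t)

sublocale H: psd_form fscale "L2 M" "L2_inner M" by (rule psd_form_L2)

lemma psd_form_N: "psd_form fscale D (L2_inner M)"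
proof -
  have "D \<subseteq> L2 M" using D_L2 by blast
  then show ?thesis
    using hermitian_form_subset[OF H.hermitian_form_axioms fun_subspace_D] H.nonneg
    unfolding psd_form_def psd_form_axioms_def by blast
qed

sublocale N: psd_form fscale D "L2_inner M" by (rule psd_form_N)

lemma closed_limit:
  assumes U: "\<And>n::nat. U n \<in> D"
    and cauN: "\<And>\<epsilon>. \<epsilon> > 0 \<Longrightarrow> \<exists>n0. \<forall>m\<ge>n0. \<forall>n\<ge>n0. N.quad (U m - U n) < \<epsilon>"
    and cauT: "\<And>\<epsilon>. \<epsilon> > 0 \<Longrightarrow> \<exists>n0. \<forall>m\<ge>n0. \<forall>n\<ge>n0. T.quad (U m - U n) < \<epsilon>"
  shows "\<exists>u\<in>D. (\<lambda>n. N.quad (U n - u)) \<longlonglongrightarrow> 0 \<and> (\<lambda>n. T.quad (U n - u)) \<longlonglongrightarrow> 0"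
proof -
  obtain u where u: "u \<in> L2 M" and lim: "(\<lambda>n. N.quad (U n - u)) \<longlonglongrightarrow> 0"
    using L2_complete[OF D_L2[OF U] cauN] by blast
  have "L2_norm M (\<lambda>x. U n x - u x) = sqrt (N.quad (U n - u))" for n
    by (simp add: L2_norm_def quad_L2_inner)
  then have "(\<lambda>n. L2_norm M (\<lambda>x. U n x - u x)) \<longlonglongrightarrow> 0"
    using tendsto_real_sqrt[OF lim] by simp
  moreover have "\<forall>\<epsilon>>0. \<exists>n0. \<forall>m\<ge>n0. \<forall>n\<ge>n0. qform t (\<lambda>x. U m x - U n x) < \<epsilon>"
    using cauT unfolding qform_def fun_diff_def by blast
  ultimately have "u \<in> D \<and> (\<lambda>n. qform t (\<lambda>x. U n x - u x)) \<longlonglongrightarrow> 0"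
    using closed U u unfolding closed_form_def by blast
  then show ?thesis using lim unfolding qform_def fun_diff_def by blast
qed

text \<open>The form \<open>t + \<tau>\<close>.\<close>

definition shifted :: "real \<Rightarrow> 'a sform" where
  "shifted \<tau> u v = t u v + complex_of_real \<tau> * L2_inner M u v"

lemma shifted_quad: "Re (shifted \<tau> u u) = T.quad u + \<tau> * N.quad u"
  by (simp add: shifted_def)

text \<open>By Young's inequality the interpolation inequality becomes a Sobolev inequality for \<open>t + \<tau>\<close>.\<close>

lemma sobolev_form_shifted:
  assumes \<tau>: "0 < \<tau>"
  shows "sobolev_form D (shifted \<tau>) M q (S * \<tau> powr (1 - \<theta>))"
proof -
  have "hermitian_form fscale D (shifted \<tau>)"
  proof (rule hermitian_formI[OF fun_subspace_D])
    fix u v assume "u \<in> D" "v \<in> D"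
    then show "shifted \<tau> v u = cnj (shifted \<tau> u v)"
      using T.hermitian[of u v] N.hermitian[of u v] by (simp add: shifted_def)
  qed (simp_all add: shifted_def T.add_left N.add_left T.scale_left N.scale_left algebra_simps)
  moreover have "0 \<le> Re (shifted \<tau> u u)" if "u \<in> D" for u
    using T.nonneg[OF that] N.nonneg[OF that] \<tau> by (simp add: shifted_quad)
  ultimately have psd: "psd_form fscale D (shifted \<tau>)"
    by (simp add: psd_form_def psd_form_axioms_def)
  interpret A: psd_form fscale D "shifted \<tau>" by (rule psd)
  have complete: "A.form_complete"
    unfolding A.form_complete_def
  proof (intro allI impI)
    fix U assume U: "\<forall>n::nat. U n \<in> D"
      and cau: "\<forall>\<epsilon>>0. \<exists>n0. \<forall>m\<ge>n0. \<forall>n\<ge>n0. A.quad (U m - U n) < \<epsilon>"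
    have T_le: "T.quad u \<le> A.quad u" if "u \<in> D" for u
      using N.nonneg[OF that] \<tau> by (simp add: shifted_quad)
    have N_le: "\<tau> * N.quad u \<le> A.quad u" if "u \<in> D" for u
      using T.nonneg[OF that] by (simp add: shifted_quad)
    have "\<exists>u\<in>D. (\<lambda>n. N.quad (U n - u)) \<longlonglongrightarrow> 0 \<and> (\<lambda>n. T.quad (U n - u)) \<longlonglongrightarrow> 0"
    proof (rule closed_limit)
      fix \<epsilon> :: real assume "\<epsilon> > 0"
      then show "\<exists>n0. \<forall>m\<ge>n0. \<forall>n\<ge>n0. T.quad (U m - U n) < \<epsilon>"
        using cau T_le[OF T.D_diff] U by (meson le_less_trans)
      have "\<tau> * \<epsilon> > 0" using \<open>\<epsilon> > 0\<close> \<tau> by simp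
      then obtain n0 where n0: "\<forall>m\<ge>n0. \<forall>n\<ge>n0. A.quad (U m - U n) < \<tau> * \<epsilon>" using cau by blast
      have "N.quad (U m - U n) < \<epsilon>" if "m \<ge> n0" "n \<ge> n0" for m n
      proof -
        have "\<tau> * N.quad (U m - U n) < \<tau> * \<epsilon>"
          using N_le[OF T.D_diff, of "U m" "U n"] U n0 that by (meson le_less_trans)
        then show ?thesis using \<tau> by simp
      qed
      then show "\<exists>n0. \<forall>m\<ge>n0. \<forall>n\<ge>n0. N.quad (U m - U n) < \<epsilon>" by blast
    qed (use U in blast)
    then obtain u where u: "u \<in> D" and lim: "(\<lambda>n. N.quad (U n - u)) \<longlonglongrightarrow> 0" "(\<lambda>n. T.quad (U n - u)) \<longlonglongrightarrow> 0"
      by blast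
    have "(\<lambda>n. A.quad (U n - u)) \<longlonglongrightarrow> 0"
      unfolding shifted_quad using tendsto_add[OF lim(2) tendsto_mult_left[OF lim(1), of \<tau>]] by simp
    then show "\<exists>u\<in>D. (\<lambda>n. A.quad (U n - u)) \<longlonglongrightarrow> 0" using u by blast
  qed
  have sobolev: "S * \<tau> powr (1 - \<theta>) * (\<integral>x. cmod (u x) powr q \<partial>M) powr (2 / q) \<le> A.quad u" if u: "u \<in> D" for u
  proof -
    have nn: "0 \<le> T.quad u" "0 \<le> N.quad u" using T.nonneg[OF u] N.nonneg[OF u] by auto
    have "L2_norm M u = N.quad u powr (1/2)"
      using nn by (simp add: L2_norm_def quad_L2_inner powr_half_sqrt)
    moreover have "1 / 2 * (2 * (1 - \<theta>)) = 1 - \<theta>" by (simp add: field_simps)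
    ultimately have "L2_norm M u powr (2 * (1 - \<theta>)) = N.quad u powr (1 - \<theta>)"
      by (simp only: powr_powr)
    then have "S * (\<integral>x. cmod (u x) powr q \<partial>M) powr (2 / q) \<le> T.quad u powr \<theta> * N.quad u powr (1 - \<theta>)"
      using interpolation[OF u] by (simp add: qform_def)
    then have "S * (\<integral>x. cmod (u x) powr q \<partial>M) powr (2 / q) * \<tau> powr (1 - \<theta>)
        \<le> T.quad u powr \<theta> * N.quad u powr (1 - \<theta>) * \<tau> powr (1 - \<theta>)"
      by (rule mult_right_mono) simp
    also have "\<dots> = T.quad u powr \<theta> * (\<tau> * N.quad u) powr (1 - \<theta>)"
      using nn \<tau> by (simp add: powr_mult)
    also have "\<dots> \<le> \<theta> * T.quad u + (1 - \<theta>) * (\<tau> * N.quad u)"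
      using nn \<tau> \<theta> by (intro weighted_young) auto
    also have "\<dots> \<le> 1 * T.quad u + 1 * (\<tau> * N.quad u)"
      using nn \<tau> \<theta> by (intro add_mono mult_right_mono) auto
    finally show ?thesis by (simp add: shifted_quad mult_ac)
  qed
  have abs_Re: "(\<lambda>x. complex_of_real \<bar>Re (u x)\<bar>) \<in> D"
    "A.quad (\<lambda>x. complex_of_real \<bar>Re (u x)\<bar>) \<le> A.quad u" if u: "u \<in> D" for u
  proof -
    have re: "(\<lambda>x. complex_of_real (Re (u x))) \<in> D" by (rule Re_in[OF u])
    have "fscale (- \<i>) u \<in> D" using u by (rule T.D_scale)
    from Re_in[OF this] have im: "(\<lambda>x. complex_of_real (Im (u x))) \<in> D" by simp
    show mem: "(\<lambda>x. complex_of_real \<bar>Re (u x)\<bar>) \<in> D" using qform_abs[OF re] by blast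
    have "T.quad (\<lambda>x. complex_of_real \<bar>Re (u x)\<bar>) \<le> T.quad (\<lambda>x. complex_of_real (Re (u x)))"
      using qform_abs[OF re] by (simp add: qform_def)
    also have "\<dots> \<le> T.quad (\<lambda>x. complex_of_real (Re (u x))) + T.quad (\<lambda>x. complex_of_real (Im (u x)))"
      using T.nonneg[OF im] by simp
    also have "\<dots> = T.quad (\<lambda>x. complex_of_real (Re (u x)) + \<i> * complex_of_real (Im (u x)))"
      using qform_Re_Im[OF re im] by (simp add: qform_def)
    also have "(\<lambda>x. complex_of_real (Re (u x)) + \<i> * complex_of_real (Im (u x))) = u"
      by (simp add: complex_eq[symmetric])
    finally have "T.quad (\<lambda>x. complex_of_real \<bar>Re (u x)\<bar>) \<le> T.quad u" .
    moreover have "N.quad (\<lambda>x. complex_of_real \<bar>Re (u x)\<bar>) \<le> N.quad u"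
      unfolding quad_L2_inner Re_complex_of_real
    proof (rule integral_mono)
      show "(cmod (complex_of_real \<bar>Re (u x)\<bar>))\<^sup>2 \<le> (cmod (u x))\<^sup>2" for x
        using abs_Re_le_cmod[of "u x"] by (intro power_mono) auto
    qed (rule L2_integrable[OF D_L2[OF mem]], rule L2_integrable[OF D_L2[OF u]])
    ultimately show "A.quad (\<lambda>x. complex_of_real \<bar>Re (u x)\<bar>) \<le> A.quad u"
      unfolding shifted_quad using \<tau> by (intro add_mono mult_left_mono) auto
  qed
  show ?thesis
    unfolding sobolev_form_def sobolev_form_axioms_def
    using psd complete q S \<tau> sobolev abs_Re D_measurable interpolation by auto
qed

text \<open>A non-negative potential is admissible if its form is finite on the form domain.\<close>

definition admissible :: "('a \<Rightarrow> real) \<Rightarrow> bool" where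
  "admissible V \<longleftrightarrow> V \<in> borel_measurable M \<and> (AE x in M. 0 \<le> V x) \<and>
     (\<forall>u\<in>D. u \<in> L2 (density M (\<lambda>x. ennreal (V x))))"

abbreviation vquad :: "('a \<Rightarrow> real) \<Rightarrow> ('a \<Rightarrow> complex) \<Rightarrow> real" where
  "vquad V u \<equiv> Re (L2_inner (density M (\<lambda>x. ennreal (V x))) u u)"

lemma form_minus_eq:
  assumes V: "admissible V" and "u \<in> D" "v \<in> D"
  shows "form_minus M t V u v = t u v - L2_inner (density M (\<lambda>x. ennreal (V x))) u v"
proof -
  have [measurable]: "u \<in> borel_measurable M" "v \<in> borel_measurable M" "V \<in> borel_measurable M"
    using assms D_measurable by (auto simp: admissible_def)
  have "L2_inner (density M (\<lambda>x. ennreal (V x))) u v = (\<integral>x. V x *\<^sub>R (u x * cnj (v x)) \<partial>M)"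
    unfolding L2_inner_def using V by (intro integral_density) (auto simp: admissible_def)
  also have "\<dots> = (\<integral>x. complex_of_real (V x) * u x * cnj (v x) \<partial>M)"
    by (simp add: scaleR_conv_of_real mult.assoc)
  finally show ?thesis by (simp add: form_minus_def)
qed

lemma form_minus_quad:
  "admissible V \<Longrightarrow> u \<in> D \<Longrightarrow> Re (form_minus M t V u u) = T.quad u - vquad V u"
  by (simp add: form_minus_eq)

lemma hermitian_form_minus:
  assumes V: "admissible V"
  shows "hermitian_form fscale D (form_minus M t V)"
proof -
  define MV where "MV = density M (\<lambda>x. ennreal (V x))"
  interpret HV: psd_form fscale "L2 MV" "L2_inner MV" by (rule psd_form_L2)
  have sub: "u \<in> L2 MV" if "u \<in> D" for u using V that by (simp add: admissible_def MV_def)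
  have eq: "form_minus M t V u v = t u v - L2_inner MV u v" if "u \<in> D" "v \<in> D" for u v
    using form_minus_eq[OF V that] by (simp add: MV_def)
  show ?thesis
  proof (rule hermitian_formI[OF fun_subspace_D])
    show "form_minus M t V (u + v) w = form_minus M t V u w + form_minus M t V v w"
      if "u \<in> D" "v \<in> D" "w \<in> D" for u v w
      using that sub by (simp add: eq T.add_left HV.add_left)
    show "form_minus M t V (fscale c u) v = c * form_minus M t V u v" if "u \<in> D" "v \<in> D" for c u v
      using that sub by (simp add: eq T.scale_left HV.scale_left algebra_simps)
    show "form_minus M t V v u = cnj (form_minus M t V u v)" if "u \<in> D" "v \<in> D" for u v
      using that sub T.hermitian[of u v] HV.hermitian[of u v] by (simp add: eq)
  qed
qed

text \<open>The form of \<open>\<rho> - (T - V)\<close>, whose positive index is the number of eigenvalues below \<open>\<rho>\<close>.\<close>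

definition gap :: "real \<Rightarrow> ('a \<Rightarrow> real) \<Rightarrow> 'a sform" where
  "gap \<rho> V = (\<lambda>u v. complex_of_real \<rho> * L2_inner M u v - form_minus M t V u v)"

lemma hermitian_form_gap:
  assumes V: "admissible V"
  shows "hermitian_form fscale D (gap \<rho> V)"
proof -
  interpret s: hermitian_form fscale D "form_minus M t V" by (rule hermitian_form_minus[OF V])
  show ?thesis
  proof (rule hermitian_formI[OF fun_subspace_D])
    fix u v assume "u \<in> D" "v \<in> D"
    then show "gap \<rho> V v u = cnj (gap \<rho> V u v)"
      using s.hermitian[of u v] N.hermitian[of u v] by (simp add: gap_def)
  qed (simp_all add: gap_def s.add_left N.add_left s.scale_left N.scale_left algebra_simps)
qed

lemma gap_quad:
  "admissible V \<Longrightarrow> u \<in> D \<Longrightarrow> Re (gap \<rho> V u u) = \<rho> * N.quad u - T.quad u + vquad V u"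
  by (simp add: gap_def form_minus_quad)

text \<open>\<open>gap_pos_family \<rho> V n w\<close>: on the span of the \<open>n\<close> independent \<open>w i\<close>, \<open>T - V < \<rho>\<close> as forms.\<close>

abbreviation gap_pos_family :: "real \<Rightarrow> ('a \<Rightarrow> real) \<Rightarrow> nat \<Rightarrow> (nat \<Rightarrow> 'a \<Rightarrow> complex) \<Rightarrow> bool" where
  "gap_pos_family \<rho> V \<equiv> hermitian_form.pos_family fscale D (gap \<rho> V)"

lemma eigenspace_eq:
  "eigenspace (schroedinger_op M D t V) \<mu> =
     {u \<in> D. \<forall>v\<in>D. form_minus M t V u v = complex_of_real \<mu> * L2_inner M u v}"
proof -
  have eq: "L2_inner M (\<lambda>x. complex_of_real \<mu> * u x) v = complex_of_real \<mu> * L2_inner M u v"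
    if "u \<in> D" "v \<in> D" for u v
    using N.scale_left[OF that, of "complex_of_real \<mu>"] by (simp add: fscale_def)
  have L2: "(\<lambda>x. complex_of_real \<mu> * u x) \<in> L2 M" if "u \<in> D" for u
    using H.D_scale[OF D_L2[OF that], of "complex_of_real \<mu>"] by (simp add: fscale_def)
  show ?thesis
    unfolding eigenspace_def schroedinger_op_def form_op_def using eq L2 by auto
qed

lemma independent_pos_family:
  assumes w: "\<forall>i<m. w i \<in> D" and ind: "L2_independent M m w"
  shows "N.pos_family m w"
  unfolding N.pos_family_def
proof (intro conjI allI impI)
  fix c :: "nat \<Rightarrow> complex" assume c: "\<exists>i<m. c i \<noteq> 0"
  have x: "N.lincomb m w c \<in> D" using w by (intro N.lincomb_in) auto
  have "N.quad (N.lincomb m w c) \<noteq> 0"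
  proof
    assume "N.quad (N.lincomb m w c) = 0"
    then have "AE x in M. (\<Sum>i<m. c i * w i x) = 0"
      using quad_L2_zero_iff[OF D_L2[OF x]] by (simp add: lincomb_apply)
    then show False using ind c by (auto simp: L2_independent_def)
  qed
  then show "0 < N.quad (N.lincomb m w c)" using N.nonneg[OF x] by simp
qed (use w in auto)

lemma orthonormal_independent:
  assumes e: "N.orthonormal m e"
  shows "L2_independent M m e"
  unfolding L2_independent_def
proof (intro allI impI)
  fix c i assume "AE x in M. (\<Sum>i<m. c i * e i x) = 0" and i: "i < m"
  moreover have "N.lincomb m e c \<in> D" using e by (intro N.lincomb_in) (rule N.orthonormal_in)
  ultimately have "N.quad (N.lincomb m e c) = 0"
    using quad_L2_zero_iff[OF D_L2] by (simp add: lincomb_apply)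
  then have "(\<Sum>i<m. (cmod (c i))\<^sup>2) = 0" unfolding N.quad_lincomb[OF e] .
  then show "c i = 0" using i by (simp add: sum_nonneg_eq_0_iff)
qed

text \<open>Eigenvectors to several eigenvalues below \<open>\<rho>\<close> span a subspace on which the gap form is positive.\<close>

lemma eigenspaces_pos_family:
  assumes V: "admissible V" and F: "finite F" "\<And>\<mu>. \<mu> \<in> F \<Longrightarrow> \<mu> < \<rho>"
    and m: "\<And>\<mu>. \<mu> \<in> F \<Longrightarrow> enat (m \<mu>) \<le> L2_dim M (eigenspace (schroedinger_op M D t V) \<mu>)"
  shows "\<exists>w. gap_pos_family \<rho> V (\<Sum>\<mu>\<in>F. m \<mu>) w"
proof -
  interpret s: hermitian_form fscale D "form_minus M t V" by (rule hermitian_form_minus[OF V])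
  have "\<exists>f. N.orthonormal (m \<mu>) f \<and>
      (\<forall>i<m \<mu>. \<forall>v\<in>D. form_minus M t V (f i) v = complex_of_real \<mu> * L2_inner M (f i) v)"
    if \<mu>: "\<mu> \<in> F" for \<mu>
  proof -
    obtain w where w: "\<forall>i<m \<mu>. w i \<in> eigenspace (schroedinger_op M D t V) \<mu>" "L2_independent M (m \<mu>) w"
      using L2_dim_family[OF m[OF \<mu>]] by blast
    have wD: "\<forall>i<m \<mu>. w i \<in> D"
      and weig: "\<And>i v. i < m \<mu> \<Longrightarrow> v \<in> D \<Longrightarrow> form_minus M t V (w i) v = complex_of_real \<mu> * L2_inner M (w i) v"
      using w(1) unfolding eigenspace_eq by auto
    obtain f where f: "N.orthonormal (m \<mu>) f" and span: "\<And>i. i < m \<mu> \<Longrightarrow> \<exists>d. f i = N.lincomb (m \<mu>) w d"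
      using N.gram_schmidt[OF independent_pos_family[OF wD w(2)]] by blast
    have "form_minus M t V (f i) v = complex_of_real \<mu> * L2_inner M (f i) v" if i: "i < m \<mu>" and v: "v \<in> D" for i v
    proof -
      obtain d where d: "f i = N.lincomb (m \<mu>) w d" using span[OF i] by blast
      have "form_minus M t V (f i) v = (\<Sum>j<m \<mu>. d j * form_minus M t V (w j) v)"
        unfolding d N.lincomb_def using wD v by (subst s.sum_left) (auto simp: s.scale_left)
      also have "\<dots> = (\<Sum>j<m \<mu>. complex_of_real \<mu> * (d j * L2_inner M (w j) v))"
        using weig v by (intro sum.cong) auto
      also have "\<dots> = complex_of_real \<mu> * L2_inner M (f i) v"
        unfolding d N.lincomb_def using wD v
        by (subst N.sum_left) (auto simp: N.scale_left sum_distrib_left)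
      finally show ?thesis .
    qed
    then show ?thesis using f by blast
  qed
  then obtain f where f: "\<And>\<mu>. \<mu> \<in> F \<Longrightarrow> N.orthonormal (m \<mu>) (f \<mu>)"
    and feig: "\<And>\<mu> i v. \<mu> \<in> F \<Longrightarrow> i < m \<mu> \<Longrightarrow> v \<in> D \<Longrightarrow>
      form_minus M t V (f \<mu> i) v = complex_of_real \<mu> * L2_inner M (f \<mu> i) v"
    by metis
  define A where "A = Sigma F (\<lambda>\<mu>. {..<m \<mu>})"
  have cardA: "card A = (\<Sum>\<mu>\<in>F. m \<mu>)" unfolding A_def using F(1) by (simp add: card_SigmaI)
  have "finite A" unfolding A_def using F(1) by auto
  then obtain \<beta> where \<beta>: "bij_betw \<beta> {..<card A} A"
    using ex_bij_betw_nat_finite by (auto simp: lessThan_atLeast0)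
  define e where "e k = f (fst (\<beta> k)) (snd (\<beta> k))" for k
  have \<beta>A: "fst (\<beta> k) \<in> F" "snd (\<beta> k) < m (fst (\<beta> k))" if "k < card A" for k
    using bij_betwE[OF \<beta>] that by (force simp: A_def)+
  have eD: "e k \<in> D" if "k < card A" for k
    unfolding e_def using N.orthonormal_in[OF f] \<beta>A[OF that] by blast
  have eig: "form_minus M t V (e k) v = complex_of_real (fst (\<beta> k)) * L2_inner M (e k) v"
    if "k < card A" "v \<in> D" for k v
    unfolding e_def using feig \<beta>A[OF that(1)] that(2) by blast
  \<comment> \<open>Vectors from the same eigenspace were orthonormalised; different eigenspaces are orthogonal.\<close>
  have "N.orthonormal (card A) e"
    unfolding N.orthonormal_def
  proof (intro conjI allI impI)
    fix k l assume kl: "k < card A" "l < card A"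
    show "L2_inner M (e k) (e l) = (if k = l then 1 else 0)"
    proof (cases "fst (\<beta> k) = fst (\<beta> l)")
      case True
      have "k = l \<longleftrightarrow> \<beta> k = \<beta> l" using \<beta> kl by (auto simp: bij_betw_def inj_on_def)
      also have "\<dots> \<longleftrightarrow> snd (\<beta> k) = snd (\<beta> l)" using True by (auto simp: prod_eq_iff)
      finally show ?thesis
        using f[OF \<beta>A(1)[OF kl(1)]] \<beta>A[OF kl(1)] \<beta>A[OF kl(2)] True
        unfolding e_def N.orthonormal_def by auto
    next
      case False
      have "complex_of_real (fst (\<beta> k)) * L2_inner M (e k) (e l) = form_minus M t V (e k) (e l)"
        using eig[OF kl(1) eD[OF kl(2)]] by simp
      also have "\<dots> = cnj (form_minus M t V (e l) (e k))" by (rule s.hermitian[OF eD[OF kl(2)] eD[OF kl(1)]])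
      also have "\<dots> = complex_of_real (fst (\<beta> l)) * cnj (L2_inner M (e l) (e k))"
        using eig[OF kl(2) eD[OF kl(1)]] by simp
      also have "cnj (L2_inner M (e l) (e k)) = L2_inner M (e k) (e l)"
        by (rule N.hermitian[OF eD[OF kl(2)] eD[OF kl(1)], symmetric])
      finally have "L2_inner M (e k) (e l) = 0" using False by simp
      then show ?thesis using False by auto
    qed
  qed (rule eD)
  from N.eigenvectors_pos_family[OF s.hermitian_form_axioms this eig]
  have "gap_pos_family \<rho> V (card A) e"
    unfolding gap_def using F(2) \<beta>A(1) by blast
  then show ?thesis unfolding cardA by blast
qed

lemma num_eigenvalues_le:
  assumes V: "admissible V" and B: "\<And>n w. gap_pos_family \<rho> V n w \<Longrightarrow> of_nat n \<le> B"
  shows "num_eigenvalues_below M \<rho> (schroedinger_op M D t V) \<le> B"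
  unfolding num_eigenvalues_below_def
proof (subst nonneg_infsum_complete)
  show "(SUP F\<in>{F. finite F \<and> F \<subseteq> {\<mu>. eigenvalue M (schroedinger_op M D t V) \<mu> \<and> \<mu> < \<rho>}}.
           sum (multiplicity_of M (schroedinger_op M D t V)) F) \<le> B"
  proof (rule SUP_least)
    fix F assume "F \<in> {F. finite F \<and> F \<subseteq> {\<mu>. eigenvalue M (schroedinger_op M D t V) \<mu> \<and> \<mu> < \<rho>}}"
    then have F: "finite F" "\<And>\<mu>. \<mu> \<in> F \<Longrightarrow> \<mu> < \<rho>" by auto
    show "sum (multiplicity_of M (schroedinger_op M D t V)) F \<le> B"
      unfolding multiplicity_of_def
    proof (rule sum_enat_le[OF F(1)])
      fix m :: "real \<Rightarrow> nat"
      assume "\<forall>\<mu>\<in>F. enat (m \<mu>) \<le> L2_dim M (eigenspace (schroedinger_op M D t V) \<mu>)"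
      then show "of_nat (\<Sum>\<mu>\<in>F. m \<mu>) \<le> B"
        using eigenspaces_pos_family[OF V F, of m] B by blast
    qed
  qed
qed simp

lemma num_eigenvalues_ge:
  assumes e: "N.orthonormal n e"
    and eig: "\<And>i. i < n \<Longrightarrow> \<mu> i < \<rho> \<and> (\<forall>v\<in>D. form_minus M t V (e i) v = complex_of_real (\<mu> i) * L2_inner M (e i) v)"
  shows "of_nat n \<le> num_eigenvalues_below M \<rho> (schroedinger_op M D t V)"
proof -
  define A where "A = schroedinger_op M D t V"
  define F where "F = \<mu> ` {..<n}"
  have eE: "e i \<in> eigenspace A (\<mu> i)" if "i < n" for i
    unfolding A_def eigenspace_eq using eig[OF that] N.orthonormal_in[OF e that] by blast
  have eig_A: "eigenvalue M A \<nu> \<and> \<nu> < \<rho>" if "\<nu> \<in> F" for \<nu>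
  proof -
    obtain i where i: "i < n" "\<nu> = \<mu> i" using \<open>\<nu> \<in> F\<close> by (auto simp: F_def)
    have eD: "e i \<in> D" by (rule N.orthonormal_in[OF e i(1)])
    have "N.quad (e i) = 1" using e i(1) by (simp add: N.orthonormal_def)
    then have "\<not> (AE x in M. e i x = 0)" using quad_L2_zero_iff[OF D_L2[OF eD]] by simp
    then show ?thesis unfolding eigenvalue_def using eE[OF i(1)] eig[OF i(1)] i(2) by blast
  qed
  have mult: "of_nat (card {i \<in> {..<n}. \<mu> i = \<nu>}) \<le> multiplicity_of M A \<nu>" for \<nu>
  proof -
    define m where "m = card {i \<in> {..<n}. \<mu> i = \<nu>}"
    obtain \<beta> where \<beta>: "bij_betw \<beta> {..<m} {i \<in> {..<n}. \<mu> i = \<nu>}"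
      using ex_bij_betw_nat_finite[of "{i \<in> {..<n}. \<mu> i = \<nu>}"] by (auto simp: lessThan_atLeast0 m_def)
    have \<beta>_mem: "\<beta> j < n" "\<mu> (\<beta> j) = \<nu>" if "j < m" for j using bij_betwE[OF \<beta>] that by auto
    have inj: "\<beta> j = \<beta> l \<longleftrightarrow> j = l" if "j < m" "l < m" for j l
      using \<beta> that by (auto simp: bij_betw_def inj_on_def)
    have "N.orthonormal m (\<lambda>j. e (\<beta> j))"
      using e \<beta>_mem inj unfolding N.orthonormal_def by auto
    then have "L2_independent M m (\<lambda>j. e (\<beta> j))" by (rule orthonormal_independent)
    moreover have "\<forall>j<m. e (\<beta> j) \<in> eigenspace A \<nu>" using eE \<beta>_mem by metis
    ultimately have "enat m \<le> L2_dim M (eigenspace A \<nu>)" by (intro L2_dim_geI)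
    then have "ennreal_of_enat (enat m) \<le> multiplicity_of M A \<nu>"
      unfolding multiplicity_of_def by (simp only: ennreal_of_enat_le_iff)
    then show ?thesis by (simp add: m_def)
  qed
  have "(\<Sum>\<nu>\<in>F. card {i \<in> {..<n}. \<mu> i = \<nu>}) = card {..<n}"
    unfolding F_def using sum.image_gen[of "{..<n}" "\<lambda>_. 1 :: nat" \<mu>] by simp
  then have "of_nat n = (\<Sum>\<nu>\<in>F. of_nat (card {i \<in> {..<n}. \<mu> i = \<nu>}) :: ennreal)"
    by (simp flip: of_nat_sum)
  also have "\<dots> \<le> (\<Sum>\<nu>\<in>F. multiplicity_of M A \<nu>)" by (intro sum_mono mult)
  also have "\<dots> \<le> num_eigenvalues_below M \<rho> A"
    unfolding num_eigenvalues_below_def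
  proof (subst nonneg_infsum_complete)
    have "F \<in> {F. finite F \<and> F \<subseteq> {\<mu>. eigenvalue M A \<mu> \<and> \<mu> < \<rho>}}"
      using eig_A by (auto simp: F_def)
    then show "sum (multiplicity_of M A) F
        \<le> (SUP F\<in>{F. finite F \<and> F \<subseteq> {\<mu>. eigenvalue M A \<mu> \<and> \<mu> < \<rho>}}. sum (multiplicity_of M A) F)"
      by (rule SUP_upper)
  qed simp
  finally show ?thesis by (simp add: A_def)
qed

section \<open>The weak Lieb--Thirring inequality\<close>

lemma weighted_sobolev_form_shifted:
  assumes W: "W \<in> nonneg_Lp M (\<gamma> + \<kappa>)" and \<tau>: "0 < \<tau>"
  shows "weighted_sobolev_form D (shifted \<tau>) M q (S * \<tau> powr (1 - \<theta>)) W"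
proof -
  interpret sobolev_form D "shifted \<tau>" M q "S * \<tau> powr (1 - \<theta>)" by (rule sobolev_form_shifted[OF \<tau>])
  show ?thesis
    by unfold_locales (use W in \<open>auto simp: nonneg_Lp_def exponent_sum\<close>)
qed

lemma nonneg_Lp_admissible:
  assumes W: "W \<in> nonneg_Lp M (\<gamma> + \<kappa>)"
  shows "admissible W"
proof -
  interpret weighted_sobolev_form D "shifted 1" M q "S * 1 powr (1 - \<theta>)" W
    by (rule weighted_sobolev_form_shifted[OF W]) simp
  show ?thesis
    unfolding admissible_def using W D_embeds(1) by (auto simp: nonneg_Lp_def)
qed

text \<open>The potential is form bounded with respect to \<open>t\<close> with bound one half.\<close>

lemma form_bound_half:
  assumes W: "W \<in> nonneg_Lp M (\<gamma> + \<kappa>)"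
  shows "\<exists>K\<ge>0. \<forall>u\<in>D. vquad W u \<le> T.quad u / 2 + K * N.quad u"
proof -
  define J where "J = (\<integral>x. W x powr (\<gamma> + \<kappa>) \<partial>M) powr (1 / (\<gamma> + \<kappa>))"
  \<comment> \<open>For large \<open>\<tau>\<close> the constant \<open>S \<tau> powr (1 - \<theta>)\<close> in the Sobolev inequality for \<open>t + \<tau>\<close> exceeds
    \<open>2 J\<close>.\<close>
  define \<tau> where "\<tau> = (2 * J / S) powr (1 / (1 - \<theta>)) + 1"
  have J: "0 \<le> J" by (simp add: J_def)
  have \<tau>: "0 < \<tau>" by (simp add: \<tau>_def add_nonneg_pos)
  note S_pos = S
  interpret weighted_sobolev_form D "shifted \<tau>" M q "S * \<tau> powr (1 - \<theta>)" W
    by (rule weighted_sobolev_form_shifted[OF W \<tau>])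
  have "((2 * J / S) powr (1 / (1 - \<theta>))) powr (1 - \<theta>) \<le> \<tau> powr (1 - \<theta>)"
    using \<theta> by (intro powr_mono2) (auto simp: \<tau>_def)
  then have "2 * J / S \<le> \<tau> powr (1 - \<theta>)"
    using \<theta> J S_pos by (simp add: powr_powr)
  then have half: "J / (S * \<tau> powr (1 - \<theta>)) \<le> 1 / 2"
    using S_pos \<tau> by (simp add: field_simps)
  have "vquad W u \<le> T.quad u / 2 + \<tau> / 2 * N.quad u" if u: "u \<in> D" for u
  proof -
    have "vquad W u \<le> J / (S * \<tau> powr (1 - \<theta>)) * Re (shifted \<tau> u u)"
      using D_embeds(2)[OF u] by (simp add: I_def p_def J_def exponent_sum)
    also have "\<dots> \<le> 1 / 2 * Re (shifted \<tau> u u)"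
      using half nonneg[OF u] by (intro mult_right_mono)
    finally show ?thesis by (simp add: shifted_quad)
  qed
  then show ?thesis using \<tau> by (intro exI[of _ "\<tau> / 2"]) auto
qed

text \<open>The constant in the weak inequality that \<open>CLR_bound\<close> provides.\<close>

definition CLR_constant :: real where
  "CLR_constant = 4 * exp 2 * (4 * (\<gamma> + \<kappa>) / S) powr (\<gamma> + \<kappa>)"

lemma pos_index_bound:
  assumes W: "W \<in> nonneg_Lp M (\<gamma> + \<kappa>)" and \<tau>: "0 < \<tau>" and fam: "gap_pos_family (- \<tau>) W n w"
  shows "real n \<le> CLR_constant * \<tau> powr (- \<gamma>) * (\<integral>x. W x powr (\<gamma> + \<kappa>) \<partial>M)"
proof -
  interpret A: weighted_sobolev_form D "shifted \<tau>" M q "S * \<tau> powr (1 - \<theta>)" W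
    by (rule weighted_sobolev_form_shifted[OF W \<tau>])
  have p: "A.p = \<gamma> + \<kappa>" by (simp add: A.p_def exponent_sum)
  interpret g: hermitian_form fscale D "gap (- \<tau>) W"
    by (rule hermitian_form_gap[OF nonneg_Lp_admissible[OF W]])
  interpret HD: hermitian_form fscale D "L2_inner A.MW" by (rule A.hermitian_form_D)
  have herm: "hermitian_form fscale D (\<lambda>u v. L2_inner A.MW u v - shifted \<tau> u v)"
  proof (rule hermitian_formI[OF fun_subspace_D])
    fix u v assume "u \<in> D" "v \<in> D"
    then show "L2_inner A.MW v u - shifted \<tau> v u = cnj (L2_inner A.MW u v - shifted \<tau> u v)"
      using A.hermitian[of u v] HD.hermitian[of u v] by simp
  qed (simp_all add: A.add_left HD.add_left A.scale_left HD.scale_left algebra_simps)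
  have "hermitian_form.pos_family fscale D (\<lambda>u v. L2_inner A.MW u v - shifted \<tau> u v) n w"
    by (rule g.pos_family_mono_form[OF herm fam])
      (simp add: gap_quad[OF nonneg_Lp_admissible[OF W]] shifted_quad)
  from A.CLR_bound[OF this]
  have "real n \<le> 4 * exp 2 * (4 * (\<gamma> + \<kappa>) / (S * \<tau> powr (1 - \<theta>))) powr (\<gamma> + \<kappa>) * (\<integral>x. W x powr (\<gamma> + \<kappa>) \<partial>M)"
    unfolding A.I_def p .
  also have "4 * (\<gamma> + \<kappa>) / (S * \<tau> powr (1 - \<theta>)) = 4 * (\<gamma> + \<kappa>) / S * \<tau> powr - (1 - \<theta>)"
    unfolding powr_minus_divide by simp
  also have "(4 * (\<gamma> + \<kappa>) / S * \<tau> powr - (1 - \<theta>)) powr (\<gamma> + \<kappa>)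
      = (4 * (\<gamma> + \<kappa>) / S) powr (\<gamma> + \<kappa>) * (\<tau> powr - (1 - \<theta>)) powr (\<gamma> + \<kappa>)"
    using S \<tau> gamma_pos kappa_pos by (intro powr_mult)
  also have "(\<tau> powr - (1 - \<theta>)) powr (\<gamma> + \<kappa>) = \<tau> powr (- \<gamma>)"
  proof -
    have "(1 - \<theta>) * (q / (q - 2)) = \<gamma>" by (simp add: \<gamma> mult.commute)
    then have "- (1 - \<theta>) * (\<gamma> + \<kappa>) = - \<gamma>" by (simp only: exponent_sum mult_minus_left)
    then show ?thesis by (simp only: powr_powr)
  qed
  finally show ?thesis by (simp add: CLR_constant_def mult_ac)
qed

text \<open>Conversely, a subspace on which the gap form is positive forces as many eigenvalues.\<close>

lemma pos_index_le_num_eigenvalues: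
  assumes W: "W \<in> nonneg_Lp M (\<gamma> + \<kappa>)" and \<tau>: "0 < \<tau>" and fam: "gap_pos_family (- \<tau>) W n w"
  shows "of_nat n \<le> num_eigenvalues_below M (- \<tau>) (schroedinger_op M D t W)"
proof -
  have adm: "admissible W" by (rule nonneg_Lp_admissible[OF W])
  define s where "s = form_minus M t W"
  have herm: "hermitian_form fscale D s" unfolding s_def by (rule hermitian_form_minus[OF adm])
  obtain K where K: "0 \<le> K" "\<And>u. u \<in> D \<Longrightarrow> vquad W u \<le> T.quad u / 2 + K * N.quad u"
    using form_bound_half[OF W] by blast
  have s_quad: "Re (s u u) = T.quad u - vquad W u" if "u \<in> D" for u
    unfolding s_def by (rule form_minus_quad[OF adm that])
  have s_upper: "Re (s u u) \<le> T.quad u" if "u \<in> D" for u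
  proof -
    have "0 \<le> vquad W u"
      by (rule psd_form.nonneg[OF psd_form_L2]) (use adm that in \<open>auto simp: admissible_def\<close>)
    then show ?thesis using s_quad[OF that] by simp
  qed
  have s_lower: "T.quad u / 2 - K * N.quad u \<le> Re (s u u)" if "u \<in> D" for u
    using s_quad[OF that] K(2)[OF that] by simp
  have "\<exists>e \<mu>. N.orthonormal n e \<and>
      (\<forall>i<n. \<mu> i < - \<tau> \<and> (\<forall>v\<in>D. s (e i) v = complex_of_real (\<mu> i) * L2_inner M (e i) v))"
  proof (rule N.eigenvectors_below[OF herm, where K = K and w = w and ?N0.0 = "nat \<lceil>CLR_constant * \<tau> powr (- \<gamma>) * (\<integral>x. W x powr (\<gamma> + \<kappa>) \<partial>M)\<rceil>"])
    show "- K * N.quad u \<le> Re (s u u)" if "u \<in> D" for u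
      using s_lower[OF that] T.nonneg[OF that] by simp
    show "hermitian_form.pos_family fscale D (\<lambda>u v. complex_of_real (- \<tau>) * L2_inner M u v - s u v) n w"
      using fam unfolding gap_def s_def .
    show "m \<le> nat \<lceil>CLR_constant * \<tau> powr (- \<gamma>) * (\<integral>x. W x powr (\<gamma> + \<kappa>) \<partial>M)\<rceil>"
      if "hermitian_form.pos_family fscale D (\<lambda>u v. complex_of_real (- \<tau>) * L2_inner M u v - s u v) m w" for m w
    proof -
      have "gap_pos_family (- \<tau>) W m w" using that unfolding gap_def s_def .
      from pos_index_bound[OF W \<tau> this] show ?thesis by linarith
    qed
    fix U :: "nat \<Rightarrow> 'a \<Rightarrow> complex"
    assume U: "\<And>n. U n \<in> D"
      and cau: "\<And>\<epsilon>. \<epsilon> > 0 \<Longrightarrow> \<exists>N. \<forall>m\<ge>N. \<forall>n\<ge>N. N.quad (U m - U n) < \<epsilon> \<and> Re (s (U m - U n) (U m - U n)) < \<epsilon>"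
    have "\<exists>u\<in>D. (\<lambda>n. N.quad (U n - u)) \<longlonglongrightarrow> 0 \<and> (\<lambda>n. T.quad (U n - u)) \<longlonglongrightarrow> 0"
    proof (rule closed_limit[OF U])
      fix \<epsilon> :: real assume \<epsilon>: "\<epsilon> > 0"
      show "\<exists>n0. \<forall>m\<ge>n0. \<forall>n\<ge>n0. N.quad (U m - U n) < \<epsilon>" using cau[OF \<epsilon>] by blast
      define \<delta> where "\<delta> = \<epsilon> / 2 / (1 + K)"
      have \<delta>: "\<delta> > 0" using \<epsilon> K(1) by (simp add: \<delta>_def)
      obtain n0 where n0: "\<And>m n. m \<ge> n0 \<Longrightarrow> n \<ge> n0 \<Longrightarrow> N.quad (U m - U n) < \<delta> \<and> Re (s (U m - U n) (U m - U n)) < \<delta>"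
        using cau[OF \<delta>] by blast
      have "T.quad (U m - U n) < \<epsilon>" if "m \<ge> n0" "n \<ge> n0" for m n
      proof -
        have "K * N.quad (U m - U n) \<le> K * \<delta>"
          using n0[OF that] K(1) by (intro mult_left_mono) auto
        then have "T.quad (U m - U n) / 2 < \<delta> + K * \<delta>"
          using s_lower[OF T.D_diff[OF U U], of m n] n0[OF that] by linarith
        also have "\<delta> + K * \<delta> = \<delta> * (1 + K)" by (simp add: algebra_simps)
        also have "\<dots> = \<epsilon> / 2"
        proof -
          have "1 + K \<noteq> 0" using K(1) by linarith
          then show ?thesis unfolding \<delta>_def by (rule nonzero_eq_divide_eq[THEN iffD1]) simp
        qed
        finally show ?thesis by simp
      qed
      then show "\<exists>n0. \<forall>m\<ge>n0. \<forall>n\<ge>n0. T.quad (U m - U n) < \<epsilon>" by blast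
    qed
    then obtain u where u: "u \<in> D" and lim: "(\<lambda>n. N.quad (U n - u)) \<longlonglongrightarrow> 0" "(\<lambda>n. T.quad (U n - u)) \<longlonglongrightarrow> 0"
      by blast
    have "(\<lambda>n. Re (s (U n - u) (U n - u))) \<longlonglongrightarrow> 0"
    proof (rule tendsto_sandwich)
      show "\<forall>\<^sub>F n in sequentially. T.quad (U n - u) / 2 - K * N.quad (U n - u) \<le> Re (s (U n - u) (U n - u))"
        using s_lower[OF T.D_diff[OF U u]] by (intro always_eventually allI)
      show "\<forall>\<^sub>F n in sequentially. Re (s (U n - u) (U n - u)) \<le> T.quad (U n - u)"
        using s_upper[OF T.D_diff[OF U u]] by (intro always_eventually allI)
      show "(\<lambda>n. T.quad (U n - u) / 2 - K * N.quad (U n - u)) \<longlonglongrightarrow> 0"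
        using tendsto_diff[OF tendsto_mult_left[OF lim(2), of "1/2"] tendsto_mult_left[OF lim(1), of K]] by simp
    qed (rule lim(2))
    then show "\<exists>u\<in>D. (\<lambda>n. N.quad (U n - u)) \<longlonglongrightarrow> 0 \<and> (\<lambda>n. Re (s (U n - u) (U n - u))) \<longlonglongrightarrow> 0"
      using u lim(1) by blast
  qed
  then obtain e \<mu> where e: "N.orthonormal n e"
    and eig: "\<And>i. i < n \<Longrightarrow> \<mu> i < - \<tau> \<and> (\<forall>v\<in>D. s (e i) v = complex_of_real (\<mu> i) * L2_inner M (e i) v)"
    by blast
  show ?thesis by (rule num_eigenvalues_ge[OF e eig[unfolded s_def]])
qed

lemma weak_LT_CLR: "weak_LT M D t \<gamma> \<kappa> CLR_constant"
  unfolding weak_LT_def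
proof (intro ballI allI impI)
  fix W \<tau> assume W: "W \<in> nonneg_Lp M (\<gamma> + \<kappa>)" and \<tau>: "(0::real) < \<tau>"
  show "num_eigenvalues_below M (- \<tau>) (schroedinger_op M D t W)
      \<le> ennreal (CLR_constant * \<tau> powr - \<gamma> * (\<integral>x. W x powr (\<gamma> + \<kappa>) \<partial>M))"
  proof (rule num_eigenvalues_le[OF nonneg_Lp_admissible[OF W]])
    fix n w assume "gap_pos_family (- \<tau>) W n w"
    from pos_index_bound[OF W \<tau> this]
    show "of_nat n \<le> ennreal (CLR_constant * \<tau> powr - \<gamma> * (\<integral>x. W x powr (\<gamma> + \<kappa>) \<partial>M))"
      by (simp add: ennreal_of_nat_eq_real_of_nat ennreal_leI)
  qed
qed

text \<open>The weak inequality passes to the infimum of its admissible constants.\<close>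

lemma sharp_weak_LT_exists: "\<exists>L. sharp_weak_LT M D t \<gamma> \<kappa> L"
proof -
  define Cs where "Cs = {C. 0 \<le> C \<and> weak_LT M D t \<gamma> \<kappa> C}"
  have "0 \<le> CLR_constant" by (simp add: CLR_constant_def)
  then have ne: "Cs \<noteq> {}" using weak_LT_CLR by (auto simp: Cs_def)
  have bdd: "bdd_below Cs" by (auto simp: Cs_def intro: bdd_belowI[of _ 0])
  have "0 \<le> Inf Cs" by (rule cInf_greatest[OF ne]) (simp add: Cs_def)
  moreover have "weak_LT M D t \<gamma> \<kappa> (Inf Cs)"
    unfolding weak_LT_def
  proof (intro ballI allI impI)
    fix W \<tau> assume W: "W \<in> nonneg_Lp M (\<gamma> + \<kappa>)" and \<tau>: "(0::real) < \<tau>"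
    define x where "x = \<tau> powr - \<gamma> * (\<integral>x. W x powr (\<gamma> + \<kappa>) \<partial>M)"
    define n where "n = num_eigenvalues_below M (- \<tau>) (schroedinger_op M D t W)"
    have x: "0 \<le> x" by (simp add: x_def)
    have le: "n \<le> ennreal (C * x)" if "C \<in> Cs" for C
      using that W \<tau> unfolding Cs_def weak_LT_def n_def x_def by (simp add: mult.assoc)
    obtain C0 where C0: "C0 \<in> Cs" using ne by blast
    have "n \<noteq> \<infinity>" using le[OF C0] by (auto simp: top_unique)
    then obtain y where y: "0 \<le> y" "n = ennreal y" by (cases n) auto
    have "n \<le> ennreal (Inf Cs * x)"
    proof (cases "x = 0")
      case True
      then show ?thesis using le[OF C0] by simp
    next
      case False
      then have x: "0 < x" using x by simp
      have "y / x \<le> C" if "C \<in> Cs" for C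
      proof -
        have "0 \<le> C" using that by (simp add: Cs_def)
        then have "y \<le> C * x" using le[OF that] y x by simp
        then show ?thesis using x by (simp add: field_simps)
      qed
      then have "y / x \<le> Inf Cs" by (intro cInf_greatest[OF ne])
      then have "y \<le> Inf Cs * x" using x by (simp add: field_simps)
      then show ?thesis using y by (simp add: ennreal_leI)
    qed
    then show "num_eigenvalues_below M (- \<tau>) (schroedinger_op M D t W)
        \<le> ennreal (Inf Cs * \<tau> powr - \<gamma> * (\<integral>x. W x powr (\<gamma> + \<kappa>) \<partial>M))"
      by (simp add: n_def x_def mult.assoc)
  qed
  moreover have "Inf Cs \<le> C" if "0 \<le> C" "weak_LT M D t \<gamma> \<kappa> C" for C
    using that bdd by (intro cInf_lower) (auto simp: Cs_def)
  ultimately show ?thesis unfolding sharp_weak_LT_def by blast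
qed

end

section \<open>The trace of the negative part\<close>

lemma nn_integral_powr:
  assumes g: "0 < g" and c: "0 \<le> c"
  shows "(\<integral>\<^sup>+\<tau>. ennreal (g * \<tau> powr (g - 1)) * indicator {0<..<c} \<tau> \<partial>lborel) = ennreal (c powr g)"
proof -
  have "((\<lambda>\<tau>. \<tau> powr (g - 1)) has_integral (c powr (g - 1 + 1) / (g - 1 + 1))) {0..c}"
    using g c by (intro has_integral_powr_from_0) auto
  from has_integral_mult_right[OF this, of g]
  have "((\<lambda>\<tau>. g * \<tau> powr (g - 1)) has_integral c powr g) {0..c}" using g by simp
  then have "(\<integral>\<^sup>+\<tau>. ennreal (g * \<tau> powr (g - 1)) * indicator {0..c} \<tau> \<partial>lborel) = ennreal (c powr g)"
    using g by (intro nn_integral_has_integral_lebesgue') auto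
  moreover have "(\<integral>\<^sup>+\<tau>. ennreal (g * \<tau> powr (g - 1)) * indicator {0<..<c} \<tau> \<partial>lborel)
      = (\<integral>\<^sup>+\<tau>. ennreal (g * \<tau> powr (g - 1)) * indicator {0..c} \<tau> \<partial>lborel)"
  proof (rule nn_integral_cong_AE)
    have "AE \<tau> in lborel. \<tau> \<noteq> 0 \<and> \<tau> \<noteq> c"
      using AE_lborel_singleton[of 0] AE_lborel_singleton[of c] by eventually_elim simp
    then show "AE \<tau> in lborel. ennreal (g * \<tau> powr (g - 1)) * indicator {0<..<c} \<tau>
        = ennreal (g * \<tau> powr (g - 1)) * indicator {0..c} \<tau>"
      by eventually_elim (auto simp: indicator_def)
  qed
  ultimately show ?thesis by simp
qed

lemma nn_integral_Beta:
  assumes a: "0 < a" and p: "0 < p"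
  shows "(\<integral>\<^sup>+r. ennreal (r powr (a - 1) * (max 0 (1 - r)) powr p) * indicator {0<..} r \<partial>lborel)
    = ennreal (Beta a (p + 1))"
proof -
  have "((\<lambda>r. r powr (a - 1) * (1 - r) powr (p + 1 - 1)) has_integral Beta a (p + 1)) {0..1}"
    using a p by (intro has_integral_Beta_real) auto
  then have "(\<integral>\<^sup>+r. ennreal (r powr (a - 1) * (1 - r) powr (p + 1 - 1)) * indicator {0..1} r \<partial>lborel)
      = ennreal (Beta a (p + 1))"
    by (intro nn_integral_has_integral_lebesgue') auto
  moreover have "ennreal (r powr (a - 1) * (max 0 (1 - r)) powr p) * indicator {0<..} r
      = ennreal (r powr (a - 1) * (1 - r) powr (p + 1 - 1)) * indicator {0..1} r" for r :: real
    by (cases "r = 0"; cases "r \<le> 1") (auto simp: indicator_def max_def)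
  ultimately show ?thesis by simp
qed

lemma nn_integral_Beta_scaled:
  assumes a: "0 < a" and p: "0 < p" and \<sigma>: "0 < \<sigma>" and v: "0 \<le> v"
  shows "(\<integral>\<^sup>+\<tau>. ennreal (\<tau> powr (a - 1) * (max 0 (v - \<sigma> * \<tau>)) powr p) * indicator {0<..} \<tau> \<partial>lborel)
    = ennreal (\<sigma> powr - a * Beta a (p + 1) * v powr (a + p))"
proof (cases "v = 0")
  case True
  have "ennreal (\<tau> powr (a - 1) * (max 0 (v - \<sigma> * \<tau>)) powr p) * indicator {0<..} \<tau> = 0" for \<tau>
    using True mult_pos_pos[OF \<sigma>, of \<tau>] by (cases "0 < \<tau>") auto
  then have "(\<integral>\<^sup>+\<tau>. ennreal (\<tau> powr (a - 1) * (max 0 (v - \<sigma> * \<tau>)) powr p) * indicator {0<..} \<tau> \<partial>lborel)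
      = (\<integral>\<^sup>+(\<tau>::real). 0 \<partial>lborel)"
    by (intro nn_integral_cong)
  also have "\<dots> = ennreal (\<sigma> powr - a * Beta a (p + 1) * v powr (a + p))"
    using True a p by simp
  finally show ?thesis .
next
  case False
  then have v: "0 < v" using v by simp
  define c where "c = v / \<sigma>"
  have c: "0 < c" using v \<sigma> by (simp add: c_def)
  have "(\<integral>\<^sup>+\<tau>. ennreal (\<tau> powr (a - 1) * (max 0 (v - \<sigma> * \<tau>)) powr p) * indicator {0<..} \<tau> \<partial>lborel)
      = ennreal c * (\<integral>\<^sup>+r. ennreal ((c * r) powr (a - 1) * (max 0 (v - \<sigma> * (c * r))) powr p) * indicator {0<..} (c * r) \<partial>lborel)"
    using c by (subst nn_integral_real_affine[where c = c and t = 0]) auto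
  also have "\<dots> = ennreal c * (\<integral>\<^sup>+r. ennreal (c powr (a - 1) * v powr p) *
      (ennreal (r powr (a - 1) * (max 0 (1 - r)) powr p) * indicator {0<..} r) \<partial>lborel)"
  proof (rule arg_cong2[where f = "(*)", OF refl], rule nn_integral_cong)
    fix r :: real
    have "max 0 (v - \<sigma> * (c * r)) = v * max 0 (1 - r)"
      using v \<sigma> by (simp add: c_def max_mult_distrib_left algebra_simps)
    then have "(c * r) powr (a - 1) * (max 0 (v - \<sigma> * (c * r))) powr p
        = c powr (a - 1) * v powr p * (r powr (a - 1) * (max 0 (1 - r)) powr p)"
      by (simp add: powr_mult)
    moreover have "indicator {0<..} (c * r) = (indicator {0<..} r :: ennreal)"
      using c by (simp add: indicator_def zero_less_mult_iff)
    ultimately show "ennreal ((c * r) powr (a - 1) * (max 0 (v - \<sigma> * (c * r))) powr p) * indicator {0<..} (c * r)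
        = ennreal (c powr (a - 1) * v powr p) * (ennreal (r powr (a - 1) * (max 0 (1 - r)) powr p) * indicator {0<..} r)"
      by (simp add: ennreal_mult mult.assoc)
  qed
  also have "\<dots> = ennreal c * (ennreal (c powr (a - 1) * v powr p) * ennreal (Beta a (p + 1)))"
    by (subst nn_integral_cmult) (auto simp: nn_integral_Beta[OF a p])
  also have "\<dots> = ennreal (c * (c powr (a - 1) * v powr p * Beta a (p + 1)))"
  proof -
    have "0 \<le> Beta a (p + 1)" using a p by (simp add: Beta_def Gamma_real_nonneg)
    then show ?thesis using c by (simp add: ennreal_mult)
  qed
  also have "c * (c powr (a - 1) * v powr p * Beta a (p + 1)) = c powr a * v powr p * Beta a (p + 1)"
    using c by (simp add: powr_diff)
  also have "\<dots> = \<sigma> powr - a * Beta a (p + 1) * v powr (a + p)"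
    using v \<sigma> by (simp add: c_def powr_divide powr_minus_divide powr_add)
  finally show ?thesis .
qed

context interpolated_sobolev
begin

context
  fixes g :: real and V :: "'a \<Rightarrow> real" and \<sigma> :: real
  assumes g: "\<gamma> < g" and V: "V \<in> nonneg_Lp M (g + \<kappa>)" and \<sigma>: "0 < \<sigma>" "\<sigma> < 1"
begin

text \<open>The part of the potential that exceeds \<open>\<sigma> \<tau>\<close>.\<close>

definition excess :: "real \<Rightarrow> 'a \<Rightarrow> real" where
  "excess \<tau> x = max 0 (V x - \<sigma> * \<tau>)"

lemma V_measurable [measurable]: "V \<in> borel_measurable M"
  and V_nonneg: "AE x in M. 0 \<le> V x"
  and V_integrable: "integrable M (\<lambda>x. V x powr (g + \<kappa>))"
  using V by (auto simp: nonneg_Lp_def)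

lemma excess_nonneg_Lp:
  assumes \<tau>: "0 < \<tau>"
  shows "excess \<tau> \<in> nonneg_Lp M (\<gamma> + \<kappa>)"
proof -
  have [measurable]: "excess \<tau> \<in> borel_measurable M" unfolding excess_def by measurable
  have "integrable M (\<lambda>x. excess \<tau> x powr (\<gamma> + \<kappa>))"
  proof (rule Bochner_Integration.integrable_bound)
    show "integrable M (\<lambda>x. (\<sigma> * \<tau>) powr (\<gamma> - g) * V x powr (g + \<kappa>))"
      using V_integrable by simp
    have "excess \<tau> x powr (\<gamma> + \<kappa>) \<le> (\<sigma> * \<tau>) powr (\<gamma> - g) * V x powr (g + \<kappa>)" for x
    proof (cases "V x \<le> \<sigma> * \<tau>")
      case True
      then have "excess \<tau> x = 0" by (simp add: excess_def)
      then show ?thesis by simp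
    next
      case False
      have st: "0 < \<sigma> * \<tau>" using \<sigma> \<tau> by simp
      have "excess \<tau> x powr (\<gamma> + \<kappa>) \<le> V x powr (\<gamma> + \<kappa>)"
        using False st gamma_pos kappa_pos by (intro powr_mono2) (auto simp: excess_def)
      also have "V x powr (\<gamma> + \<kappa>) = V x powr (\<gamma> - g) * V x powr (g + \<kappa>)"
        by (simp flip: powr_add)
      also have "\<dots> \<le> (\<sigma> * \<tau>) powr (\<gamma> - g) * V x powr (g + \<kappa>)"
        using False st g by (intro mult_right_mono powr_mono2') auto
      finally show ?thesis .
    qed
    then show "AE x in M. norm (excess \<tau> x powr (\<gamma> + \<kappa>)) \<le> norm ((\<sigma> * \<tau>) powr (\<gamma> - g) * V x powr (g + \<kappa>))"
      by simp
  qed measurable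
  then show ?thesis by (simp add: nonneg_Lp_def) (simp add: excess_def)
qed

lemma V_le_excess: "V x \<le> \<sigma> * \<tau> + excess \<tau> x"
  by (simp add: excess_def)

lemma potential_split:
  assumes \<tau>: "0 < \<tau>" and u: "u \<in> D"
  shows "u \<in> L2 (density M (\<lambda>x. ennreal (V x)))"
    and "vquad V u \<le> \<sigma> * \<tau> * N.quad u + vquad (excess \<tau>) u"
proof -
  note [measurable] = D_measurable[OF u]
  have W: "excess \<tau> \<in> borel_measurable M" "AE x in M. 0 \<le> excess \<tau> x"
    using excess_nonneg_Lp[OF \<tau>] by (auto simp: nonneg_Lp_def)
  note [measurable] = W(1)
  have intW: "integrable M (\<lambda>x. excess \<tau> x * (cmod (u x))\<^sup>2)"
    using nonneg_Lp_admissible[OF excess_nonneg_Lp[OF \<tau>]] u L2_density_iff[OF W] by (simp add: admissible_def)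
  have intN: "integrable M (\<lambda>x. (cmod (u x))\<^sup>2)" by (rule L2_integrable[OF D_L2[OF u]])
  have le: "V x * (cmod (u x))\<^sup>2 \<le> \<sigma> * \<tau> * (cmod (u x))\<^sup>2 + excess \<tau> x * (cmod (u x))\<^sup>2" for x
    using mult_right_mono[OF V_le_excess[of x \<tau>], of "(cmod (u x))\<^sup>2"] by (simp add: distrib_right)
  have intV: "integrable M (\<lambda>x. V x * (cmod (u x))\<^sup>2)"
  proof (rule Bochner_Integration.integrable_bound)
    show "integrable M (\<lambda>x. \<sigma> * \<tau> * (cmod (u x))\<^sup>2 + excess \<tau> x * (cmod (u x))\<^sup>2)"
      using intW intN by simp
    show "AE x in M. norm (V x * (cmod (u x))\<^sup>2) \<le> norm (\<sigma> * \<tau> * (cmod (u x))\<^sup>2 + excess \<tau> x * (cmod (u x))\<^sup>2)"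
      using V_nonneg
    proof eventually_elim
      fix x assume "0 \<le> V x"
      then have "0 \<le> V x * (cmod (u x))\<^sup>2" by simp
      then show "norm (V x * (cmod (u x))\<^sup>2) \<le> norm (\<sigma> * \<tau> * (cmod (u x))\<^sup>2 + excess \<tau> x * (cmod (u x))\<^sup>2)"
        using le[of x] by simp
    qed
  qed measurable
  show "u \<in> L2 (density M (\<lambda>x. ennreal (V x)))"
    using intV L2_density_iff[OF V_measurable V_nonneg] by (simp add: D_measurable[OF u])
  have "vquad V u = (\<integral>x. V x * (cmod (u x))\<^sup>2 \<partial>M)"
    by (rule quad_L2_density[OF V_measurable V_nonneg D_measurable[OF u]])
  also have "\<dots> \<le> (\<integral>x. \<sigma> * \<tau> * (cmod (u x))\<^sup>2 + excess \<tau> x * (cmod (u x))\<^sup>2 \<partial>M)"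
    using intV intW intN le by (intro integral_mono) auto
  also have "\<dots> = \<sigma> * \<tau> * N.quad u + vquad (excess \<tau>) u"
    using intW intN quad_L2_density[OF W D_measurable[OF u]] by (simp add: quad_L2_inner)
  finally show "vquad V u \<le> \<sigma> * \<tau> * N.quad u + vquad (excess \<tau>) u" .
qed

lemma V_admissible: "admissible V"
  unfolding admissible_def using V_measurable V_nonneg potential_split(1)[OF zero_less_one] by blast

text \<open>A part \<open>\<sigma> \<tau>\<close> of the energy shift is absorbed into the potential.\<close>

lemma num_eigenvalues_excess:
  assumes \<tau>: "0 < \<tau>"
  shows "num_eigenvalues_below M (- \<tau>) (schroedinger_op M D t V)
    \<le> num_eigenvalues_below M (- ((1 - \<sigma>) * \<tau>)) (schroedinger_op M D t (excess \<tau>))"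
proof (rule num_eigenvalues_le[OF V_admissible])
  fix n w assume fam: "gap_pos_family (- \<tau>) V n w"
  note W = excess_nonneg_Lp[OF \<tau>]
  interpret gV: hermitian_form fscale D "gap (- \<tau>) V" by (rule hermitian_form_gap[OF V_admissible])
  have "gap_pos_family (- ((1 - \<sigma>) * \<tau>)) (excess \<tau>) n w"
  proof (rule gV.pos_family_mono_form[OF hermitian_form_gap[OF nonneg_Lp_admissible[OF W]] fam])
    fix u assume u: "u \<in> D"
    show "Re (gap (- \<tau>) V u u) \<le> Re (gap (- ((1 - \<sigma>) * \<tau>)) (excess \<tau>) u u)"
      unfolding gap_quad[OF V_admissible u] gap_quad[OF nonneg_Lp_admissible[OF W] u]
      using potential_split(2)[OF \<tau> u] by (simp add: algebra_simps)
  qed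
  then show "of_nat n \<le> num_eigenvalues_below M (- ((1 - \<sigma>) * \<tau>)) (schroedinger_op M D t (excess \<tau>))"
    using \<sigma> \<tau> by (intro pos_index_le_num_eigenvalues[OF W]) auto
qed

text \<open>
  Each eigenvalue \<open>\<mu> < 0\<close> contributes \<open>\<bar>\<mu>\<bar> powr g\<close>, the integral of \<open>g \<tau> powr (g - 1)\<close> over
  \<open>0 < \<tau> < \<bar>\<mu>\<bar>\<close>; so the trace is the integral of \<open>g \<tau> powr (g - 1)\<close> times the number of eigenvalues
  below \<open>-\<tau>\<close>. As there may be uncountably many eigenvalues a priori, this is done for finite
  sets of them.
\<close>

lemma trace_bound:
  assumes M: "sigma_finite_measure M" and L: "0 \<le> L" "weak_LT M D t \<gamma> \<kappa> L"
  shows "trace_neg_part M g (schroedinger_op M D t V)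
    \<le> ennreal (g * L * (1 - \<sigma>) powr - \<gamma> * \<sigma> powr - (g - \<gamma>) * Beta (g - \<gamma>) (\<gamma> + \<kappa> + 1)
        * (\<integral>x. V x powr (g + \<kappa>) \<partial>M))"
proof -
  interpret sigma_finite_measure M by (rule M)
  interpret pair_sigma_finite lborel M ..
  define A where "A = schroedinger_op M D t V"
  define a where "a = g - \<gamma>"
  define p where "p = \<gamma> + \<kappa>"
  define c where "c = g * L * (1 - \<sigma>) powr - \<gamma>"
  define B where "B = \<sigma> powr - a * Beta a (p + 1)"
  have g0: "0 < g" using g gamma_pos by simp
  have a: "0 < a" using g by (simp add: a_def)
  have p: "0 < p" using gamma_pos kappa_pos by (simp add: p_def)
  have c: "0 \<le> c" using g0 L(1) by (simp add: c_def)
  have B: "0 \<le> B" using a p by (simp add: B_def Beta_def Gamma_real_nonneg)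
  define f where "f \<tau> x = ennreal c * (ennreal (\<tau> powr (a - 1) * (max 0 (V x - \<sigma> * \<tau>)) powr p) * indicator {0<..} \<tau>)" for \<tau> x
  have f_meas: "case_prod f \<in> borel_measurable (lborel \<Otimes>\<^sub>M M)"
    unfolding f_def by measurable
  have count: "ennreal (g * \<tau> powr (g - 1)) * num_eigenvalues_below M (- \<tau>) A \<le> (\<integral>\<^sup>+x. f \<tau> x \<partial>M)"
    if \<tau>: "0 < \<tau>" for \<tau>
  proof -
    note W = excess_nonneg_Lp[OF \<tau>]
    have st: "0 < (1 - \<sigma>) * \<tau>" using \<sigma> \<tau> by simp
    have "num_eigenvalues_below M (- \<tau>) A
        \<le> num_eigenvalues_below M (- ((1 - \<sigma>) * \<tau>)) (schroedinger_op M D t (excess \<tau>))"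
      unfolding A_def by (rule num_eigenvalues_excess[OF \<tau>])
    also have "\<dots> \<le> ennreal (L * ((1 - \<sigma>) * \<tau>) powr (- \<gamma>) * (\<integral>x. excess \<tau> x powr p \<partial>M))"
      using L(2) W st unfolding weak_LT_def p_def by blast
    finally have "ennreal (g * \<tau> powr (g - 1)) * num_eigenvalues_below M (- \<tau>) A
        \<le> ennreal (g * \<tau> powr (g - 1)) * ennreal (L * ((1 - \<sigma>) * \<tau>) powr (- \<gamma>) * (\<integral>x. excess \<tau> x powr p \<partial>M))"
      by (rule mult_left_mono) simp
    also have "\<dots> = ennreal (g * \<tau> powr (g - 1) * (L * ((1 - \<sigma>) * \<tau>) powr (- \<gamma>) * (\<integral>x. excess \<tau> x powr p \<partial>M)))"
      using g0 L(1) by (intro ennreal_mult[symmetric]) auto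
    also have "g * \<tau> powr (g - 1) * (L * ((1 - \<sigma>) * \<tau>) powr (- \<gamma>) * (\<integral>x. excess \<tau> x powr p \<partial>M))
        = c * \<tau> powr (a - 1) * (\<integral>x. excess \<tau> x powr p \<partial>M)"
    proof -
      have "a - 1 = (g - 1) + - \<gamma>" by (simp add: a_def)
      then have "\<tau> powr (a - 1) = \<tau> powr (g - 1) * \<tau> powr - \<gamma>" by (simp only: powr_add)
      then show ?thesis by (simp add: c_def powr_mult)
    qed
    also have "ennreal \<dots> = ennreal (c * \<tau> powr (a - 1)) * ennreal (\<integral>x. excess \<tau> x powr p \<partial>M)"
      using c by (intro ennreal_mult) auto
    also have "ennreal (\<integral>x. excess \<tau> x powr p \<partial>M) = (\<integral>\<^sup>+x. ennreal (excess \<tau> x powr p) \<partial>M)"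
      using W by (intro nn_integral_eq_integral[symmetric]) (auto simp: nonneg_Lp_def p_def)
    also have "ennreal (c * \<tau> powr (a - 1)) * \<dots> = (\<integral>\<^sup>+x. ennreal (c * \<tau> powr (a - 1)) * ennreal (excess \<tau> x powr p) \<partial>M)"
      by (rule nn_integral_cmult[symmetric]) (simp add: excess_def)
    also have "\<dots> = (\<integral>\<^sup>+x. f \<tau> x \<partial>M)"
      using \<tau> c unfolding f_def excess_def by (intro nn_integral_cong) (simp add: ennreal_mult mult.assoc)
    finally show ?thesis .
  qed
  have fubini: "(\<integral>\<^sup>+\<tau>. \<integral>\<^sup>+x. f \<tau> x \<partial>M \<partial>lborel) = ennreal (c * B * (\<integral>x. V x powr (g + \<kappa>) \<partial>M))"
  proof -
    have "(\<integral>\<^sup>+\<tau>. \<integral>\<^sup>+x. f \<tau> x \<partial>M \<partial>lborel) = (\<integral>\<^sup>+x. \<integral>\<^sup>+\<tau>. f \<tau> x \<partial>lborel \<partial>M)"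
      by (rule Fubini'[OF f_meas, symmetric])
    also have "\<dots> = (\<integral>\<^sup>+x. ennreal (c * B * V x powr (g + \<kappa>)) \<partial>M)"
    proof (rule nn_integral_cong_AE)
      show "AE x in M. (\<integral>\<^sup>+\<tau>. f \<tau> x \<partial>lborel) = ennreal (c * B * V x powr (g + \<kappa>))"
        using V_nonneg
      proof eventually_elim
        fix x assume v: "0 \<le> V x"
        have "(\<integral>\<^sup>+\<tau>. f \<tau> x \<partial>lborel) = ennreal c * ennreal (\<sigma> powr - a * Beta a (p + 1) * V x powr (a + p))"
          unfolding f_def by (subst nn_integral_cmult) (auto simp: nn_integral_Beta_scaled[OF a p \<sigma>(1) v])
        also have "a + p = g + \<kappa>" by (simp add: a_def p_def)
        finally have "(\<integral>\<^sup>+\<tau>. f \<tau> x \<partial>lborel) = ennreal c * ennreal (B * V x powr (g + \<kappa>))"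
          by (simp only: B_def)
        then show "(\<integral>\<^sup>+\<tau>. f \<tau> x \<partial>lborel) = ennreal (c * B * V x powr (g + \<kappa>))"
          using ennreal_mult[OF c, of "B * V x powr (g + \<kappa>)"] B by (simp add: mult.assoc)
      qed
    qed
    also have "\<dots> = ennreal (\<integral>x. c * B * V x powr (g + \<kappa>) \<partial>M)"
      using V_integrable c B by (intro nn_integral_eq_integral) auto
    finally show ?thesis by simp
  qed
  have "trace_neg_part M g A \<le> (\<integral>\<^sup>+\<tau>. \<integral>\<^sup>+x. f \<tau> x \<partial>M \<partial>lborel)"
    unfolding trace_neg_part_def
  proof (subst nonneg_infsum_complete)
    show "(SUP F\<in>{F. finite F \<and> F \<subseteq> {\<mu>. eigenvalue M A \<mu> \<and> \<mu> < 0}}.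
        \<Sum>\<mu>\<in>F. multiplicity_of M A \<mu> * ennreal (\<bar>\<mu>\<bar> powr g)) \<le> (\<integral>\<^sup>+\<tau>. \<integral>\<^sup>+x. f \<tau> x \<partial>M \<partial>lborel)"
    proof (rule SUP_least)
      fix F assume "F \<in> {F. finite F \<and> F \<subseteq> {\<mu>. eigenvalue M A \<mu> \<and> \<mu> < 0}}"
      then have F: "finite F" "\<And>\<mu>. \<mu> \<in> F \<Longrightarrow> eigenvalue M A \<mu> \<and> \<mu> < 0" by auto
      define k where "k \<tau> \<mu> = ennreal (g * \<tau> powr (g - 1)) * indicator {0<..<- \<mu>} \<tau>" for \<tau> \<mu> :: real
      have k_meas: "(\<lambda>\<tau>. k \<tau> \<mu>) \<in> borel_measurable lborel" for \<mu> unfolding k_def by measurable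
      have "(\<Sum>\<mu>\<in>F. multiplicity_of M A \<mu> * ennreal (\<bar>\<mu>\<bar> powr g))
          = (\<Sum>\<mu>\<in>F. \<integral>\<^sup>+\<tau>. multiplicity_of M A \<mu> * k \<tau> \<mu> \<partial>lborel)"
      proof (rule sum.cong)
        fix \<mu> assume "\<mu> \<in> F"
        then have neg: "\<mu> < 0" using F by blast
        then have "(\<integral>\<^sup>+\<tau>. k \<tau> \<mu> \<partial>lborel) = ennreal ((- \<mu>) powr g)"
          unfolding k_def by (intro nn_integral_powr[OF g0]) simp
        then show "multiplicity_of M A \<mu> * ennreal (\<bar>\<mu>\<bar> powr g) = (\<integral>\<^sup>+\<tau>. multiplicity_of M A \<mu> * k \<tau> \<mu> \<partial>lborel)"
          using neg by (subst nn_integral_cmult[OF k_meas]) simp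
      qed simp
      also have "\<dots> = (\<integral>\<^sup>+\<tau>. (\<Sum>\<mu>\<in>F. multiplicity_of M A \<mu> * k \<tau> \<mu>) \<partial>lborel)"
        by (intro nn_integral_sum[symmetric] borel_measurable_times_ennreal borel_measurable_const k_meas)
      also have "\<dots> \<le> (\<integral>\<^sup>+\<tau>. \<integral>\<^sup>+x. f \<tau> x \<partial>M \<partial>lborel)"
      proof (rule nn_integral_mono)
        fix \<tau> :: real
        show "(\<Sum>\<mu>\<in>F. multiplicity_of M A \<mu> * k \<tau> \<mu>) \<le> (\<integral>\<^sup>+x. f \<tau> x \<partial>M)"
        proof (cases "0 < \<tau>")
          case False
          then have "k \<tau> \<mu> = 0" for \<mu> by (simp add: k_def)
          then show ?thesis by simp
        next
          case True
          define F' where "F' = {\<mu> \<in> F. \<mu> < - \<tau>}"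
          have "(\<Sum>\<mu>\<in>F. multiplicity_of M A \<mu> * k \<tau> \<mu>)
              = (\<Sum>\<mu>\<in>F'. multiplicity_of M A \<mu> * ennreal (g * \<tau> powr (g - 1)))"
            unfolding F'_def using F(1) True
            by (intro sum.mono_neutral_cong_right) (auto simp: k_def indicator_def)
          also have "\<dots> = ennreal (g * \<tau> powr (g - 1)) * (\<Sum>\<mu>\<in>F'. multiplicity_of M A \<mu>)"
            by (subst mult.commute) (rule sum_distrib_right[symmetric])
          also have "\<dots> \<le> ennreal (g * \<tau> powr (g - 1)) * num_eigenvalues_below M (- \<tau>) A"
          proof (rule mult_left_mono)
            have "F' \<in> {F. finite F \<and> F \<subseteq> {\<mu>. eigenvalue M A \<mu> \<and> \<mu> < - \<tau>}}"
              using F by (auto simp: F'_def)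
            then show "(\<Sum>\<mu>\<in>F'. multiplicity_of M A \<mu>) \<le> num_eigenvalues_below M (- \<tau>) A"
              unfolding num_eigenvalues_below_def
              by (subst nonneg_infsum_complete) (auto intro: SUP_upper)
          qed simp
          also have "\<dots> \<le> (\<integral>\<^sup>+x. f \<tau> x \<partial>M)" by (rule count[OF True])
          finally show ?thesis .
        qed
      qed
      finally show "(\<Sum>\<mu>\<in>F. multiplicity_of M A \<mu> * ennreal (\<bar>\<mu>\<bar> powr g)) \<le> (\<integral>\<^sup>+\<tau>. \<integral>\<^sup>+x. f \<tau> x \<partial>M \<partial>lborel)" .
    qed
  qed simp
  also have "\<dots> = ennreal (c * B * (\<integral>x. V x powr (g + \<kappa>) \<partial>M))" by (rule fubini)
  finally show ?thesis by (simp add: A_def c_def B_def a_def p_def mult.assoc)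
qed

end

lemma optimal_split:
  assumes g: "\<gamma> < g"
  defines "\<sigma> \<equiv> (g - \<gamma>) / g"
  shows "0 < \<sigma>" "\<sigma> < 1"
    and "g * L * (1 - \<sigma>) powr - \<gamma> * \<sigma> powr - (g - \<gamma>) * Beta (g - \<gamma>) (\<gamma> + \<kappa> + 1)
      = g powr (g + 1) / (\<gamma> powr \<gamma> * (g - \<gamma>) powr (g - \<gamma>))
          * (Gamma (\<gamma> + \<kappa> + 1) * Gamma (g - \<gamma>) / Gamma (g + \<kappa> + 1)) * L"
proof -
  have g0: "0 < g" using g gamma_pos by simp
  show "0 < \<sigma>" "\<sigma> < 1" using g g0 gamma_pos by (auto simp: \<sigma>_def)
  have "1 - \<sigma> = \<gamma> / g" using g0 by (simp add: \<sigma>_def field_simps)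
  then have "(1 - \<sigma>) powr - \<gamma> = g powr \<gamma> / \<gamma> powr \<gamma>"
    using g0 gamma_pos by (simp add: powr_minus_divide powr_divide)
  moreover have "\<sigma> powr - (g - \<gamma>) = g powr (g - \<gamma>) / (g - \<gamma>) powr (g - \<gamma>)"
    using g0 g unfolding \<sigma>_def powr_minus_divide by (simp add: powr_divide)
  moreover have "g powr (g + 1) = g * (g powr \<gamma> * g powr (g - \<gamma>))"
    using g0 by (simp add: powr_add flip: powr_add[of g \<gamma> "g - \<gamma>"])
  moreover have "Beta (g - \<gamma>) (\<gamma> + \<kappa> + 1) = Gamma (\<gamma> + \<kappa> + 1) * Gamma (g - \<gamma>) / Gamma (g + \<kappa> + 1)"
    by (simp add: Beta_def mult.commute add.assoc[symmetric])
  ultimately show "g * L * (1 - \<sigma>) powr - \<gamma> * \<sigma> powr - (g - \<gamma>) * Beta (g - \<gamma>) (\<gamma> + \<kappa> + 1)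
      = g powr (g + 1) / (\<gamma> powr \<gamma> * (g - \<gamma>) powr (g - \<gamma>))
          * (Gamma (\<gamma> + \<kappa> + 1) * Gamma (g - \<gamma>) / Gamma (g + \<kappa> + 1)) * L"
    by (simp add: mult_ac)
qed

end

theorem corollary2p1:
  fixes M :: "'a measure"
    and D :: "('a \<Rightarrow> complex) set"
    and t :: "'a sform"
    and q \<theta> S \<gamma> \<kappa> :: real
  assumes "sigma_finite_measure M"
    and "nonneg_form M D t"
    and "closed_form M D t"
    and "L2_dense M D"
    and "2 < q" and "0 < \<theta>" and "\<theta> < 1" and "0 < S"
    and sobolev: "\<And>u. u \<in> D \<Longrightarrow>
          integrable M (\<lambda>x. cmod (u x) powr q) \<and>
          S * (\<integral>x. cmod (u x) powr q \<partial>M) powr (2 / q)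
            \<le> qform t u powr \<theta> * L2_norm M u powr (2 * (1 - \<theta>))"
    and "beurling_deny M D t (q / (q - 2))"
    and "\<gamma> = q * (1 - \<theta>) / (q - 2)"
    and "\<kappa> = q * \<theta> / (q - 2)"
  shows "\<exists>L. sharp_weak_LT M D t \<gamma> \<kappa> L \<and>
    (\<forall>\<gamma>'>\<gamma>. \<exists>L'. 0 \<le> L' \<and>
       L' \<le> \<gamma>' powr (\<gamma>' + 1) / (\<gamma> powr \<gamma> * (\<gamma>' - \<gamma>) powr (\<gamma>' - \<gamma>))
              * (Gamma (\<gamma> + \<kappa> + 1) * Gamma (\<gamma>' - \<gamma>) / Gamma (\<gamma>' + \<kappa> + 1)) * L \<and>
       (\<forall>V\<in>nonneg_Lp M (\<gamma>' + \<kappa>).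
          trace_neg_part M \<gamma>' (schroedinger_op M D t V)
            \<le> ennreal (L' * (\<integral>x. V x powr (\<gamma>' + \<kappa>) \<partial>M))))"
proof -
  note BD = \<open>beurling_deny M D t (q / (q - 2))\<close>[unfolded beurling_deny_def]
  interpret interpolated_sobolev M D t q \<theta> S \<gamma> \<kappa>
  proof
    show "(\<lambda>x. complex_of_real (Re (f x))) \<in> D" if "f \<in> D" for f
      using BD that by blast
    show "qform t (\<lambda>x. complex_of_real (u x) + \<i> * complex_of_real (v x)) =
        qform t (\<lambda>x. complex_of_real (u x)) + qform t (\<lambda>x. complex_of_real (v x))"
      if "(\<lambda>x. complex_of_real (u x)) \<in> D" "(\<lambda>x. complex_of_real (v x)) \<in> D" for u v :: "'a \<Rightarrow> real"
      using BD that by blast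
    show "(\<lambda>x. complex_of_real \<bar>u x\<bar>) \<in> D \<and>
        qform t (\<lambda>x. complex_of_real \<bar>u x\<bar>) \<le> qform t (\<lambda>x. complex_of_real (u x))"
      if "(\<lambda>x. complex_of_real (u x)) \<in> D" for u :: "'a \<Rightarrow> real"
      using BD that by blast
  qed (use assms in auto)
  obtain L where L: "sharp_weak_LT M D t \<gamma> \<kappa> L" using sharp_weak_LT_exists by blast
  then have L0: "0 \<le> L" and weak: "weak_LT M D t \<gamma> \<kappa> L" by (auto simp: sharp_weak_LT_def)
  have "\<exists>L'. 0 \<le> L' \<and>
       L' \<le> g powr (g + 1) / (\<gamma> powr \<gamma> * (g - \<gamma>) powr (g - \<gamma>))
              * (Gamma (\<gamma> + \<kappa> + 1) * Gamma (g - \<gamma>) / Gamma (g + \<kappa> + 1)) * L \<and>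
       (\<forall>V\<in>nonneg_Lp M (g + \<kappa>). trace_neg_part M g (schroedinger_op M D t V)
            \<le> ennreal (L' * (\<integral>x. V x powr (g + \<kappa>) \<partial>M)))" if g: "\<gamma> < g" for g
  proof -
    define L' where "L' = g powr (g + 1) / (\<gamma> powr \<gamma> * (g - \<gamma>) powr (g - \<gamma>))
              * (Gamma (\<gamma> + \<kappa> + 1) * Gamma (g - \<gamma>) / Gamma (g + \<kappa> + 1)) * L"
    have "0 \<le> L'"
      unfolding L'_def using g gamma_pos kappa_pos L0
      by (intro mult_nonneg_nonneg divide_nonneg_nonneg Gamma_real_nonneg) auto
    moreover have "trace_neg_part M g (schroedinger_op M D t V) \<le> ennreal (L' * (\<integral>x. V x powr (g + \<kappa>) \<partial>M))"
      if V: "V \<in> nonneg_Lp M (g + \<kappa>)" for V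
      using trace_bound[OF g V optimal_split(1,2)[OF g] assms(1) L0 weak] unfolding optimal_split(3)[OF g] L'_def .
    ultimately show ?thesis unfolding L'_def by blast
  qed
  then show ?thesis using L by blast
qed

end
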